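(* Let $k$ be a field, $q\ge2$, and let $I\subset k[x_1,\ldots,x_n]$ be the initial squarefree lexsegment ideal generated in degree $q$, determined by the monomial $v=x_{j_1}\cdots x_{j_q}$, with $2\leq j_1<\cdots<j_q\leq n$. Then $I$ is sequentially Cohen–Macaulay.
   Context: Monomials are ordered by the lexicographic order with $x_1>x_2>\cdots>x_n$. For a squarefree monomial $v$ of degree $q$, $L^i(v)=\{w: w\text{ a squarefree monomial of degree }q,\ w\geq_{lex}v\}$ and the initial squarefree lexsegment ideal determined by $v$ is $(L^i(v))$. Let $S=k[x_1,\ldots,x_n]$. A finitely generated graded $S$-module $M$ is sequentially Cohen–Macaulay if there is a finite filtration $0=M_0\subset M_1\subset\cdots\subset M_r=M$ by graded submodules such that each $M_i/M_{i-1}$ is Cohen–Macaulay and $\dim(M_1/M_0)<\dim(M_2/M_1)<\cdots<\dim(M_r/M_{r-1})$. An ideal $I\subset S$ is sequentially Cohen–Macaulay if $S/I$ is a sequentially Cohen–Macaulay module. *)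

theory Defs
  imports
    "HOL-Algebra.QuotRing"
    "HOL-Algebra.Module"
    "HOL-Library.Poly_Mapping"
    "HOL-Library.Extended_Nat"
begin

section \<open>Modules over a commutative ring\<close>

text \<open>
  Only the additive group and the scalar multiplication of a module record are meaningful;
  the ring multiplication and unit that the record type also carries play no role below.
\<close>

definition self_module :: "('a, 'c) ring_scheme \<Rightarrow> ('a, 'a) module" where
  "self_module R =
     \<lparr>carrier = carrier R, mult = mult R, one = one R, zero = zero R, add = add R,
      smult = mult R\<rparr>"

definition restrict_module :: "('a, 'b) module \<Rightarrow> 'b set \<Rightarrow> ('a, 'b) module" where
  "restrict_module M N = M\<lparr>carrier := N\<rparr>"

definition quot_module :: "('a, 'b) module \<Rightarrow> 'b set \<Rightarrow> ('a, 'b set) module" where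
  "quot_module M N =
     \<lparr>carrier = a_rcosets\<^bsub>M\<^esub> N, mult = undefined, one = undefined,
      zero = N, add = set_add M,
      smult = (\<lambda>r X. \<Union>x\<in>X. N +>\<^bsub>M\<^esub> (r \<odot>\<^bsub>M\<^esub> x))\<rparr>"

definition module_span :: "('a, 'c) ring_scheme \<Rightarrow> ('a, 'b) module \<Rightarrow> 'b set \<Rightarrow> 'b set" where
  "module_span R M A = \<Inter>{N. submodule N R M \<and> A \<subseteq> N}"

definition finitely_generated :: "('a, 'c) ring_scheme \<Rightarrow> ('a, 'b) module \<Rightarrow> bool" where
  "finitely_generated R M \<longleftrightarrow>
     (\<exists>A. finite A \<and> A \<subseteq> carrier M \<and> module_span R M A = carrier M)"

definition annihilator :: "('a, 'c) ring_scheme \<Rightarrow> ('a, 'b) module \<Rightarrow> 'a set" where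
  "annihilator R M = {r \<in> carrier R. \<forall>u\<in>carrier M. r \<odot>\<^bsub>M\<^esub> u = \<zero>\<^bsub>M\<^esub>}"


section \<open>Dimension, depth and Cohen--Macaulay modules\<close>

text \<open>
  The dimension of the zero ring and of the zero module, and the depth of the zero module, come
  out as \<open>0\<close> instead of \<open>-\<infinity>\<close> and \<open>\<infinity>\<close>; these values are never used, because the zero module is
  treated separately in \<open>cohen_macaulay\<close> and all factors of the filtrations considered
  in \<open>sequentially_cohen_macaulay\<close> are nonzero.
\<close>

definition krull_dim :: "('a, 'c) ring_scheme \<Rightarrow> enat" where
  "krull_dim R =
     Sup {enat l | l. \<exists>P. (\<forall>i\<le>l. primeideal (P i) R) \<and> (\<forall>i<l. P i \<subset> P (Suc i))}"

definition module_dim :: "('a, 'c) ring_scheme \<Rightarrow> ('a, 'b) module \<Rightarrow> enat" where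
  "module_dim R M = krull_dim (R Quot annihilator R M)"

definition nonzerodivisor_on :: "('a, 'b) module \<Rightarrow> 'a \<Rightarrow> bool" where
  "nonzerodivisor_on M x \<longleftrightarrow> (\<forall>u\<in>carrier M. x \<odot>\<^bsub>M\<^esub> u = \<zero>\<^bsub>M\<^esub> \<longrightarrow> u = \<zero>\<^bsub>M\<^esub>)"

text \<open>For a set \<open>X\<close> of scalars this is the submodule \<open>(X)M\<close>.\<close>

definition scalar_span :: "('a, 'c) ring_scheme \<Rightarrow> ('a, 'b) module \<Rightarrow> 'a set \<Rightarrow> 'b set" where
  "scalar_span R M X = module_span R M {x \<odot>\<^bsub>M\<^esub> u | x u. x \<in> X \<and> u \<in> carrier M}"

definition regular_sequence :: "('a, 'c) ring_scheme \<Rightarrow> ('a, 'b) module \<Rightarrow> 'a list \<Rightarrow> bool" where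
  "regular_sequence R M xs \<longleftrightarrow>
     set xs \<subseteq> carrier R \<and>
     (\<forall>i<length xs.
        nonzerodivisor_on (quot_module M (scalar_span R M (set (take i xs)))) (xs ! i)) \<and>
     scalar_span R M (set xs) \<noteq> carrier M"

definition depth :: "('a, 'c) ring_scheme \<Rightarrow> 'a set \<Rightarrow> ('a, 'b) module \<Rightarrow> enat" where
  "depth R \<mm> M = Sup {enat (length xs) | xs. set xs \<subseteq> \<mm> \<and> regular_sequence R M xs}"

text \<open>
  For use with a Noetherian ring \<open>R\<close> that is local with maximal ideal \<open>\<mm>\<close>, or standard graded over
  a field with graded maximal ideal \<open>\<mm>\<close>; in the latter case \<open>M\<close> is meant to be graded.
\<close>

definition cohen_macaulay :: "('a, 'c) ring_scheme \<Rightarrow> 'a set \<Rightarrow> ('a, 'b) module \<Rightarrow> bool" where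
  "cohen_macaulay R \<mm> M \<longleftrightarrow>
     Module.module R M \<and> finitely_generated R M \<and>
     (carrier M = {\<zero>\<^bsub>M\<^esub>} \<or> depth R \<mm> M = module_dim R M)"


section \<open>The polynomial ring in \<open>n\<close> variables\<close>

text \<open>
  Monomials are identified with their exponent vectors, so that multiplication of monomials is
  addition of exponents; the variables are numbered from \<open>1\<close>.
\<close>

type_synonym monomial = "nat \<Rightarrow>\<^sub>0 nat"

definition monomials :: "nat \<Rightarrow> monomial set" where
  "monomials n = {t. Poly_Mapping.keys t \<subseteq> {1..n}}"

definition mdegree :: "monomial \<Rightarrow> nat" where
  "mdegree t = (\<Sum>i\<in>Poly_Mapping.keys t. Poly_Mapping.lookup t i)"

definition mpoly_ring :: "nat \<Rightarrow> (monomial \<Rightarrow>\<^sub>0 'k::field) ring" where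
  "mpoly_ring n =
     \<lparr>carrier = {f. Poly_Mapping.keys f \<subseteq> monomials n}, mult = (*), one = 1, zero = 0, add = (+)\<rparr>"

definition homogeneous :: "nat \<Rightarrow> nat \<Rightarrow> (monomial \<Rightarrow>\<^sub>0 'k::field) set" where
  "homogeneous n d = {f \<in> carrier (mpoly_ring n). \<forall>t\<in>Poly_Mapping.keys f. mdegree t = d}"

definition graded_maximal_ideal :: "nat \<Rightarrow> (monomial \<Rightarrow>\<^sub>0 'k::field) set" where
  "graded_maximal_ideal n =
     Idl\<^bsub>mpoly_ring n\<^esub> ((\<lambda>i. Poly_Mapping.single (Poly_Mapping.single i 1) 1) ` {1..n})"


section \<open>Graded modules and sequential Cohen--Macaulayness\<close>

text \<open>\<open>D d\<close> is the homogeneous component of degree \<open>d\<close>, and \<open>u\<close> is the sum of the \<open>c d\<close>.\<close>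

definition homogeneous_decomposition ::
    "('a, 'b) module \<Rightarrow> (int \<Rightarrow> 'b set) \<Rightarrow> 'b \<Rightarrow> (int \<Rightarrow> 'b) \<Rightarrow> bool" where
  "homogeneous_decomposition M D u c \<longleftrightarrow>
     (\<forall>d. c d \<in> D d) \<and> finite {d. c d \<noteq> \<zero>\<^bsub>M\<^esub>} \<and>
     u = finsum M c {d. c d \<noteq> \<zero>\<^bsub>M\<^esub>}"

definition graded_module ::
    "nat \<Rightarrow> (monomial \<Rightarrow>\<^sub>0 'k::field, 'b) module \<Rightarrow> (int \<Rightarrow> 'b set) \<Rightarrow> bool" where
  "graded_module n M D \<longleftrightarrow>
     Module.module (mpoly_ring n) M \<and>
     (\<forall>d. subgroup (D d) (add_monoid M)) \<and>
     (\<forall>e d. \<forall>f\<in>homogeneous n e. \<forall>u\<in>D d. f \<odot>\<^bsub>M\<^esub> u \<in> D (int e + d)) \<and>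
     (\<forall>u\<in>carrier M. \<exists>!c. homogeneous_decomposition M D u c)"

definition graded_submodule ::
    "nat \<Rightarrow> (monomial \<Rightarrow>\<^sub>0 'k::field, 'b) module \<Rightarrow> (int \<Rightarrow> 'b set) \<Rightarrow> 'b set \<Rightarrow> bool" where
  "graded_submodule n M D N \<longleftrightarrow>
     submodule N (mpoly_ring n) M \<and>
     (\<forall>u\<in>N. \<forall>c. homogeneous_decomposition M D u c \<longrightarrow> (\<forall>d. c d \<in> N))"

definition factor_module ::
    "('a, 'b) module \<Rightarrow> (nat \<Rightarrow> 'b set) \<Rightarrow> nat \<Rightarrow> ('a, 'b set) module" where
  "factor_module M F i = quot_module (restrict_module M (F i)) (F (i - 1))"

definition sequentially_cohen_macaulay ::
    "nat \<Rightarrow> (monomial \<Rightarrow>\<^sub>0 'k::field, 'b) module \<Rightarrow> (int \<Rightarrow> 'b set) \<Rightarrow> bool" where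
  "sequentially_cohen_macaulay n M D \<longleftrightarrow>
     graded_module n M D \<and> finitely_generated (mpoly_ring n) M \<and>
     (\<exists>r F. F 0 = {\<zero>\<^bsub>M\<^esub>} \<and> F r = carrier M \<and>
        (\<forall>i\<le>r. graded_submodule n M D (F i)) \<and>
        (\<forall>i\<in>{1..r}. F (i - 1) \<subset> F i) \<and>
        (\<forall>i\<in>{1..r}. cohen_macaulay (mpoly_ring n) (graded_maximal_ideal n) (factor_module M F i)) \<and>
        (\<forall>i\<in>{1..<r}. module_dim (mpoly_ring n) (factor_module M F i)
                     < module_dim (mpoly_ring n) (factor_module M F (i + 1))))"

definition quot_grading ::
    "nat \<Rightarrow> (monomial \<Rightarrow>\<^sub>0 'k::field) set \<Rightarrow> int \<Rightarrow> (monomial \<Rightarrow>\<^sub>0 'k) set set" where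
  "quot_grading n I d =
     (if d < 0 then {I} else (\<lambda>f. I +>\<^bsub>mpoly_ring n\<^esub> f) ` homogeneous n (nat d))"

definition sequentially_cohen_macaulay_ideal ::
    "nat \<Rightarrow> (monomial \<Rightarrow>\<^sub>0 'k::field) set \<Rightarrow> bool" where
  "sequentially_cohen_macaulay_ideal n I \<longleftrightarrow>
     ideal I (mpoly_ring n) \<and>
     sequentially_cohen_macaulay n (quot_module (self_module (mpoly_ring n)) I) (quot_grading n I)"


section \<open>Initial squarefree lexsegment ideals\<close>

text \<open>
  The order that the library puts on \<^typ>\<open>nat \<Rightarrow>\<^sub>0 nat\<close> compares two exponent vectors at the smallest
  index where they differ. This is the lexicographic order with \<open>x\<^sub>1 > x\<^sub>2 > \<dots> > x\<^sub>n\<close>.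
\<close>

lemma monomial_less_iff:
  fixes v w :: monomial
  shows "v < w \<longleftrightarrow>
    (\<exists>k. Poly_Mapping.lookup v k < Poly_Mapping.lookup w k \<and> (\<forall>k'<k. Poly_Mapping.lookup v k' = Poly_Mapping.lookup w k'))"
  by transfer (simp add: less_fun_def)

definition squarefree_monomials :: "nat \<Rightarrow> nat \<Rightarrow> monomial set" where
  "squarefree_monomials n q =
     {w \<in> monomials n. mdegree w = q \<and> (\<forall>i. Poly_Mapping.lookup w i \<le> 1)}"

definition initial_lexsegment :: "nat \<Rightarrow> monomial \<Rightarrow> monomial set" where
  "initial_lexsegment n v = {w \<in> squarefree_monomials n (mdegree v). v \<le> w}"

definition initial_lexsegment_ideal :: "nat \<Rightarrow> monomial \<Rightarrow> (monomial \<Rightarrow>\<^sub>0 'k::field) set" where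
  "initial_lexsegment_ideal n v =
     Idl\<^bsub>mpoly_ring n\<^esub> ((\<lambda>w. Poly_Mapping.single w 1) ` initial_lexsegment n v)"

end

theory Submission imports Defs begin

text \<open>
  A squarefree monomial ideal is determined by the family of supports of its monomials, an
  up-closed family of subsets of \<open>{1..n}\<close> (\<open>support_ideal\<close>). Let \<open>J\<close> be the support of \<open>v\<close>. The family
  of the lexsegment ideal consists of the sets with at least \<open>q\<close> elements that are contained in
  none of the \<open>q\<close> sets \<open>facet j = {x \<in> J. x < j} \<union> {j<..n}\<close> with \<open>j \<in> J\<close>
  (\<open>initial_lexsegment_ideal_eq\<close>). So the faces of the associated simplicial complex are the
  subsets of the facets together with all sets of fewer than \<open>q\<close> elements.

  This complex is shellable in the nonpure sense. In terms of ideals: the family can be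
  enlarged up to the whole power set by adding one interval \<open>{R..A}\<close> of sets at a time, such
  that all intermediate families are up-closed. The sets of fewer than \<open>q\<close> elements below no
  facet come first; they split into intervals whose top has \<open>q - 1\<close> elements, by branching on
  the smallest element where a set departs from \<open>J\<close>. Then the intervals from \<open>{x \<in> J. x < j}\<close> to
  \<open>facet j\<close> are added for decreasing \<open>j\<close>, and the facets do not get smaller on the way. Intervals
  with tops of the same size are collected into one step of the filtration. The first step is
  nonzero because \<open>{1}\<close> has fewer than \<open>q\<close> elements and is below no facet, as \<open>1 \<notin> J\<close>.

  It remains to see that the quotient of two consecutive ideals is Cohen--Macaulay of
  dimension \<open>d\<close> when all the tops have \<open>d\<close> elements (\<open>shellable_factor_cohen_macaulay\<close>). Adding
  \<open>{R..A}\<close> adds a cyclic module isomorphic to \<open>S/P\<close> up to a shift of degrees, where \<open>S\<close> is the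
  polynomial ring and \<open>P\<close> is generated by the variables outside \<open>A\<close>. The elementary symmetric
  polynomials \<open>e\<^sub>d, \<dots>, e\<^sub>1\<close>, in this order, form a regular sequence on every \<open>S/P\<close> of this kind
  and hence on iterated extensions of such modules (\<open>weakly_regular_cyclic\<close>,
  \<open>weakly_regular_trans\<close>): modulo \<open>P\<close>, the polynomial \<open>e\<^sub>d\<close> is the product of the \<open>d\<close> remaining
  variables, and dividing by this product leaves a module filtered by quotients of the same
  kind with \<open>d - 1\<close> variables. This sequence works over every field, finite ones included. A
  single count of monomials bounds the length of arbitrary regular sequences and of chains of
  prime ideals by \<open>d\<close> (\<open>regular_chain_length_le\<close>): \<open>l\<close> elements of such a chain are algebraically
  independent, while modulo the smaller ideal everything is spanned by monomials in at most \<open>d\<close>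
  variables.
\<close>

abbreviation "lookup \<equiv> Poly_Mapping.lookup"
abbreviation "keys \<equiv> Poly_Mapping.keys"
abbreviation "single \<equiv> Poly_Mapping.single"
abbreviation polys :: "nat \<Rightarrow> (monomial \<Rightarrow>\<^sub>0 'k::field) set" where
  "polys n \<equiv> carrier (mpoly_ring n)"

section \<open>Polynomials and squarefree monomial ideals\<close>

lemma mpoly_ring_sel [simp]:
  "mult (mpoly_ring n) = (*)" "add (mpoly_ring n) = (+)"
  "one (mpoly_ring n) = 1" "zero (mpoly_ring n) = 0"
  by (simp_all add: mpoly_ring_def)

lemma keys_plus_nat: "keys (s + t :: monomial) = keys s \<union> keys t"
  by (auto simp: in_keys_iff lookup_add)

lemma keys_multE:
  assumes "t \<in> keys (f * g)"
  obtains a b where "a \<in> keys f" "b \<in> keys g" "t = a + b"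
  using assms keys_mult[of f g] by blast

lemma keys_uminus: "keys (- f :: 'a \<Rightarrow>\<^sub>0 'b::ab_group_add) = keys f"
  by (auto simp: in_keys_iff)

lemma keys_minus_subset: "keys (f - g :: 'a \<Rightarrow>\<^sub>0 'b::ab_group_add) \<subseteq> keys f \<union> keys g"
  by (auto simp: in_keys_iff lookup_minus)

lemma keys_sum_subset: "keys (sum f X) \<subseteq> (\<Union>x\<in>X. keys (f x))"
proof (induction X rule: infinite_finite_induct)
  case (insert x X)
  then show ?case using keys_add[of "f x" "sum f X"] by auto
qed auto

text \<open>
  Membership of a polynomial in an ideal is mostly checked term by term; this expansion is the
  reason that it suffices.
\<close>

lemma poly_eq_sum_terms: "(\<Sum>t\<in>keys f. single t (lookup f t)) = f"
proof (rule poly_mapping_eqI)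
  fix k
  have "lookup (\<Sum>t\<in>keys f. single t (lookup f t)) k
        = (\<Sum>t\<in>keys f. lookup f t when t = k)"
    by (simp add: lookup_sum lookup_single)
  also have "\<dots> = lookup f k"
    by (auto simp: when_def in_keys_iff)
  finally show "lookup (\<Sum>t\<in>keys f. single t (lookup f t)) k = lookup f k" .
qed

lemma polys_iff: "f \<in> polys n \<longleftrightarrow> (\<forall>t\<in>keys f. keys t \<subseteq> {1..n})"
  by (auto simp: mpoly_ring_def monomials_def)

lemma polys_closed [simp, intro]:
  "0 \<in> polys n" "1 \<in> polys n"
  "f \<in> polys n \<Longrightarrow> g \<in> polys n \<Longrightarrow> f + g \<in> polys n"
  "f \<in> polys n \<Longrightarrow> g \<in> polys n \<Longrightarrow> f - g \<in> polys n"
  "f \<in> polys n \<Longrightarrow> g \<in> polys n \<Longrightarrow> f * g \<in> polys n"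
  "f \<in> polys n \<Longrightarrow> - f \<in> polys n"
proof -
  show "f + g \<in> polys n" if "f \<in> polys n" "g \<in> polys n"
    using that keys_add[of f g] unfolding polys_iff by blast
  show "f - g \<in> polys n" if "f \<in> polys n" "g \<in> polys n"
    using that keys_minus_subset[of f g] unfolding polys_iff by blast
  show "f * g \<in> polys n" if fg: "f \<in> polys n" "g \<in> polys n"
    unfolding polys_iff
  proof
    fix t assume "t \<in> keys (f * g)"
    then obtain a b where "a \<in> keys f" "b \<in> keys g" "t = a + b" by (rule keys_multE)
    then show "keys t \<subseteq> {1..n}" using fg by (auto simp: polys_iff keys_plus_nat)
  qed
qed (auto simp: polys_iff keys_uminus)

lemma polys_sum [intro]: "(\<And>x. x \<in> X \<Longrightarrow> f x \<in> polys n) \<Longrightarrow> sum f X \<in> polys n"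
  by (induction X rule: infinite_finite_induct) auto

lemma polys_power [intro]: "f \<in> polys n \<Longrightarrow> f ^ k \<in> polys n"
  by (induction k) auto

lemma polys_single_0 [simp]: "single 0 c \<in> polys n"
  by (simp add: polys_iff)

lemma cring_mpoly_ring: "cring (mpoly_ring n :: (monomial \<Rightarrow>\<^sub>0 'k::field) ring)"
proof (rule cringI)
  show "abelian_group (mpoly_ring n :: (monomial \<Rightarrow>\<^sub>0 'k::field) ring)"
  proof (rule abelian_groupI)
    fix f :: "monomial \<Rightarrow>\<^sub>0 'k" assume "f \<in> polys n"
    then show "\<exists>g\<in>polys n. g \<oplus>\<^bsub>mpoly_ring n\<^esub> f = \<zero>\<^bsub>mpoly_ring n\<^esub>"
      by (intro bexI[of _ "- f"]) auto
  qed (auto simp: algebra_simps)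
  show "Group.comm_monoid (mpoly_ring n :: (monomial \<Rightarrow>\<^sub>0 'k::field) ring)"
    by (rule comm_monoidI) (auto simp: algebra_simps)
qed (auto simp: algebra_simps)

lemma a_inv_mpoly_ring:
  assumes "f \<in> polys n"
  shows "\<ominus>\<^bsub>mpoly_ring n\<^esub> f = - f"
proof -
  interpret cring "mpoly_ring n :: (monomial \<Rightarrow>\<^sub>0 'k::field) ring" by (rule cring_mpoly_ring)
  show ?thesis
    by (rule minus_equality) (use assms in auto)
qed

lemma ideal_mpoly_ring_iff:
  fixes J :: "(monomial \<Rightarrow>\<^sub>0 'k::field) set"
  shows "ideal J (mpoly_ring n) \<longleftrightarrow>
     J \<subseteq> polys n \<and> 0 \<in> J \<and> (\<forall>f\<in>J. \<forall>g\<in>J. f + g \<in> J) \<and> (\<forall>r\<in>polys n. \<forall>f\<in>J. r * f \<in> J)"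
  (is "?L \<longleftrightarrow> ?R")
proof
  assume ?L
  then interpret ideal J "mpoly_ring n" .
  show ?R
    using a_subset additive_subgroup.zero_closed[OF is_additive_subgroup]
      additive_subgroup.a_closed[OF is_additive_subgroup] I_l_closed by simp
next
  assume R: ?R
  interpret cring "mpoly_ring n :: (monomial \<Rightarrow>\<^sub>0 'k) ring" by (rule cring_mpoly_ring)
  show ?L
  proof (rule idealI)
    show "subgroup J (add_monoid (mpoly_ring n))"
    proof (rule add.subgroupI)
      fix f assume f: "f \<in> J"
      then have "(- 1) * f \<in> J" using R by (metis polys_closed(2) polys_closed(6))
      then show "\<ominus>\<^bsub>mpoly_ring n\<^esub> f \<in> J"
        using f R a_inv_mpoly_ring[of f n] by (auto simp: a_inv_def)
    qed (use R in auto)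
  next
    fix a x :: "monomial \<Rightarrow>\<^sub>0 'k" assume "a \<in> J" "x \<in> polys n"
    then have "x * a \<in> J" using R by blast
    then show "x \<otimes>\<^bsub>mpoly_ring n\<^esub> a \<in> J" "a \<otimes>\<^bsub>mpoly_ring n\<^esub> x \<in> J"
      by (simp_all add: mult.commute[of a x])
  qed (rule ring_axioms)
qed

context
  fixes J :: "(monomial \<Rightarrow>\<^sub>0 'k::field) set" and n
  assumes J: "ideal J (mpoly_ring n)"
begin
lemma ideal_polys: "f \<in> J \<Longrightarrow> f \<in> polys n"
  and ideal_zero: "0 \<in> J"
  and ideal_add: "f \<in> J \<Longrightarrow> g \<in> J \<Longrightarrow> f + g \<in> J"
  and ideal_mult: "r \<in> polys n \<Longrightarrow> f \<in> J \<Longrightarrow> r * f \<in> J"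
  using J unfolding ideal_mpoly_ring_iff by auto

lemma ideal_uminus: "f \<in> J \<Longrightarrow> - f \<in> J"
  using ideal_mult[of "-1" f] by auto

lemma ideal_diff: "f \<in> J \<Longrightarrow> g \<in> J \<Longrightarrow> f - g \<in> J"
  using ideal_add[of f "- g"] ideal_uminus[of g] by auto

lemma ideal_sum: "(\<And>x. x \<in> X \<Longrightarrow> f x \<in> J) \<Longrightarrow> sum f X \<in> J"
  by (induction X rule: infinite_finite_induct) (auto intro: ideal_zero ideal_add)
end

lemma ideal_memI_terms:
  assumes "ideal J (mpoly_ring n)" "\<And>t. t \<in> keys f \<Longrightarrow> single t (lookup f t) \<in> J"
  shows "f \<in> J"
  using ideal_sum[OF assms(1), of "keys f" "\<lambda>t. single t (lookup f t)"] assms(2)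
  by (simp add: poly_eq_sum_terms)

text \<open>
  The families of supports that belong to squarefree monomial ideals of \<open>k[x\<^sub>1,\<dots>,x\<^sub>n]\<close>: their
  complements in the power set are the simplicial complexes.
\<close>

definition up_closed :: "nat \<Rightarrow> nat set set \<Rightarrow> bool" where
  "up_closed n U \<longleftrightarrow> U \<subseteq> Pow {1..n} \<and> (\<forall>B\<in>U. \<forall>B'. B \<subseteq> B' \<and> B' \<subseteq> {1..n} \<longrightarrow> B' \<in> U)"

text \<open>
  The Stanley--Reisner ideal of the complex whose nonfaces form \<open>U\<close>.
\<close>

definition support_ideal :: "nat set set \<Rightarrow> (monomial \<Rightarrow>\<^sub>0 'k::field) set" where
  "support_ideal U = {f. \<forall>t\<in>keys f. keys t \<in> U}"

lemma support_ideal_ideal: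
  assumes "up_closed n U"
  shows "ideal (support_ideal U) (mpoly_ring n)"
  unfolding ideal_mpoly_ring_iff
proof (intro conjI ballI)
  show "(support_ideal U :: (monomial \<Rightarrow>\<^sub>0 'a) set) \<subseteq> polys n"
  proof
    fix f :: "monomial \<Rightarrow>\<^sub>0 'a" assume "f \<in> support_ideal U"
    then have "\<forall>t\<in>keys f. keys t \<in> Pow {1..n}"
      using assms unfolding support_ideal_def up_closed_def by blast
    then show "f \<in> polys n" unfolding polys_iff by blast
  qed
  fix r f :: "monomial \<Rightarrow>\<^sub>0 'a" assume r: "r \<in> polys n" and f: "f \<in> support_ideal U"
  show "r * f \<in> support_ideal U"
    unfolding support_ideal_def
  proof (intro CollectI ballI)
    fix t assume "t \<in> keys (r * f)"
    then obtain a b where ab: "a \<in> keys r" "b \<in> keys f" "t = a + b" by (rule keys_multE)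
    then have "keys b \<in> U" "keys b \<subseteq> keys t" "keys t \<subseteq> {1..n}"
      using r f assms by (auto simp: support_ideal_def polys_iff keys_plus_nat up_closed_def)
    then show "keys t \<in> U" using assms by (auto simp: up_closed_def)
  qed
qed (auto simp: support_ideal_def dest!: subsetD[OF keys_add])

lemma support_ideal_Pow: "support_ideal (Pow {1..n}) = polys n"
  unfolding set_eq_iff support_ideal_def polys_iff mem_Collect_eq Pow_iff by simp

lemma support_ideal_mono: "U \<subseteq> V \<Longrightarrow> support_ideal U \<subseteq> support_ideal V"
  by (auto simp: support_ideal_def)

definition sqfree :: "nat set \<Rightarrow> monomial" where
  "sqfree B = (\<Sum>i\<in>B. single i 1)"

lemma lookup_sqfree: "finite B \<Longrightarrow> lookup (sqfree B) i = (if i \<in> B then 1 else 0)"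
  by (auto simp: sqfree_def lookup_sum lookup_single when_def)

lemma keys_sqfree: "finite B \<Longrightarrow> keys (sqfree B) = B"
  by (auto simp: in_keys_iff lookup_sqfree split: if_splits)

lemma sqfree_insert: "finite B \<Longrightarrow> a \<notin> B \<Longrightarrow> sqfree (insert a B) = single a 1 + sqfree B"
  by (simp add: sqfree_def)

lemma monomial_cofactor:
  fixes t u :: monomial
  assumes "\<And>i. lookup u i \<le> lookup t i"
  shows "t = (t - u) + u"
  using assms by (intro poly_mapping_eqI) (simp add: lookup_add lookup_minus)

lemma keys_diff_monomial: "keys (t - u :: monomial) \<subseteq> keys t"
  by (auto simp: in_keys_iff lookup_minus)

lemma sqfree_dvd:
  assumes "B \<subseteq> keys t"
  obtains s where "t = s + sqfree B" "keys s \<subseteq> keys t"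
proof
  have fB: "finite B" by (rule finite_subset[OF assms]) simp
  show "t = (t - sqfree B) + sqfree B"
    using assms fB by (intro monomial_cofactor) (auto simp: lookup_sqfree in_keys_iff Suc_le_eq)
qed (rule keys_diff_monomial)

section \<open>Prime ideals generated by variables\<close>

text \<open>
  The prime ideal generated by the variables outside \<open>A\<close>; its residue ring is the polynomial
  ring in the variables of \<open>A\<close>.
\<close>

definition face_ideal :: "nat \<Rightarrow> nat set \<Rightarrow> (monomial \<Rightarrow>\<^sub>0 'k::field) set" where
  "face_ideal n A = support_ideal {B. B \<subseteq> {1..n} \<and> \<not> B \<subseteq> A}"

lemma mem_face_ideal_iff:
  "f \<in> face_ideal n A \<longleftrightarrow> f \<in> polys n \<and> (\<forall>t\<in>keys f. \<not> keys t \<subseteq> A)"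
  unfolding face_ideal_def support_ideal_def polys_iff by blast

lemma face_ideal_ideal: "ideal (face_ideal n A) (mpoly_ring n)"
  unfolding face_ideal_def by (rule support_ideal_ideal) (auto simp: up_closed_def)

definition poly_part :: "(monomial \<Rightarrow> bool) \<Rightarrow> (monomial \<Rightarrow>\<^sub>0 'k::field) \<Rightarrow> (monomial \<Rightarrow>\<^sub>0 'k)" where
  "poly_part P f = (\<Sum>t\<in>{t\<in>keys f. P t}. single t (lookup f t))"

lemma lookup_poly_part: "lookup (poly_part P f) t = (if P t then lookup f t else 0)"
proof -
  have "lookup (poly_part P f) t = (\<Sum>s\<in>{t\<in>keys f. P t}. if s = t then lookup f s else 0)"
    unfolding poly_part_def lookup_sum lookup_single when_def by simp
  also have "\<dots> = (if t \<in> {t\<in>keys f. P t} then lookup f t else 0)"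
    by (subst sum.delta) auto
  also have "\<dots> = (if P t then lookup f t else 0)"
    by (auto simp: in_keys_iff)
  finally show ?thesis .
qed

lemma keys_poly_part: "keys (poly_part P f) = {t\<in>keys f. P t}"
  unfolding set_eq_iff in_keys_iff[of _ "poly_part P f"] lookup_poly_part mem_Collect_eq
  by (simp add: in_keys_iff[of _ f])

abbreviation restrict_vars :: "nat set \<Rightarrow> (monomial \<Rightarrow>\<^sub>0 'k::field) \<Rightarrow> (monomial \<Rightarrow>\<^sub>0 'k)" where
  "restrict_vars A \<equiv> poly_part (\<lambda>t. keys t \<subseteq> A)"

lemma restrict_vars_polys: "f \<in> polys n \<Longrightarrow> restrict_vars A f \<in> polys n"
  by (simp add: polys_iff keys_poly_part)

lemma face_ideal_restrict: "f \<in> polys n \<Longrightarrow> f \<in> face_ideal n A \<longleftrightarrow> restrict_vars A f = 0"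
  unfolding mem_face_ideal_iff poly_mapping_eq_iff fun_eq_iff lookup_poly_part
  by (auto simp: in_keys_iff)

text \<open>
  Deleting all terms that involve a variable outside \<open>A\<close> is multiplicative modulo the ideal and
  has the ideal as its kernel, so primeness follows from the absence of zero divisors among
  polynomials.
\<close>

lemma face_ideal_prime:
  assumes fg: "f \<in> polys n" "g \<in> polys n" and "f * g \<in> face_ideal n A"
  shows "f \<in> face_ideal n A \<or> g \<in> face_ideal n A"
proof -
  let ?r = "restrict_vars A"
  have diff: "h - ?r h \<in> face_ideal n A" if "h \<in> polys n" for h :: "monomial \<Rightarrow>\<^sub>0 'a"
    unfolding mem_face_ideal_iff
    using that restrict_vars_polys[OF that, of A]
    by (auto simp: in_keys_iff lookup_minus lookup_poly_part split: if_splits)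
  have rp: "?r f \<in> polys n" "?r g \<in> polys n" using fg by (auto intro: restrict_vars_polys)
  have "?r f * ?r g = f * g - (g * (f - ?r f) + ?r f * (g - ?r g))"
    by (simp add: algebra_simps)
  also have "\<dots> \<in> face_ideal n A"
    by (rule ideal_diff[OF face_ideal_ideal assms(3) ideal_add[OF face_ideal_ideal
          ideal_mult[OF face_ideal_ideal fg(2) diff[OF fg(1)]]
          ideal_mult[OF face_ideal_ideal rp(1) diff[OF fg(2)]]]])
  finally have *: "?r f * ?r g \<in> face_ideal n A" .
  have "keys (?r f * ?r g) = {}"
  proof -
    have "keys t \<subseteq> A" if "t \<in> keys (?r f * ?r g)" for t
      using that by (rule keys_multE) (auto simp: keys_poly_part keys_plus_nat)
    then show ?thesis using * unfolding mem_face_ideal_iff by blast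
  qed
  then have "?r f * ?r g = 0" by simp
  then show ?thesis using fg by (auto simp: face_ideal_restrict)
qed

lemma one_notin_face_ideal: "1 \<notin> face_ideal n A"
  by (simp add: mem_face_ideal_iff)

text \<open>
  Multiplication by a monomial shifts exponents without cancellation.
\<close>

lemma lookup_times_single: "lookup (f * single s (1::'k::field)) (t + s) = lookup f (t::monomial)"
proof -
  have "f * single s 1 = (\<Sum>u\<in>keys f. single (u + s) (lookup f u))"
    by (subst (1) poly_eq_sum_terms[of f, symmetric]) (simp add: sum_distrib_right mult_single)
  then show ?thesis
    by (simp add: lookup_sum lookup_single when_def in_keys_iff sum.delta cong: if_cong)
qed

section \<open>Regular sequences on quotients of ideals\<close>

definition ideal_plus :: "(monomial \<Rightarrow>\<^sub>0 'k::field) set \<Rightarrow> (monomial \<Rightarrow>\<^sub>0 'k) set \<Rightarrow> (monomial \<Rightarrow>\<^sub>0 'k) set"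
    (infixl \<open>\<boxplus>\<close> 65) where
  "J \<boxplus> K = {a + b | a b. a \<in> J \<and> b \<in> K}"

text \<open>
  Regularity of a sequence on the module \<open>J/J'\<close>, without the requirement that the final quotient
  be nonzero. Working with pairs of ideals of one ring avoids iterated quotient modules.
\<close>

fun weakly_regular ::
    "(monomial \<Rightarrow>\<^sub>0 'k::field) list \<Rightarrow> (monomial \<Rightarrow>\<^sub>0 'k) set \<Rightarrow> (monomial \<Rightarrow>\<^sub>0 'k) set \<Rightarrow> bool" where
  "weakly_regular [] J' J \<longleftrightarrow> True"
| "weakly_regular (y # ys) J' J \<longleftrightarrow>
     (\<forall>u\<in>J. y * u \<in> J' \<longrightarrow> u \<in> J') \<and> weakly_regular ys (J' \<boxplus> (*) y ` J) J"

lemma ideal_plusI: "a \<in> J \<Longrightarrow> b \<in> K \<Longrightarrow> a + b \<in> J \<boxplus> K"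
  by (auto simp: ideal_plus_def)

lemma ideal_plusE:
  assumes "x \<in> J \<boxplus> K"
  obtains a b where "a \<in> J" "b \<in> K" "x = a + b"
  using assms by (auto simp: ideal_plus_def)

lemma ideal_plus_mono: "J \<subseteq> J' \<Longrightarrow> K \<subseteq> K' \<Longrightarrow> J \<boxplus> K \<subseteq> J' \<boxplus> K'"
  by (fastforce simp: ideal_plus_def)

lemma ideal_plus_ideal:
  fixes J K :: "(monomial \<Rightarrow>\<^sub>0 'k::field) set"
  assumes J: "ideal J (mpoly_ring n)" and K: "ideal K (mpoly_ring n)"
  shows "ideal (J \<boxplus> K) (mpoly_ring n)"
  unfolding ideal_mpoly_ring_iff
proof (intro conjI ballI)
  show "J \<boxplus> K \<subseteq> polys n"
    using ideal_polys[OF J] ideal_polys[OF K] by (auto elim!: ideal_plusE)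
  show "0 \<in> J \<boxplus> K"
    using ideal_plusI[OF ideal_zero[OF J] ideal_zero[OF K]] by simp
next
  fix f g :: "monomial \<Rightarrow>\<^sub>0 'k" assume "f \<in> J \<boxplus> K" "g \<in> J \<boxplus> K"
  then obtain a b c d where "a \<in> J" "c \<in> J" "b \<in> K" "d \<in> K" "f = a + b" "g = c + d"
    by (auto elim!: ideal_plusE)
  then show "f + g \<in> J \<boxplus> K"
    using ideal_plusI[OF ideal_add[OF J, of a c] ideal_add[OF K, of b d]]
    by (simp add: algebra_simps)
next
  fix r f :: "monomial \<Rightarrow>\<^sub>0 'k" assume "r \<in> polys n" "f \<in> J \<boxplus> K"
  then obtain a b where "a \<in> J" "b \<in> K" "f = a + b" "r \<in> polys n"
    by (auto elim!: ideal_plusE)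
  then show "r * f \<in> J \<boxplus> K"
    using ideal_plusI[OF ideal_mult[OF J, of r a] ideal_mult[OF K, of r b]]
    by (simp add: algebra_simps)
qed

lemma ideal_scale_ideal:
  fixes J :: "(monomial \<Rightarrow>\<^sub>0 'k::field) set"
  assumes J: "ideal J (mpoly_ring n)" and y: "y \<in> polys n"
  shows "ideal ((*) y ` J) (mpoly_ring n)"
  unfolding ideal_mpoly_ring_iff
proof (intro conjI ballI)
  show "(*) y ` J \<subseteq> polys n" using y ideal_polys[OF J] by auto
  show "0 \<in> (*) y ` J" using ideal_zero[OF J] by force
  fix f :: "monomial \<Rightarrow>\<^sub>0 'k" assume f: "f \<in> (*) y ` J"
  then obtain a where a: "a \<in> J" "f = y * a" by auto
  { fix g assume "g \<in> (*) y ` J"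
    then obtain b where b: "b \<in> J" "g = y * b" by auto
    then show "f + g \<in> (*) y ` J"
      using a ideal_add[OF J, of a b] by (auto simp: distrib_left[symmetric]) }
  { fix r :: "monomial \<Rightarrow>\<^sub>0 'k" assume "r \<in> polys n"
    then have "y * (r * a) \<in> (*) y ` J" using ideal_mult[OF J, of r a] a by blast
    then show "r * f \<in> (*) y ` J" using a by (simp add: algebra_simps) }
qed

lemma ideal_plus_left: "ideal K (mpoly_ring n) \<Longrightarrow> J \<subseteq> J \<boxplus> K"
  using ideal_plusI[of _ J 0 K] ideal_zero by fastforce

lemma ideal_plus_right: "ideal J (mpoly_ring n) \<Longrightarrow> K \<subseteq> J \<boxplus> K"
  using ideal_plusI[of 0 J _ K] ideal_zero by fastforce

lemma ideal_plus_least: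
  assumes "ideal L (mpoly_ring n)" "J \<subseteq> L" "K \<subseteq> L"
  shows "J \<boxplus> K \<subseteq> L"
  using assms by (auto elim!: ideal_plusE intro!: ideal_add)

lemma weakly_regular_refl:
  assumes "ideal J (mpoly_ring n)" "set ys \<subseteq> polys n"
  shows "weakly_regular ys J J"
  using assms(2)
proof (induction ys)
  case (Cons y ys)
  have i: "ideal ((*) y ` J) (mpoly_ring n)"
    using Cons.prems assms(1) by (auto intro: ideal_scale_ideal)
  have "(*) y ` J \<subseteq> J" using Cons.prems assms(1) by (auto intro: ideal_mult)
  then have "J \<boxplus> (*) y ` J = J"
    using ideal_plus_least[OF assms(1), of J] ideal_plus_left[OF i, of J] by auto
  then show ?case using Cons by simp
qed simp

text \<open>
  If \<open>J \<inter> K \<subseteq> J'\<close>, the inclusion of \<open>J\<close> into \<open>J + K\<close> induces an isomorphism of \<open>J/J'\<close> with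
  \<open>(J + K)/(J' + K)\<close>, and regularity is invariant under isomorphism.
\<close>

lemma weakly_regular_transfer:
  assumes "ideal J' (mpoly_ring n)" "ideal J (mpoly_ring n)" and K: "ideal K (mpoly_ring n)"
    and "J' \<subseteq> J" "J \<inter> K \<subseteq> J'" "set ys \<subseteq> polys n" "weakly_regular ys J' J"
  shows "weakly_regular ys (J' \<boxplus> K) (J \<boxplus> K)"
  using assms
proof (induction ys arbitrary: J')
  case (Cons y ys)
  note J' = \<open>ideal J' (mpoly_ring n)\<close> and J = \<open>ideal J (mpoly_ring n)\<close>
  have y: "y \<in> polys n" using Cons.prems by auto
  have nzd: "u \<in> J'" if "u \<in> J" "y * u \<in> J'" for u using Cons.prems(7) that by auto
  have wr: "weakly_regular ys (J' \<boxplus> (*) y ` J) J" using Cons.prems(7) by simp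
  note yJ = ideal_scale_ideal[OF J y]
  note J'yJ = ideal_plus_ideal[OF J' yJ]
  have sub: "J' \<boxplus> (*) y ` J \<subseteq> J"
    using Cons.prems(4) y by (intro ideal_plus_least[OF J]) (auto intro: ideal_mult[OF J])
  have "weakly_regular ys ((J' \<boxplus> (*) y ` J) \<boxplus> K) (J \<boxplus> K)"
    by (rule Cons.IH[OF J'yJ J K sub _ _ wr])
       (use Cons.prems ideal_plus_left[OF yJ, of J'] in auto)
  also have "(J' \<boxplus> (*) y ` J) \<boxplus> K = (J' \<boxplus> K) \<boxplus> (*) y ` (J \<boxplus> K)"
  proof (intro equalityI subsetI)
    fix x assume "x \<in> (J' \<boxplus> (*) y ` J) \<boxplus> K"
    then obtain a b k where abk: "a \<in> J'" "b \<in> J" "k \<in> K" "x = a + y * b + k"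
      by (auto elim!: ideal_plusE)
    then have "b + 0 \<in> J \<boxplus> K" using ideal_zero[OF K] by (intro ideal_plusI)
    then have "(a + k) + y * b \<in> (J' \<boxplus> K) \<boxplus> (*) y ` (J \<boxplus> K)"
      using abk by (intro ideal_plusI) auto
    then show "x \<in> (J' \<boxplus> K) \<boxplus> (*) y ` (J \<boxplus> K)" using abk by (simp add: algebra_simps)
  next
    fix x assume "x \<in> (J' \<boxplus> K) \<boxplus> (*) y ` (J \<boxplus> K)"
    then obtain a b k l where abk: "a \<in> J'" "b \<in> J" "k \<in> K" "l \<in> K" "x = a + k + y * (b + l)"
      by (auto elim!: ideal_plusE)
    then have "(a + y * b) + (k + y * l) \<in> (J' \<boxplus> (*) y ` J) \<boxplus> K"
      using y by (intro ideal_plusI ideal_add[OF K] ideal_mult[OF K]) auto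
    then show "x \<in> (J' \<boxplus> (*) y ` J) \<boxplus> K" using abk by (simp add: algebra_simps)
  qed
  finally have *: "weakly_regular ys ((J' \<boxplus> K) \<boxplus> (*) y ` (J \<boxplus> K)) (J \<boxplus> K)" .
  have "u \<in> J' \<boxplus> K" if "u \<in> J \<boxplus> K" "y * u \<in> J' \<boxplus> K" for u
  proof -
    obtain a k where ak: "a \<in> J" "k \<in> K" "u = a + k" using \<open>u \<in> J \<boxplus> K\<close> by (rule ideal_plusE)
    obtain b l where bl: "b \<in> J'" "l \<in> K" "y * u = b + l"
      using \<open>y * u \<in> J' \<boxplus> K\<close> by (rule ideal_plusE)
    have e: "y * a - b = l - y * k" using ak bl by (simp add: algebra_simps)
    have "y * a - b \<in> J"
      using ak bl y Cons.prems(4) by (intro ideal_diff[OF J] ideal_mult[OF J]) auto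
    moreover have "y * a - b \<in> K"
      unfolding e using ak bl y by (intro ideal_diff[OF K] ideal_mult[OF K]) auto
    ultimately have "y * a - b \<in> J'" using Cons.prems(5) by auto
    then have "y * a \<in> J'" using ideal_add[OF J', of "y * a - b" b] bl by simp
    then show ?thesis using nzd ak by (auto intro: ideal_plusI)
  qed
  then show ?case using * by simp
qed simp

text \<open>
  The first element \<open>y\<close> of the sequence is injective on \<open>K2/K1\<close>. Hence \<open>(K1/K0)/y(K1/K0)\<close> embeds in
  \<open>(K2/K0)/y(K2/K0)\<close>, with cokernel \<open>(K2/K1)/y(K2/K1)\<close>, and the rest of the sequence meets an
  extension of the same kind.
\<close>

lemma weakly_regular_trans:
  assumes "ideal K0 (mpoly_ring n)" "ideal K1 (mpoly_ring n)" "ideal K2 (mpoly_ring n)"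
    and "K0 \<subseteq> K1" "K1 \<subseteq> K2" "set ys \<subseteq> polys n"
    and "weakly_regular ys K0 K1" "weakly_regular ys K1 K2"
  shows "weakly_regular ys K0 K2"
  using assms
proof (induction ys arbitrary: K0 K1)
  case (Cons y ys)
  note K0 = \<open>ideal K0 (mpoly_ring n)\<close> and K1 = \<open>ideal K1 (mpoly_ring n)\<close>
    and K2 = \<open>ideal K2 (mpoly_ring n)\<close>
  have y: "y \<in> polys n" and ys: "set ys \<subseteq> polys n" using Cons.prems by auto
  have n01: "u \<in> K0" if "u \<in> K1" "y * u \<in> K0" for u using Cons.prems(7) that by auto
  have n12: "u \<in> K1" if "u \<in> K2" "y * u \<in> K1" for u using Cons.prems(8) that by auto
  note yK1 = ideal_scale_ideal[OF K1 y] and yK2 = ideal_scale_ideal[OF K2 y]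
  note I0 = ideal_plus_ideal[OF K0 yK2] and I1 = ideal_plus_ideal[OF K1 yK2]
  have I: "ideal (K0 \<boxplus> (*) y ` K1) (mpoly_ring n)" by (rule ideal_plus_ideal[OF K0 yK1])
  have sub: "K0 \<boxplus> (*) y ` K1 \<subseteq> K1"
    using Cons.prems(4) y by (intro ideal_plus_least[OF K1]) (auto intro: ideal_mult[OF K1])
  \<comment> \<open>The embedding: an element of \<open>K1\<close> that lies in \<open>K0 + y K2\<close> already lies in \<open>K0 + y K1\<close>.\<close>
  have cap: "K1 \<inter> (K0 \<boxplus> (*) y ` K2) \<subseteq> K0 \<boxplus> (*) y ` K1"
  proof
    fix x assume "x \<in> K1 \<inter> (K0 \<boxplus> (*) y ` K2)"
    then obtain a b where ab: "a \<in> K0" "b \<in> K2" "x = a + y * b" "x \<in> K1"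
      by (auto elim!: ideal_plusE)
    then have "y * b \<in> K1"
      using ideal_diff[OF K1, of x a] Cons.prems(4) by auto
    then show "x \<in> K0 \<boxplus> (*) y ` K1" using ab n12 by (auto intro: ideal_plusI)
  qed
  have "weakly_regular ys ((K0 \<boxplus> (*) y ` K1) \<boxplus> (K0 \<boxplus> (*) y ` K2)) (K1 \<boxplus> (K0 \<boxplus> (*) y ` K2))"
    using Cons.prems(7) by (intro weakly_regular_transfer[OF I K1 I0 sub cap ys]) simp
  also have "(K0 \<boxplus> (*) y ` K1) \<boxplus> (K0 \<boxplus> (*) y ` K2) = K0 \<boxplus> (*) y ` K2"
  proof (rule equalityI)
    have "(*) y ` K1 \<subseteq> (*) y ` K2" using Cons.prems(5) by auto
    then have "(*) y ` K1 \<subseteq> K0 \<boxplus> (*) y ` K2" using ideal_plus_right[OF K0] by blast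
    then show "(K0 \<boxplus> (*) y ` K1) \<boxplus> (K0 \<boxplus> (*) y ` K2) \<subseteq> K0 \<boxplus> (*) y ` K2"
      by (intro ideal_plus_least[OF I0] ideal_plus_left[OF yK2] order_refl)
  qed (rule ideal_plus_right[OF I])
  also have "K1 \<boxplus> (K0 \<boxplus> (*) y ` K2) = K1 \<boxplus> (*) y ` K2"
  proof (rule equalityI)
    have "K0 \<subseteq> K1 \<boxplus> (*) y ` K2" "K1 \<subseteq> K1 \<boxplus> (*) y ` K2"
      using ideal_plus_left[OF yK2, of K1] Cons.prems(4) by auto
    then show "K1 \<boxplus> (K0 \<boxplus> (*) y ` K2) \<subseteq> K1 \<boxplus> (*) y ` K2"
      by (intro ideal_plus_least[OF I1] ideal_plus_right[OF K1])
    have "(*) y ` K2 \<subseteq> K1 \<boxplus> (K0 \<boxplus> (*) y ` K2)"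
      using ideal_plus_right[OF K0, of "(*) y ` K2"]
        ideal_plus_right[OF K1, of "K0 \<boxplus> (*) y ` K2"] by blast
    then show "K1 \<boxplus> (*) y ` K2 \<subseteq> K1 \<boxplus> (K0 \<boxplus> (*) y ` K2)"
      by (intro ideal_plus_least[OF ideal_plus_ideal[OF K1 I0]] ideal_plus_left[OF I0])
  qed
  finally have wr1: "weakly_regular ys (K0 \<boxplus> (*) y ` K2) (K1 \<boxplus> (*) y ` K2)" .
  have wr2: "weakly_regular ys (K1 \<boxplus> (*) y ` K2) K2" using Cons.prems(8) by simp
  have s1: "K0 \<boxplus> (*) y ` K2 \<subseteq> K1 \<boxplus> (*) y ` K2"
    using Cons.prems(4) by (auto simp: ideal_plus_def)
  have s2: "K1 \<boxplus> (*) y ` K2 \<subseteq> K2"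
    using Cons.prems(5) y by (intro ideal_plus_least[OF K2]) (auto intro: ideal_mult[OF K2])
  have "weakly_regular ys (K0 \<boxplus> (*) y ` K2) K2"
    by (rule Cons.IH[OF I0 I1 K2 s1 s2 ys wr1 wr2])
  moreover have "u \<in> K0" if "u \<in> K2" "y * u \<in> K0" for u
    using that n01 n12 Cons.prems(4) by blast
  ultimately show ?case by simp
qed simp

section \<open>Elementary symmetric polynomials\<close>

definition esym :: "nat \<Rightarrow> nat \<Rightarrow> (monomial \<Rightarrow>\<^sub>0 'k::field)" where
  "esym n d = (\<Sum>C\<in>{C. C \<subseteq> {1..n} \<and> card C = d}. single (sqfree C) 1)"

text \<open>
  The order \<open>e\<^sub>d, \<dots>, e\<^sub>1\<close> matters: when its turn comes, each polynomial acts as a single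
  squarefree monomial on the cyclic factors that occur.
\<close>

fun esyms :: "nat \<Rightarrow> nat \<Rightarrow> (monomial \<Rightarrow>\<^sub>0 'k::field) list" where
  "esyms n 0 = []"
| "esyms n (Suc d) = esym n (Suc d) # esyms n d"

lemma sqfree_polys: "C \<subseteq> {1..n} \<Longrightarrow> single (sqfree C) c \<in> polys n"
  using finite_subset[of C "{1..n}"] by (auto simp: polys_iff keys_sqfree)

lemma esym_polys: "esym n d \<in> polys n"
  unfolding esym_def by (rule polys_sum, rule sqfree_polys) simp

lemma length_esyms: "length (esyms n d) = d"
  by (induction d) auto

lemma esyms_polys: "set (esyms n d) \<subseteq> polys n"
  by (induction d) (auto simp: esym_polys)

text \<open>
  Only the product of all variables of \<open>A\<close> survives, since any other set of \<open>d\<close> variables contains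
  one outside \<open>A\<close>.
\<close>

lemma esym_mod_face_ideal:
  assumes "A \<subseteq> {1..n}" "card A = d"
  shows "esym n d - single (sqfree A) 1 \<in> face_ideal n A"
proof -
  let ?X = "{C. C \<subseteq> {1..n} \<and> card C = d}"
  have fin: "finite ?X" by simp
  have "esym n d - single (sqfree A) 1 = (\<Sum>C\<in>?X - {A}. single (sqfree C) 1)"
    unfolding esym_def using assms fin by (subst sum.remove[of ?X A]) auto
  also have "\<dots> \<in> face_ideal n A"
  proof (rule ideal_sum[OF face_ideal_ideal])
    fix C assume "C \<in> ?X - {A}"
    then have C: "C \<subseteq> {1..n}" "card C = d" "C \<noteq> A" by auto
    have fC: "finite C" "finite A"
      using finite_subset[OF C(1)] finite_subset[OF assms(1)] by auto
    then have "\<not> C \<subseteq> A" using card_subset_eq[of A C] C assms by auto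
    then show "single (sqfree C) 1 \<in> face_ideal n A"
      using C fC sqfree_polys[of C n] by (simp add: mem_face_ideal_iff keys_sqfree)
  qed
  finally show ?thesis .
qed

lemma esym_notin_face_ideal:
  assumes "A \<subseteq> {1..n}" "card A = d"
  shows "esym n d \<notin> (face_ideal n A :: (monomial \<Rightarrow>\<^sub>0 'k::field) set)"
proof
  assume "esym n d \<in> (face_ideal n A :: (monomial \<Rightarrow>\<^sub>0 'k) set)"
  from ideal_diff[OF face_ideal_ideal this esym_mod_face_ideal[OF assms]]
  have "single (sqfree A) (1::'k) \<in> face_ideal n A" by simp
  then show False
    using finite_subset[OF assms(1)] by (simp add: mem_face_ideal_iff keys_sqfree)
qed

text \<open>
  The assumptions say that the generator \<open>g\<close> of the cyclic module \<open>(J + (g))/J\<close> has annihilator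
  \<open>face_ideal n A\<close>. The first polynomial acts as the product \<open>X A\<close> of the \<open>d\<close> variables in \<open>A\<close>, a
  nonzero element of a domain. The quotient by it is filtered by the submodules generated by
  the residues of \<open>X B g\<close>, where \<open>B\<close> runs through a chain of sets from \<open>A\<close> down to the empty set;
  the generator that comes with the removal of \<open>b\<close> from \<open>B\<close> is annihilated modulo the previous
  submodule exactly by \<open>face_ideal n (A - {b})\<close>, so that the induction hypothesis applies to
  each step.
\<close>

lemma weakly_regular_cyclic:
  assumes "ideal J (mpoly_ring n)" "g \<in> polys n" "A \<subseteq> {1..n}" "card A = d"
    and "\<And>f. f \<in> polys n \<Longrightarrow> f * g \<in> J \<longleftrightarrow> f \<in> face_ideal n A"
  shows "weakly_regular (esyms n d) J (J \<boxplus> (*) g ` polys n)"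
  using assms
proof (induction d arbitrary: J g A)
  case (Suc d)
  note J = \<open>ideal J (mpoly_ring n)\<close> and g = \<open>g \<in> polys n\<close> and A = \<open>A \<subseteq> {1..n}\<close>
    and colon = \<open>\<And>f. f \<in> polys n \<Longrightarrow> f * g \<in> J \<longleftrightarrow> f \<in> face_ideal n A\<close>
  have fA: "finite A" using finite_subset[OF A] by simp
  have S: "ideal (polys n) (mpoly_ring n)" by (auto simp: ideal_mpoly_ring_iff)
  define e :: "monomial \<Rightarrow>\<^sub>0 'a" where "e = esym n (Suc d)"
  define X :: "nat set \<Rightarrow> (monomial \<Rightarrow>\<^sub>0 'a)" where "X = (\<lambda>B. single (sqfree B) 1)"
  define L where "L = (\<lambda>B. J \<boxplus> (*) (X B * g) ` polys n)"
  have e: "e \<in> polys n" "e - X A \<in> face_ideal n A" "e \<notin> face_ideal n A"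
    unfolding e_def X_def
    using esym_polys esym_mod_face_ideal[OF A Suc.prems(4)] esym_notin_face_ideal[OF A Suc.prems(4)]
    by auto
  have X: "X B \<in> polys n" if "B \<subseteq> A" for B
    unfolding X_def using that A by (intro sqfree_polys) auto
  have XL: "ideal ((*) (X B * g) ` polys n) (mpoly_ring n)" if "B \<subseteq> A" for B
    using X[OF that] g by (intro ideal_scale_ideal[OF S]) auto
  have L: "ideal (L B) (mpoly_ring n)" if "B \<subseteq> A" for B
    unfolding L_def using XL[OF that] J by (intro ideal_plus_ideal)
  have nzd: "u \<in> J" if "u \<in> J \<boxplus> (*) g ` polys n" "e * u \<in> J" for u
  proof -
    obtain a f where u: "a \<in> J" "f \<in> polys n" "u = a + g * f"
      using \<open>u \<in> J \<boxplus> (*) g ` polys n\<close> by (auto elim!: ideal_plusE)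
    have "(e * f) * g = e * u - e * a" using u by (simp add: algebra_simps)
    also have "\<dots> \<in> J" by (rule ideal_diff[OF J that(2) ideal_mult[OF J e(1) u(1)]])
    finally have "e * f \<in> face_ideal n A" using colon u e by auto
    then have "f \<in> face_ideal n A" using face_ideal_prime e u by blast
    then have "f * g \<in> J" using colon u by auto
    then show "u \<in> J" using u ideal_add[OF J, of a "f * g"] by (simp add: mult.commute)
  qed
  have LA: "J \<boxplus> (*) e ` (J \<boxplus> (*) g ` polys n) = L A"
  proof (intro equalityI subsetI)
    fix x assume "x \<in> J \<boxplus> (*) e ` (J \<boxplus> (*) g ` polys n)"
    then obtain a b r where x: "a \<in> J" "b \<in> J" "r \<in> polys n" "x = a + e * (b + g * r)"
      by (auto elim!: ideal_plusE)
    have eXg: "(e - X A) * g \<in> J" using colon e X by auto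
    have "(a + e * b + r * ((e - X A) * g)) + (X A * g) * r \<in> L A"
      unfolding L_def
      using ideal_add[OF J ideal_add[OF J x(1) ideal_mult[OF J e(1) x(2)]] ideal_mult[OF J x(3) eXg]]
        x(3) by (intro ideal_plusI) auto
    then show "x \<in> L A" using x by (simp add: algebra_simps)
  next
    fix x assume "x \<in> L A"
    then obtain a r where x: "a \<in> J" "r \<in> polys n" "x = a + (X A * g) * r"
      unfolding L_def by (auto elim!: ideal_plusE)
    have eXg: "(e - X A) * g \<in> J" using colon e X by auto
    have "0 + g * r \<in> J \<boxplus> (*) g ` polys n"
      using x ideal_zero[OF J] by (intro ideal_plusI) auto
    then have "(a - r * ((e - X A) * g)) + e * (0 + g * r) \<in> J \<boxplus> (*) e ` (J \<boxplus> (*) g ` polys n)"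
      by (rule ideal_plusI[OF ideal_diff[OF J x(1) ideal_mult[OF J x(2) eXg]] imageI])
    then show "x \<in> J \<boxplus> (*) e ` (J \<boxplus> (*) g ` polys n)" using x by (simp add: algebra_simps)
  qed
  \<comment> \<open>Elements are removed from \<open>A\<close> one by one, and extension of regularity adds up the steps.\<close>
  have chain: "weakly_regular (esyms n d) (L A) (L (A - B)) \<and> L A \<subseteq> L (A - B)"
    if "finite B" "B \<subseteq> A" for B
    using that
  proof (induction B)
    case empty
    then show ?case using weakly_regular_refl[OF L esyms_polys] by simp
  next
    case (insert b B)
    define B' where "B' = A - insert b B"
    have AB: "A - B = insert b B'" "b \<notin> B'" "B' \<subseteq> A" "A - B \<subseteq> A" "b \<in> A"
      using insert.hyps insert.prems by (auto simp: B'_def)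
    have fB': "finite B'" using fA AB finite_subset by auto
    have Xb: "X (A - B) = single (single b 1) 1 * X B'"
      using AB fB' by (simp add: X_def sqfree_insert mult_single)
    have b: "single (single b 1) 1 \<in> polys n" using AB(5) A by (auto simp: polys_iff)
    have col: "f * (X B' * g) \<in> L (A - B) \<longleftrightarrow> f \<in> face_ideal n (A - {b})" if f: "f \<in> polys n" for f
    proof
      \<comment> \<open>A monomial of \<open>f\<close> with support in \<open>A - {b}\<close> could not cancel against a multiple of \<open>X (A - B)\<close>.\<close>
      assume "f * (X B' * g) \<in> L (A - B)"
      then obtain a r where r: "a \<in> J" "r \<in> polys n" "f * (X B' * g) = a + (X (A - B) * g) * r"
        unfolding L_def by (auto elim!: ideal_plusE)
      then have "(f * X B' - r * X (A - B)) * g \<in> J" by (simp add: algebra_simps)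
      moreover have "f * X B' - r * X (A - B) \<in> polys n" using f r X AB by auto
      ultimately have fa: "f * X B' - r * X (A - B) \<in> face_ideal n A" using colon by auto
      have "\<not> keys t \<subseteq> A - {b}" if t: "t \<in> keys f" for t
      proof
        assume tA: "keys t \<subseteq> A - {b}"
        let ?s = "t + sqfree B'"
        have k: "keys ?s \<subseteq> A" "b \<notin> keys ?s"
          using tA AB fB' by (auto simp: keys_plus_nat keys_sqfree)
        have "?s \<notin> keys (r * X (A - B))"
        proof
          assume "?s \<in> keys (r * X (A - B))"
          then obtain w where "?s = w + sqfree (A - B)" by (rule keys_multE) (auto simp: X_def)
          then have "b \<in> keys ?s" using AB fB' by (simp add: keys_plus_nat keys_sqfree)
          then show False using k by simp
        qed
        then have "lookup (f * X B' - r * X (A - B)) ?s = lookup f t"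
          by (simp add: lookup_minus in_keys_iff X_def lookup_times_single)
        then have "?s \<in> keys (f * X B' - r * X (A - B))" using t by (simp add: in_keys_iff)
        then show False using fa k by (auto simp: mem_face_ideal_iff)
      qed
      then show "f \<in> face_ideal n (A - {b})" using f by (auto simp: mem_face_ideal_iff)
    next
      assume fa: "f \<in> face_ideal n (A - {b})"
      have "single t (lookup f t) * (X B' * g) \<in> L (A - B)" if t: "t \<in> keys f" for t
      proof (cases "keys t \<subseteq> A")
        case False
        have "single t (lookup f t) \<in> face_ideal n A"
          using f t False by (auto simp: mem_face_ideal_iff polys_iff)
        then have "single t (lookup f t) * g \<in> J" using colon by (auto simp: mem_face_ideal_iff)
        then have "X B' * (single t (lookup f t) * g) \<in> J" by (rule ideal_mult[OF J X[OF AB(3)]])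
        then have "single t (lookup f t) * (X B' * g) \<in> J" by (simp add: algebra_simps)
        then show ?thesis unfolding L_def using ideal_plus_left[OF XL[OF AB(4)], of J] by blast
      next
        case True
        then have "{b} \<subseteq> keys t" using fa t by (auto simp: mem_face_ideal_iff)
        then obtain s where s: "t = s + sqfree {b}" "keys s \<subseteq> keys t" by (rule sqfree_dvd)
        have sp: "single s (lookup f t) \<in> polys n" using s f t by (fastforce simp: polys_iff)
        have "single t (lookup f t) = single s (lookup f t) * single (single b 1) 1"
          using s by (simp add: mult_single sqfree_def)
        then have "single t (lookup f t) * (X B' * g) = 0 + (X (A - B) * g) * single s (lookup f t)"
          by (simp add: Xb algebra_simps)
        also have "\<dots> \<in> L (A - B)"
          unfolding L_def using sp ideal_zero[OF J] by (intro ideal_plusI imageI)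
        finally show ?thesis .
      qed
      then have "(\<Sum>t\<in>keys f. single t (lookup f t) * (X B' * g)) \<in> L (A - B)"
        by (intro ideal_sum[OF L[OF AB(4)]])
      then show "f * (X B' * g) \<in> L (A - B)"
        by (simp add: sum_distrib_right[symmetric] poly_eq_sum_terms)
    qed
    have "card (A - {b}) = d" using Suc.prems(4) AB(5) by simp
    then have wr: "weakly_regular (esyms n d) (L (A - B)) (L (A - B) \<boxplus> (*) (X B' * g) ` polys n)"
      using L[OF AB(4)] X[OF AB(3)] g A col by (intro Suc.IH) auto
    have sub: "L (A - B) \<subseteq> L B'"
    proof -
      have "(*) (X (A - B) * g) ` polys n \<subseteq> (*) (X B' * g) ` polys n"
      proof
        fix x assume "x \<in> (*) (X (A - B) * g) ` polys n"
        then obtain r where "r \<in> polys n" "x = X (A - B) * g * r" by auto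
        then have "x = (X B' * g) * (single (single b 1) 1 * r)" "single (single b 1) 1 * r \<in> polys n"
          using b by (auto simp: Xb algebra_simps)
        then show "x \<in> (*) (X B' * g) ` polys n" by blast
      qed
      then show ?thesis unfolding L_def by (rule ideal_plus_mono[OF order_refl])
    qed
    have "L (A - B) \<boxplus> (*) (X B' * g) ` polys n = L B'"
    proof (rule equalityI)
      have "(*) (X B' * g) ` polys n \<subseteq> L B'" unfolding L_def by (rule ideal_plus_right[OF J])
      then show "L (A - B) \<boxplus> (*) (X B' * g) ` polys n \<subseteq> L B'"
        using sub by (intro ideal_plus_least[OF L[OF AB(3)]])
      have "J \<subseteq> L (A - B)" unfolding L_def by (rule ideal_plus_left[OF XL[OF AB(4)]])
      then show "L B' \<subseteq> L (A - B) \<boxplus> (*) (X B' * g) ` polys n"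
        unfolding fun_cong[OF L_def, of B'] by (rule ideal_plus_mono[OF _ order_refl])
    qed
    then have wr': "weakly_regular (esyms n d) (L (A - B)) (L B')" using wr by simp
    have IH: "weakly_regular (esyms n d) (L A) (L (A - B))" "L A \<subseteq> L (A - B)"
      using insert by auto
    have "weakly_regular (esyms n d) (L A) (L B')"
      by (rule weakly_regular_trans[OF L[OF order_refl] L[OF AB(4)] L[OF AB(3)] IH(2) sub
            esyms_polys IH(1) wr'])
    then show ?case using IH(2) sub unfolding B'_def by auto
  qed
  have "L {} = J \<boxplus> (*) g ` polys n" unfolding L_def X_def sqfree_def by simp
  then have "weakly_regular (esyms n d) (L A) (J \<boxplus> (*) g ` polys n)"
    using chain[OF fA order_refl] by simp
  then show ?case using nzd LA unfolding e_def by simp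
qed simp

section \<open>A bound on the length of regular chains\<close>

text \<open>
  Gaussian elimination: each step removes one coordinate \<open>t\<close> together with a pivot vector \<open>p\<close>
  whose coordinate at \<open>t\<close> is nonzero.
\<close>

lemma linear_dependence:
  fixes h :: "'e \<Rightarrow> 't \<Rightarrow> 'k::field"
  assumes "finite T" "finite E" "card T < card E"
  shows "\<exists>c. (\<exists>e\<in>E. c e \<noteq> 0) \<and> (\<forall>t\<in>T. (\<Sum>e\<in>E. c e * h e t) = 0)"
  using assms
proof (induction T arbitrary: E h)
  case empty
  then have "E \<noteq> {}" by auto
  then show ?case by (intro exI[of _ "\<lambda>_. 1"]) auto
next
  case (insert t T)
  show ?case
  proof (cases "\<forall>e\<in>E. h e t = 0")
    case True
    have "card T < card E" using insert by simp
    then obtain c where "\<exists>e\<in>E. c e \<noteq> 0" "\<forall>t\<in>T. (\<Sum>e\<in>E. c e * h e t) = 0"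
      using insert.IH insert.prems by blast
    then show ?thesis using True by (intro exI[of _ c]) simp
  next
    case False
    then obtain p where p: "p \<in> E" "h p t \<noteq> 0" by auto
    define E' where "E' = E - {p}"
    have E: "E = insert p E'" "p \<notin> E'" "finite E'" using p insert.prems by (auto simp: E'_def)
    have "card T < card E'" using insert.prems insert.hyps E by simp
    then obtain c where c: "\<exists>e\<in>E'. c e \<noteq> 0"
        "\<forall>s\<in>T. (\<Sum>e\<in>E'. c e * (h e s - h e t / h p t * h p s)) = 0"
      using insert.IH[of E' "\<lambda>e s. h e s - h e t / h p t * h p s"] E by blast
    define a where "a = - (\<Sum>e\<in>E'. c e * h e t) / h p t"
    have sum: "(\<Sum>e\<in>E. (c(p := a)) e * h e s) = a * h p s + (\<Sum>e\<in>E'. c e * h e s)" for s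
    proof -
      have "(\<Sum>e\<in>E'. (c(p := a)) e * h e s) = (\<Sum>e\<in>E'. c e * h e s)"
        by (rule sum.cong) (use E in auto)
      then show ?thesis using E by simp
    qed
    have "(\<Sum>e\<in>E. (c(p := a)) e * h e s) = 0" if "s \<in> insert t T" for s
    proof (cases "s = t")
      case True
      then show ?thesis unfolding sum using p by (simp add: a_def)
    next
      case False
      then have "(\<Sum>e\<in>E'. c e * (h e s - h e t / h p t * h p s)) = 0" using that c by auto
      also have "(\<Sum>e\<in>E'. c e * (h e s - h e t / h p t * h p s))
          = (\<Sum>e\<in>E'. c e * h e s) - (\<Sum>e\<in>E'. c e * h e t) * (h p s / h p t)"
        by (simp add: algebra_simps sum_subtractf sum_distrib_left sum_distrib_right)
      finally show ?thesis unfolding sum by (simp add: a_def algebra_simps)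
    qed
    moreover have "\<exists>e\<in>E. (c(p := a)) e \<noteq> 0" using c(1) E by auto
    ultimately show ?thesis by blast
  qed
qed

fun power_product :: "'a::comm_semiring_1 list \<Rightarrow> nat list \<Rightarrow> 'a" where
  "power_product [] as = 1"
| "power_product (y # ys) as = y ^ hd as * power_product ys (tl as)"

definition exponents :: "nat \<Rightarrow> nat \<Rightarrow> nat list set" where
  "exponents l m = {as. set as \<subseteq> {..m} \<and> length as = l}"

lemma finite_exponents: "finite (exponents l m)"
  unfolding exponents_def by (rule finite_lists_length_eq) simp

lemma card_exponents: "card (exponents l m) = Suc m ^ l"
  unfolding exponents_def by (subst card_lists_length_eq) auto

lemma sum_exponents_Suc:
  "sum f (exponents (Suc l) m) = (\<Sum>i\<le>m. \<Sum>as\<in>exponents l m. f (i # as))"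
proof -
  have "sum f (exponents (Suc l) m) = (\<Sum>(i, as)\<in>{..m} \<times> exponents l m. f (i # as))"
    by (rule sum.reindex_bij_witness[of _ "\<lambda>(i, as). i # as" "\<lambda>as. (hd as, tl as)"])
       (auto simp: exponents_def length_Suc_conv)
  then show ?thesis by (simp add: sum.cartesian_product)
qed

text \<open>
  The elements \<open>ys\<close> are algebraically independent over the field in their action on \<open>u\<close> modulo
  \<open>N 0\<close>. Write a vanishing polynomial expression by powers of the first element \<open>y\<close> as
  \<open>\<Sum>k. y\<^sup>k g k\<close>. In the lowest power, \<open>g 0 u\<close> lies in \<open>N 1\<close>, because multiples of \<open>y\<close> do, so the
  coefficients of \<open>g 0\<close> vanish by induction; then \<open>y\<close> can be cancelled and the next coefficient is
  reached. Both regular sequences and chains of prime ideals have the properties assumed of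
  the chain \<open>N\<close>.
\<close>

lemma power_products_independent:
  fixes J :: "(monomial \<Rightarrow>\<^sub>0 'k::field) set"
  assumes J: "ideal J (mpoly_ring n)" and u: "u \<in> J" and ys: "set ys \<subseteq> polys n"
    and "\<And>i. i \<le> length ys \<Longrightarrow> ideal (N i) (mpoly_ring n)"
    and "u \<notin> N (length ys)"
    and "\<And>i. i < length ys \<Longrightarrow> N i \<subseteq> N (Suc i)"
    and "\<And>i w. i < length ys \<Longrightarrow> w \<in> J \<Longrightarrow> ys ! i * w \<in> N i \<Longrightarrow> w \<in> N i"
    and "\<And>i w. i < length ys \<Longrightarrow> w \<in> J \<Longrightarrow> ys ! i * w \<in> N (Suc i)"
    and "(\<Sum>as\<in>exponents (length ys) m. single 0 (c as) * power_product ys as) * u \<in> N 0"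
  shows "\<forall>as\<in>exponents (length ys) m. c as = 0"
  using ys assms(4-)
proof (induction ys arbitrary: N c)
  case Nil
  have e: "exponents 0 m = {[]}" by (auto simp: exponents_def)
  have "c [] = 0"
  proof (rule ccontr)
    assume c: "c [] \<noteq> 0"
    have "single 0 (c []) * u \<in> N 0" using Nil.prems(7) e by simp
    then have "single 0 (inverse (c [])) * (single 0 (c []) * u) \<in> N 0"
      by (rule ideal_mult[OF Nil.prems(2)[of 0] polys_single_0, simplified])
    then have "u \<in> N 0" using c by (simp add: mult.assoc[symmetric] mult_single)
    then show False using Nil.prems(3) by simp
  qed
  then show ?case using e by simp
next
  case (Cons y ys)
  define g where "g = (\<lambda>i. \<Sum>as\<in>exponents (length ys) m. single 0 (c (i # as)) * power_product ys as)"
  \<comment> \<open>What remains of the expression after the first \<open>i\<close> coefficients are removed and \<open>y\<^sup>i\<close> is cancelled.\<close>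
  define w where "w = (\<lambda>i. (\<Sum>k=i..m. y ^ (k - i) * g k) * u)"
  have y: "y \<in> polys n" and ys: "set ys \<subseteq> polys n" using Cons.prems(1) by auto
  have N1: "ideal (N 1) (mpoly_ring n)" using Cons.prems(2)[of 1] by simp
  have pp: "power_product ys as \<in> polys n" for as
    using ys by (induction ys arbitrary: as) auto
  have g: "g k \<in> polys n" for k unfolding g_def using pp by (intro polys_sum polys_closed) auto
  have wJ: "w i \<in> J" for i
    unfolding w_def using g y u by (intro ideal_mult[OF J] polys_sum polys_closed polys_power)
  have w_rec: "w i = g i * u + y * w (Suc i)" if "i \<le> m" for i
  proof -
    have "(\<Sum>k=i..m. y ^ (k - i) * g k) = g i + (\<Sum>k=Suc i..m. y ^ (k - i) * g k)"
      using that by (simp add: sum.atLeast_Suc_atMost)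
    also have "(\<Sum>k=Suc i..m. y ^ (k - i) * g k) = y * (\<Sum>k=Suc i..m. y ^ (k - Suc i) * g k)"
      unfolding sum_distrib_left
    proof (rule sum.cong[OF refl])
      fix k assume "k \<in> {Suc i..m}"
      then have "k - i = Suc (k - Suc i)" by auto
      then show "y ^ (k - i) * g k = y * (y ^ (k - Suc i) * g k)" by (simp add: mult.assoc)
    qed
    finally show ?thesis unfolding w_def by (simp add: algebra_simps)
  qed
  have zero: "\<forall>as\<in>exponents (length ys) m. c (i # as) = 0" if i: "i \<le> m" and wi: "w i \<in> N 0" for i
  proof -
    have "w i \<in> N 1" using wi Cons.prems(4)[of 0] by auto
    moreover have "y * w (Suc i) \<in> N 1" using Cons.prems(6)[of 0, OF _ wJ] by simp
    ultimately have "w i - y * w (Suc i) \<in> N 1" by (rule ideal_diff[OF N1])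
    then have "g i * u \<in> N (Suc 0)" using w_rec[OF i] by simp
    then show ?thesis
      unfolding g_def using Cons.prems(2,3,4)
      by (intro Cons.IH[of "\<lambda>i. N (Suc i)"] ys) (use Cons.prems(5,6)[of "Suc _"] in auto)
  qed
  have "w i \<in> N 0" if "i \<le> m" for i
    using that
  proof (induction i)
    case 0
    have "(\<Sum>as\<in>exponents (length (y # ys)) m. single 0 (c as) * power_product (y # ys) as)
       = (\<Sum>k\<le>m. y ^ k * g k)"
      unfolding list.size(4) add_0_right plus_1_eq_Suc add_Suc_right sum_exponents_Suc g_def
      by (simp add: sum_distrib_left algebra_simps)
    then show ?case using Cons.prems(7) by (simp add: w_def atMost_atLeast0)
  next
    case (Suc i)
    then have i: "i \<le> m" and wi: "w i \<in> N 0" by auto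
    have "g i = 0" using zero[OF i wi] unfolding g_def by (intro sum.neutral) simp
    then have "y * w (Suc i) \<in> N 0" using w_rec[OF i] wi by simp
    then show ?case using Cons.prems(5)[of 0, OF _ wJ] by simp
  qed
  then have "c (i # as) = 0" if "i \<le> m" "as \<in> exponents (length ys) m" for i as
    using zero that by blast
  then show ?case by (auto simp: exponents_def length_Suc_conv)
qed

definition exponent_bound :: "(monomial \<Rightarrow>\<^sub>0 'k::field) \<Rightarrow> nat \<Rightarrow> bool" where
  "exponent_bound f e \<longleftrightarrow> (\<forall>t\<in>keys f. \<forall>i. lookup t i \<le> e)"

lemma exponent_bound_mult:
  "exponent_bound f a \<Longrightarrow> exponent_bound g b \<Longrightarrow> exponent_bound (f * g) (a + b)"
  unfolding exponent_bound_def by (auto elim!: keys_multE simp: lookup_add intro!: add_mono)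

lemma exponent_bound_mono: "exponent_bound f a \<Longrightarrow> a \<le> b \<Longrightarrow> exponent_bound f b"
  unfolding exponent_bound_def using order_trans by blast

lemma exponent_bound_one: "exponent_bound 1 a"
  unfolding exponent_bound_def by simp

lemma exponent_bound_power: "exponent_bound f a \<Longrightarrow> exponent_bound (f ^ k) (k * a)"
  by (induction k) (auto intro: exponent_bound_mult exponent_bound_one)

lemma ex_exponent_bound: "\<exists>e. exponent_bound f e"
proof -
  have "exponent_bound f (\<Sum>t\<in>keys f. \<Sum>i\<in>keys t. lookup t i)"
    unfolding exponent_bound_def
  proof (intro ballI allI)
    fix t i assume t: "t \<in> keys f"
    have "lookup t i \<le> (\<Sum>i\<in>keys t. lookup t i)"
    proof (cases "i \<in> keys t")
      case True
      then show ?thesis by (intro member_le_sum) auto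
    qed (simp add: in_keys_iff)
    also have "\<dots> \<le> (\<Sum>t\<in>keys f. \<Sum>i\<in>keys t. lookup t i)"
      using t by (intro member_le_sum) auto
    finally show "lookup t i \<le> (\<Sum>t\<in>keys f. \<Sum>i\<in>keys t. lookup t i)" .
  qed
  then show ?thesis ..
qed

lemma exponent_bound_power_product:
  assumes "\<And>y. y \<in> set ys \<Longrightarrow> exponent_bound y e" "as \<in> exponents (length ys) m"
  shows "exponent_bound (power_product ys as) (length ys * (m * e))"
  using assms
proof (induction ys arbitrary: as)
  case (Cons y ys)
  then obtain a bs where as: "as = a # bs" "a \<le> m" "bs \<in> exponents (length ys) m"
    by (auto simp: exponents_def length_Suc_conv)
  have "exponent_bound (y ^ a) (m * e)"
    using exponent_bound_power[of y e a] Cons.prems(1)[of y] as(2)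
    by (auto intro: exponent_bound_mono)
  then show ?case
    using exponent_bound_mult[OF _ Cons.IH[of bs]] as Cons.prems(1) by auto
qed (simp add: exponent_bound_one)

text \<open>
  Such a monomial is given by its support, for which there are at most \<open>2\<^sup>n\<close> possibilities, and
  by at most \<open>d\<close> exponents.
\<close>

lemma card_bounded_monomials:
  fixes n d s :: nat
  defines "T \<equiv> {t::monomial. keys t \<subseteq> {1..n} \<and> card (keys t) \<le> d \<and> (\<forall>i. lookup t i \<le> s)}"
  shows "finite T \<and> card T \<le> 2 ^ n * Suc s ^ d"
proof -
  define BB where "BB = {B. B \<subseteq> {1..n} \<and> card B \<le> d}"
  define X where "X = (SIGMA B:BB. PiE B (\<lambda>_. {..s}))"
  define h where "h = (\<lambda>t::monomial. (keys t, restrict (lookup t) (keys t)))"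
  have fBB: "finite BB" and fB: "finite B" if "B \<in> BB" for B
    using that finite_subset[of B "{1..n}"] by (auto simp: BB_def)
  have fBB: "finite BB" by (simp add: BB_def)
  have fX: "finite X" unfolding X_def using fBB fB by (intro finite_SigmaI finite_PiE) auto
  have "card X = (\<Sum>B\<in>BB. Suc s ^ card B)"
    unfolding X_def using fBB fB by (subst card_SigmaI) (auto intro: finite_PiE simp: card_PiE)
  also have "\<dots> \<le> (\<Sum>B\<in>BB. Suc s ^ d)"
    by (intro sum_mono power_increasing) (auto simp: BB_def)
  also have "\<dots> = card BB * Suc s ^ d" by simp
  also have "card BB \<le> card (Pow {1..n})" by (intro card_mono) (auto simp: BB_def)
  then have "card BB * Suc s ^ d \<le> 2 ^ n * Suc s ^ d" by (simp add: card_Pow)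
  finally have cX: "card X \<le> 2 ^ n * Suc s ^ d" .
  have inj: "inj_on h T"
  proof (rule inj_onI)
    fix t u assume "h t = h u"
    then have k: "keys t = keys u" and r: "restrict (lookup t) (keys t) = restrict (lookup u) (keys u)"
      by (auto simp: h_def)
    show "t = u"
    proof (rule poly_mapping_eqI)
      fix i
      show "lookup t i = lookup u i"
      proof (cases "i \<in> keys t")
        case True
        then show ?thesis using fun_cong[OF r, of i] k by simp
      next
        case False
        then show ?thesis using k by (metis not_in_keys_iff_lookup_eq_zero)
      qed
    qed
  qed
  have sub: "h ` T \<subseteq> X" by (auto simp: h_def T_def X_def BB_def)
  have "finite T" using finite_imageD[OF finite_subset[OF sub fX] inj] .
  moreover have "card T \<le> card X" using card_inj_on_le[OF inj sub fX] .
  ultimately show ?thesis using cX by simp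
qed

lemma lookup_const_mult: "lookup (single 0 c * f) t = (c::'k::field) * lookup f (t::monomial)"
  unfolding mult_map_scale_conv_mult[symmetric] by (simp add: map.rep_eq when_def)

text \<open>
  The \<open>(m + 1)\<^sup>l\<close> power products with exponents up to \<open>m\<close> are linearly independent modulo \<open>N 0\<close>,
  where \<open>l\<close> is the number of elements. Modulo \<open>N 0\<close>, only monomials with at most \<open>d\<close> variables
  count, and those occurring have exponents bounded linearly in \<open>m\<close>, so their number is at most
  a constant times \<open>(m + 1)\<^sup>d\<close>. For large \<open>m\<close> this forces \<open>l \<le> d\<close>.
\<close>

lemma regular_chain_length_le:
  fixes J :: "(monomial \<Rightarrow>\<^sub>0 'k::field) set"
  assumes J: "ideal J (mpoly_ring n)" and u: "u \<in> J" and ys: "set ys \<subseteq> polys n"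
    and N: "\<And>i. i \<le> length ys \<Longrightarrow> ideal (N i) (mpoly_ring n)"
    and uN: "u \<notin> N (length ys)"
    and mono: "\<And>i. i < length ys \<Longrightarrow> N i \<subseteq> N (Suc i)"
    and nzd: "\<And>i w. i < length ys \<Longrightarrow> w \<in> J \<Longrightarrow> ys ! i * w \<in> N i \<Longrightarrow> w \<in> N i"
    and absorb: "\<And>i w. i < length ys \<Longrightarrow> w \<in> J \<Longrightarrow> ys ! i * w \<in> N (Suc i)"
    and big: "\<And>f. f \<in> J \<Longrightarrow> (\<And>t. t \<in> keys f \<Longrightarrow> d < card (keys t)) \<Longrightarrow> f \<in> N 0"
  shows "length ys \<le> d"
proof (rule ccontr)
  define l where "l = length ys"
  assume "\<not> length ys \<le> d"
  then have dl: "Suc d \<le> l" by (simp add: l_def)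
  obtain b where b: "\<And>y :: monomial \<Rightarrow>\<^sub>0 'k. exponent_bound y (b y)"
    using ex_exponent_bound by metis
  define e where "e = sum_list (map b ys)"
  have e: "exponent_bound y e" if "y \<in> set ys" for y
    using b[of y] exponent_bound_mono member_le_sum_list[of "b y" "map b ys"] that
    unfolding e_def by fastforce
  define K where "K = Suc (l * e + b u)"
  \<comment> \<open>The constant in the count, so that \<open>m (m + 1)\<^sup>d < (m + 1)\<^sup>d\<^sup>+\<^sup>1\<close> gives the contradiction.\<close>
  define m where "m = 2 ^ n * K ^ d"
  define s where "s = l * (m * e) + b u"
  define T where "T = {t::monomial. keys t \<subseteq> {1..n} \<and> card (keys t) \<le> d \<and> (\<forall>i. lookup t i \<le> s)}"
  have T: "finite T" "card T \<le> 2 ^ n * Suc s ^ d"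
    using card_bounded_monomials[of n d s] by (auto simp: T_def)
  have "Suc s \<le> K * Suc m" by (simp add: s_def K_def algebra_simps)
  then have "Suc s ^ d \<le> (K * Suc m) ^ d" by (rule power_mono) simp
  then have "2 ^ n * Suc s ^ d \<le> 2 ^ n * (K ^ d * Suc m ^ d)"
    unfolding power_mult_distrib by (rule mult_left_mono) simp
  then have "2 ^ n * Suc s ^ d \<le> m * Suc m ^ d"
    unfolding m_def by (simp only: mult.assoc)
  also have "m * Suc m ^ d < Suc m ^ Suc d" by simp
  also have "\<dots> \<le> Suc m ^ l" using dl by (rule power_increasing) simp
  also have "\<dots> = card (exponents l m)" by (simp add: card_exponents)
  finally have "card T < card (exponents l m)" using T(2) by simp
  then obtain c where c: "\<exists>as\<in>exponents l m. c as \<noteq> 0"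
      "\<forall>t\<in>T. (\<Sum>as\<in>exponents l m. c as * lookup (power_product ys as * u) t) = 0"
    using linear_dependence[OF T(1) finite_exponents, where h = "\<lambda>as. lookup (power_product ys as * u)"]
    by blast
  define f where "f = (\<Sum>as\<in>exponents l m. single 0 (c as) * power_product ys as) * u"
  have pp: "power_product ys as \<in> polys n" for as
    using ys by (induction ys arbitrary: as) auto
  have fJ: "f \<in> J"
    unfolding f_def using pp u by (intro ideal_mult[OF J] polys_sum polys_closed polys_single_0)
  have lf: "lookup f t = (\<Sum>as\<in>exponents l m. c as * lookup (power_product ys as * u) t)" for t
    unfolding f_def sum_distrib_right lookup_sum mult.assoc lookup_const_mult ..
  have "f \<in> N 0"
  proof (rule big[OF fJ])
    fix t assume t: "t \<in> keys f"
    show "d < card (keys t)"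
    proof (rule ccontr)
      assume small: "\<not> d < card (keys t)"
      have nz: "(\<Sum>as\<in>exponents l m. c as * lookup (power_product ys as * u) t) \<noteq> 0"
        using t by (simp add: in_keys_iff lf)
      then obtain as where as: "as \<in> exponents l m" "t \<in> keys (power_product ys as * u)"
        by (metis (mono_tags, lifting) sum.neutral mult_zero_right in_keys_iff)
      have "exponent_bound (power_product ys as * u) s"
        unfolding s_def l_def using as(1) e b
        by (intro exponent_bound_mult exponent_bound_power_product) (auto simp: l_def)
      moreover have "keys t \<subseteq> {1..n}" using ideal_polys[OF J fJ] t by (auto simp: polys_iff)
      ultimately have "t \<in> T" using as(2) small by (auto simp: T_def exponent_bound_def)
      then show False using c(2) nz by blast
    qed
  qed
  then have "\<forall>as\<in>exponents (length ys) m. c as = 0"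
    unfolding f_def l_def
    by (intro power_products_independent[OF J u ys N uN mono nzd absorb])
  then show False using c(1) by (auto simp: l_def)
qed

section \<open>Krull dimension of a quotient ring\<close>

lemma (in ideal) rcos_mem_image_iff:
  assumes P: "ideal P R" "I \<subseteq> P" and a: "a \<in> carrier R"
  shows "I +> a \<in> (+>) I ` P \<longleftrightarrow> a \<in> P"
proof
  assume "I +> a \<in> (+>) I ` P"
  then obtain p where p: "p \<in> P" "I +> a = I +> p" by auto
  then have "a \<in> I +> p" using a_rcos_self[OF a] by simp
  then obtain x where "x \<in> I" "a = x \<oplus> p" by (auto simp: a_r_coset_def')
  then show "a \<in> P"
    using P p additive_subgroup.a_closed[OF ideal.axioms(1)[OF P(1)], of x p] by auto
qed auto

lemma (in ideal) carrier_Quot: "carrier (R Quot I) = (+>) I ` carrier R"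
  by (auto simp: FactRing_def A_RCOSETS_def')

lemma (in ideal) primeideal_image:
  assumes "cring R" and P: "primeideal P R" and IP: "I \<subseteq> P"
  shows "primeideal ((+>) I ` P) (R Quot I)"
proof (rule primeidealI)
  interpret P: primeideal P R by (rule P)
  have Pi: "ideal P R" ..
  show "ideal ((+>) I ` P) (R Quot I)" by (rule ring_ideal_imp_quot_ideal[OF ideal_axioms Pi])
  show "cring (R Quot I)" by (rule quotient_is_cring[OF assms(1)])
  obtain a where "a \<in> carrier R" "a \<notin> P" using P.I_notcarr P.a_subset by auto
  then have "I +> a \<in> carrier (R Quot I)" "I +> a \<notin> (+>) I ` P"
    using rcos_mem_image_iff[OF Pi IP] by (auto simp: carrier_Quot)
  then show "carrier (R Quot I) \<noteq> (+>) I ` P" by auto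
  fix x y assume "x \<in> carrier (R Quot I)" "y \<in> carrier (R Quot I)"
    and xy: "x \<otimes>\<^bsub>R Quot I\<^esub> y \<in> (+>) I ` P"
  then obtain a b where ab: "a \<in> carrier R" "b \<in> carrier R" "x = I +> a" "y = I +> b"
    by (auto simp: carrier_Quot)
  then have "x \<otimes>\<^bsub>R Quot I\<^esub> y = I +> (a \<otimes> b)" by (simp add: FactRing_def rcoset_mult_add)
  then have "a \<otimes> b \<in> P" using xy ab rcos_mem_image_iff[OF Pi IP] by auto
  then show "x \<in> (+>) I ` P \<or> y \<in> (+>) I ` P"
    using P.I_prime ab by blast
qed

lemma (in ideal) primeideal_vimage:
  assumes "cring R" and Q: "primeideal Q (R Quot I)"
  shows "primeideal {a \<in> carrier R. I +> a \<in> Q} R"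
proof (rule primeidealI)
  interpret h: ring_hom_ring R "R Quot I" "(+>) I" by (rule rcos_ring_hom_ring)
  interpret Q: primeideal Q "R Quot I" by (rule Q)
  show "ideal {a \<in> carrier R. I +> a \<in> Q} R"
    by (rule h.ideal_vimage) (rule Q.is_ideal)
  show "cring R" by fact
  show "carrier R \<noteq> {a \<in> carrier R. I +> a \<in> Q}"
  proof
    assume "carrier R = {a \<in> carrier R. I +> a \<in> Q}"
    then have "carrier (R Quot I) \<subseteq> Q" by (auto simp: carrier_Quot)
    then show False using Q.I_notcarr Q.a_subset by auto
  qed
  fix a b assume ab: "a \<in> carrier R" "b \<in> carrier R" "a \<otimes> b \<in> {a \<in> carrier R. I +> a \<in> Q}"
  then have "(I +> a) \<otimes>\<^bsub>R Quot I\<^esub> (I +> b) \<in> Q" by simp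
  then have "I +> a \<in> Q \<or> I +> b \<in> Q"
    using ab by (intro Q.I_prime) (auto simp: carrier_Quot)
  then show "a \<in> {a \<in> carrier R. I +> a \<in> Q} \<or> b \<in> {a \<in> carrier R. I +> a \<in> Q}"
    using ab by auto
qed

text \<open>
  Prime ideals of a quotient ring correspond to the prime ideals of the ring that contain the
  ideal, by image and preimage.
\<close>

lemma (in ideal) krull_dim_Quot:
  assumes "cring R"
  shows "krull_dim (R Quot I) =
    Sup {enat l | l. \<exists>P. (\<forall>i\<le>l. primeideal (P i) R \<and> I \<subseteq> P i) \<and> (\<forall>i<l. P i \<subset> P (Suc i))}"
proof -
  have "(\<exists>P. (\<forall>i\<le>l. primeideal (P i) (R Quot I)) \<and> (\<forall>i<l. P i \<subset> P (Suc i))) \<longleftrightarrow>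
    (\<exists>P. (\<forall>i\<le>l. primeideal (P i) R \<and> I \<subseteq> P i) \<and> (\<forall>i<l. P i \<subset> P (Suc i)))" for l
  proof
    assume "\<exists>P. (\<forall>i\<le>l. primeideal (P i) (R Quot I)) \<and> (\<forall>i<l. P i \<subset> P (Suc i))"
    then obtain Q where Q: "\<And>i. i \<le> l \<Longrightarrow> primeideal (Q i) (R Quot I)"
      and chain: "\<And>i. i < l \<Longrightarrow> Q i \<subset> Q (Suc i)" by blast
    define P where "P = (\<lambda>i. {a \<in> carrier R. I +> a \<in> Q i})"
    have "primeideal (P i) R \<and> I \<subseteq> P i" if i: "i \<le> l" for i
    proof
      interpret Q: primeideal "Q i" "R Quot I" by (rule Q[OF i])
      show "primeideal (P i) R" unfolding P_def by (rule primeideal_vimage[OF assms Q[OF i]])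
      have "I +> a = \<zero>\<^bsub>R Quot I\<^esub>" if "a \<in> I" for a
        using a_coset_join2[OF _ a_subgroup that] a_subset that by (auto simp: FactRing_def)
      then show "I \<subseteq> P i"
        using a_subset additive_subgroup.zero_closed[OF Q.is_additive_subgroup] by (auto simp: P_def)
    qed
    moreover have "P i \<subset> P (Suc i)" if i: "i < l" for i
    proof -
      obtain x where x: "x \<in> Q (Suc i)" "x \<notin> Q i" using chain[OF i] by auto
      have "x \<in> carrier (R Quot I)"
        using Q[of "Suc i"] i x(1) ideal.Icarr[OF primeideal.axioms(1)] by fastforce
      then show ?thesis using x chain[OF i] by (auto simp: carrier_Quot P_def)
    qed
    ultimately show "\<exists>P. (\<forall>i\<le>l. primeideal (P i) R \<and> I \<subseteq> P i) \<and> (\<forall>i<l. P i \<subset> P (Suc i))"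
      by blast
  next
    assume "\<exists>P. (\<forall>i\<le>l. primeideal (P i) R \<and> I \<subseteq> P i) \<and> (\<forall>i<l. P i \<subset> P (Suc i))"
    then obtain P where P: "\<And>i. i \<le> l \<Longrightarrow> primeideal (P i) R" "\<And>i. i \<le> l \<Longrightarrow> I \<subseteq> P i"
      and chain: "\<And>i. i < l \<Longrightarrow> P i \<subset> P (Suc i)" by blast
    have "(+>) I ` P i \<subset> (+>) I ` P (Suc i)" if i: "i < l" for i
    proof -
      obtain a where a: "a \<in> P (Suc i)" "a \<notin> P i" using chain[OF i] by auto
      have Pi: "ideal (P i) R" using P(1)[of i] i primeideal.axioms(1) by auto
      have "a \<in> carrier R"
        using P(1)[of "Suc i"] i a(1) ideal.Icarr[OF primeideal.axioms(1)] by fastforce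
      then have "I +> a \<notin> (+>) I ` P i"
        using rcos_mem_image_iff[OF Pi P(2)] a i by auto
      then show ?thesis using a chain[OF i] by blast
    qed
    then show "\<exists>P. (\<forall>i\<le>l. primeideal (P i) (R Quot I)) \<and> (\<forall>i<l. P i \<subset> P (Suc i))"
      using primeideal_image[OF assms P] by (intro exI[of _ "\<lambda>i. (+>) I ` P i"]) auto
  qed
  then show ?thesis unfolding krull_dim_def by presburger
qed

section \<open>Quotient modules\<close>

lemma quot_module_sel [simp]:
  "carrier (quot_module M N) = a_rcosets\<^bsub>M\<^esub> N"
  "zero (quot_module M N) = N"
  "add (quot_module M N) = set_add M"
  by (simp_all add: quot_module_def)

lemma restrict_module_sel [simp]:
  "carrier (restrict_module M N) = N"
  "zero (restrict_module M N) = zero M"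
  "add (restrict_module M N) = add M"
  "smult (restrict_module M N) = smult M"
  by (simp_all add: restrict_module_def)

locale module_quotient = Module.module R M
  for R (structure) and M :: "('a, 'b) Module.module" and N +
  assumes submod: "submodule N R M"
begin

sublocale N: abelian_subgroup N M
  using submod unfolding submodule_def
  by (intro abelian_subgroupI3 additive_subgroupI M.abelian_group_axioms) auto

lemma N_carrier: "x \<in> N \<Longrightarrow> x \<in> carrier M"
  using N.a_subset by auto

lemma quot_carrier: "carrier (quot_module M N) = (\<lambda>x. N +>\<^bsub>M\<^esub> x) ` carrier M"
  by (auto simp: A_RCOSETS_def')

lemma quot_add:
  assumes "x \<in> carrier M" "y \<in> carrier M"
  shows "N +>\<^bsub>M\<^esub> (x \<oplus>\<^bsub>M\<^esub> y) = (N +>\<^bsub>M\<^esub> x) \<oplus>\<^bsub>quot_module M N\<^esub> (N +>\<^bsub>M\<^esub> y)"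
  using N.a_rcos_sum[OF assms] by simp

lemma quot_smult:
  assumes "r \<in> carrier R" "x \<in> carrier M"
  shows "N +>\<^bsub>M\<^esub> (r \<odot>\<^bsub>M\<^esub> x) = r \<odot>\<^bsub>quot_module M N\<^esub> (N +>\<^bsub>M\<^esub> x)"
proof -
  have "N +>\<^bsub>M\<^esub> (r \<odot>\<^bsub>M\<^esub> y) = N +>\<^bsub>M\<^esub> (r \<odot>\<^bsub>M\<^esub> x)" if y: "y \<in> N +>\<^bsub>M\<^esub> x" for y
  proof -
    obtain a where a: "a \<in> N" "y = a \<oplus>\<^bsub>M\<^esub> x" using y by (auto simp: a_r_coset_def')
    then have "r \<odot>\<^bsub>M\<^esub> y = (r \<odot>\<^bsub>M\<^esub> a) \<oplus>\<^bsub>M\<^esub> (r \<odot>\<^bsub>M\<^esub> x)"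
      using assms N_carrier by (simp add: smult_r_distr)
    moreover have "r \<odot>\<^bsub>M\<^esub> a \<in> N" using assms a submodule.smult_closed[OF submod] by auto
    ultimately have "r \<odot>\<^bsub>M\<^esub> y \<in> N +>\<^bsub>M\<^esub> (r \<odot>\<^bsub>M\<^esub> x)"
      using M.a_rcosI[OF _ N.a_subset smult_closed[OF assms]] by simp
    then show ?thesis
      by (rule M.a_repr_independence[OF _ smult_closed[OF assms] N.a_subgroup, symmetric])
  qed
  moreover have "N +>\<^bsub>M\<^esub> x \<noteq> {}" using N.a_rcos_self[OF assms(2)] by blast
  ultimately have "(\<Union>y\<in>N +>\<^bsub>M\<^esub> x. N +>\<^bsub>M\<^esub> (r \<odot>\<^bsub>M\<^esub> y)) = N +>\<^bsub>M\<^esub> (r \<odot>\<^bsub>M\<^esub> x)"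
    by (intro SUP_eq_const)
  then show ?thesis by (simp add: quot_module_def)
qed

lemma quot_zero_iff: "x \<in> carrier M \<Longrightarrow> N +>\<^bsub>M\<^esub> x = \<zero>\<^bsub>quot_module M N\<^esub> \<longleftrightarrow> x \<in> N"
  unfolding quot_module_sel
  by (rule iffI, erule (1) M.a_coset_join1[OF _ _ N.a_subgroup],
      erule (1) M.a_coset_join2[OF _ N.a_subgroup])

lemma quot_is_module: "Module.module R (quot_module M N)"
proof (rule moduleI)
  let ?Q = "quot_module M N" and ?q = "\<lambda>x. N +>\<^bsub>M\<^esub> x"
  have z: "\<zero>\<^bsub>?Q\<^esub> = ?q \<zero>\<^bsub>M\<^esub>" using quot_zero_iff[of "\<zero>\<^bsub>M\<^esub>"] by simp
  show "cring R" ..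
  show "abelian_group ?Q"
  proof (rule abelian_groupI)
    fix x assume "x \<in> carrier ?Q"
    then obtain a where a: "a \<in> carrier M" "x = ?q a" unfolding quot_carrier by auto
    then have "?q (\<ominus>\<^bsub>M\<^esub> a) \<oplus>\<^bsub>?Q\<^esub> x = \<zero>\<^bsub>?Q\<^esub>"
      unfolding z by (simp add: quot_add[symmetric] M.l_neg del: quot_module_sel)
    then show "\<exists>y\<in>carrier ?Q. y \<oplus>\<^bsub>?Q\<^esub> x = \<zero>\<^bsub>?Q\<^esub>" using a unfolding quot_carrier by blast
  qed (unfold quot_carrier z,
       auto simp: quot_add[symmetric] M.a_ac simp del: quot_module_sel)
qed (unfold quot_carrier,
     auto simp: quot_add[symmetric] quot_smult[symmetric] smult_l_distr smult_r_distr smult_assoc1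
       simp del: quot_module_sel)

end

section \<open>Modules presented by ideals\<close>

text \<open>
  The module \<open>M\<close> is isomorphic to \<open>J/J'\<close> by way of \<open>\<phi>\<close>. The factors of the filtration are quotients
  of submodules of quotients, whose elements are nested cosets; through \<open>\<phi>\<close> all their properties
  are read off from ideals of the polynomial ring.
\<close>

locale presentation =
  fixes n :: nat and J J' :: "(monomial \<Rightarrow>\<^sub>0 'k::field) set"
    and M :: "(monomial \<Rightarrow>\<^sub>0 'k, 'b) module" (structure) and \<phi> :: "(monomial \<Rightarrow>\<^sub>0 'k) \<Rightarrow> 'b"
  assumes is_module: "Module.module (mpoly_ring n) M"
    and J: "ideal J (mpoly_ring n)" and J': "ideal J' (mpoly_ring n)" and J'J: "J' \<subseteq> J"
    and surj: "\<phi> ` J = carrier M"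
    and hom_add: "\<And>f g. f \<in> J \<Longrightarrow> g \<in> J \<Longrightarrow> \<phi> (f + g) = \<phi> f \<oplus> \<phi> g"
    and hom_smult: "\<And>r f. r \<in> polys n \<Longrightarrow> f \<in> J \<Longrightarrow> \<phi> (r * f) = r \<odot> \<phi> f"
    and kernel: "\<And>f. f \<in> J \<Longrightarrow> \<phi> f = \<zero> \<longleftrightarrow> f \<in> J'"
begin

sublocale Module.module "mpoly_ring n" M by (rule is_module)

lemma hom_closed: "f \<in> J \<Longrightarrow> \<phi> f \<in> carrier M"
  using surj by auto

lemma hom_uminus: "f \<in> J \<Longrightarrow> \<phi> (- f) = \<ominus> \<phi> f"
proof (rule M.minus_equality[symmetric])
  assume f: "f \<in> J"
  have "\<phi> (- f) \<oplus> \<phi> f = \<phi> (- f + f)" using f ideal_uminus[OF J f] by (intro hom_add[symmetric])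
  also have "\<dots> = \<zero>" using kernel[OF ideal_zero[OF J]] ideal_zero[OF J'] by simp
  finally show "\<phi> (- f) \<oplus> \<phi> f = \<zero>" .
qed (auto intro: hom_closed ideal_uminus[OF J])

lemma hom_zero: "\<phi> 0 = \<zero>"
  using kernel[OF ideal_zero[OF J]] ideal_zero[OF J'] by simp

lemma hom_eq_iff:
  assumes "f \<in> J" "g \<in> J"
  shows "\<phi> f = \<phi> g \<longleftrightarrow> f - g \<in> J'"
proof -
  have "\<phi> (f - g) = \<phi> f \<oplus> \<ominus> \<phi> g"
    using hom_add[of f "- g"] ideal_uminus[OF J] hom_uminus assms by simp
  then have "\<phi> (f - g) = \<zero> \<longleftrightarrow> \<phi> f = \<phi> g"
    using assms hom_closed by (metis M.add.inv_closed M.minus_equality M.minus_minus M.r_neg)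
  then show ?thesis using kernel[OF ideal_diff[OF J assms]] by simp
qed

lemma mem_image_iff:
  assumes "ideal K (mpoly_ring n)" "J' \<subseteq> K" "K \<subseteq> J" "f \<in> J"
  shows "\<phi> f \<in> \<phi> ` K \<longleftrightarrow> f \<in> K"
proof
  assume "\<phi> f \<in> \<phi> ` K"
  then obtain g where g: "g \<in> K" "\<phi> f = \<phi> g" by auto
  then have "f - g \<in> K" using hom_eq_iff[of f g] assms by auto
  from ideal_add[OF assms(1) this g(1)] show "f \<in> K" by simp
qed auto

lemma image_submodule:
  assumes K: "ideal K (mpoly_ring n)" "K \<subseteq> J"
  shows "submodule (\<phi> ` K) (mpoly_ring n) M"
proof (rule submoduleI)
  show "\<phi> ` K \<subseteq> carrier M" using K hom_closed by auto
  show "\<zero> \<in> \<phi> ` K" using hom_zero ideal_zero[OF K(1)] by (metis imageI)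
  fix x assume "x \<in> \<phi> ` K"
  then obtain f where f: "f \<in> K" "x = \<phi> f" by auto
  then show "\<ominus> x \<in> \<phi> ` K" using hom_uminus ideal_uminus[OF K(1)] K(2) by (metis imageI subsetD)
  { fix y assume "y \<in> \<phi> ` K"
    then obtain g where g: "g \<in> K" "y = \<phi> g" by auto
    then have "x \<oplus> y = \<phi> (f + g)" using f K(2)[THEN subsetD] hom_add[of f g] by simp
    then show "x \<oplus> y \<in> \<phi> ` K" using f g ideal_add[OF K(1)] by auto }
  { fix r :: "monomial \<Rightarrow>\<^sub>0 'k" assume r: "r \<in> polys n"
    then have "r \<odot> x = \<phi> (r * f)" using f K(2)[THEN subsetD] hom_smult[of r f] by simp
    then show "r \<odot> x \<in> \<phi> ` K" using f r ideal_mult[OF K(1)] by auto }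
qed

lemma vimage_submodule:
  assumes N: "submodule N (mpoly_ring n) M"
  shows "ideal {f \<in> J. \<phi> f \<in> N} (mpoly_ring n)"
  using submoduleE(4,5)[OF N] submodule.axioms(1)[OF N, THEN subgroup.one_closed]
  unfolding ideal_mpoly_ring_iff
  by (auto simp: hom_zero hom_add hom_smult ideal_polys[OF J] ideal_zero[OF J] ideal_add[OF J]
        ideal_mult[OF J])

lemma presentation_restrict:
  assumes K: "ideal K (mpoly_ring n)" "J' \<subseteq> K" "K \<subseteq> J"
  shows "presentation n K J' (restrict_module M (\<phi> ` K)) \<phi>"
proof (rule presentation.intro)
  show "Module.module (mpoly_ring n) (restrict_module M (\<phi> ` K))"
    unfolding restrict_module_def
    by (rule submodule.submodule_is_module[OF image_submodule[OF K(1,3)] is_module])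
qed (use K J' hom_add[OF subsetD[OF K(3)] subsetD[OF K(3)]] hom_smult[OF _ subsetD[OF K(3)]]
      kernel[OF subsetD[OF K(3)]] in auto)

lemma presentation_quot:
  assumes K: "ideal K (mpoly_ring n)" "J' \<subseteq> K" "K \<subseteq> J"
  shows "presentation n J K (quot_module M (\<phi> ` K)) (\<lambda>f. \<phi> ` K +>\<^bsub>M\<^esub> \<phi> f)"
proof -
  interpret q: module_quotient "mpoly_ring n" M "\<phi> ` K"
    by (rule module_quotient.intro[OF is_module module_quotient_axioms.intro])
       (rule image_submodule[OF K(1,3)])
  show ?thesis
  proof (rule presentation.intro)
    show "Module.module (mpoly_ring n) (quot_module M (\<phi> ` K))" by (rule q.quot_is_module)
    show "(\<lambda>f. \<phi> ` K +>\<^bsub>M\<^esub> \<phi> f) ` J = carrier (quot_module M (\<phi> ` K))"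
      unfolding q.quot_carrier surj[symmetric] by auto
    fix f assume f: "f \<in> J"
    show "(\<phi> ` K +>\<^bsub>M\<^esub> \<phi> f = \<zero>\<^bsub>quot_module M (\<phi> ` K)\<^esub>) = (f \<in> K)"
      using q.quot_zero_iff[OF hom_closed[OF f]] mem_image_iff[OF K f] by simp
    { fix g assume g: "g \<in> J"
      show "\<phi> ` K +>\<^bsub>M\<^esub> \<phi> (f + g) =
            (\<phi> ` K +>\<^bsub>M\<^esub> \<phi> f) \<oplus>\<^bsub>quot_module M (\<phi> ` K)\<^esub> (\<phi> ` K +>\<^bsub>M\<^esub> \<phi> g)"
        using f g by (simp only: hom_add q.quot_add hom_closed) }
    { fix r :: "monomial \<Rightarrow>\<^sub>0 'k" assume r: "r \<in> polys n"
      show "\<phi> ` K +>\<^bsub>M\<^esub> \<phi> (r * f) = r \<odot>\<^bsub>quot_module M (\<phi> ` K)\<^esub> (\<phi> ` K +>\<^bsub>M\<^esub> \<phi> f)"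
        using f r by (simp only: hom_smult q.quot_smult hom_closed) }
  qed (use K J in auto)
qed

lemma nonzerodivisor_on_iff:
  assumes "x \<in> polys n"
  shows "nonzerodivisor_on M x \<longleftrightarrow> (\<forall>f\<in>J. x * f \<in> J' \<longrightarrow> f \<in> J')"
  unfolding nonzerodivisor_on_def surj[symmetric]
  using assms kernel by (auto simp: hom_smult[symmetric] ideal_mult[OF J])

text \<open>
  The preimage in \<open>J\<close> of the submodule \<open>(ys)M\<close>.
\<close>

definition mult_ideal :: "(monomial \<Rightarrow>\<^sub>0 'k) list \<Rightarrow> (monomial \<Rightarrow>\<^sub>0 'k) set" where
  "mult_ideal ys = foldl (\<lambda>K y. K \<boxplus> (*) y ` J) J' ys"

lemma mult_ideal_snoc: "mult_ideal (ys @ [y]) = mult_ideal ys \<boxplus> (*) y ` J"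
  by (simp add: mult_ideal_def)

lemma mult_ideal_props:
  "set ys \<subseteq> polys n \<Longrightarrow> ideal (mult_ideal ys) (mpoly_ring n) \<and> J' \<subseteq> mult_ideal ys \<and> mult_ideal ys \<subseteq> J"
proof (induction ys rule: rev_induct)
  case Nil
  then show ?case using J' J'J by (simp add: mult_ideal_def)
next
  case (snoc y ys)
  then have IH: "ideal (mult_ideal ys) (mpoly_ring n)" "J' \<subseteq> mult_ideal ys" "mult_ideal ys \<subseteq> J"
    and y: "y \<in> polys n" by auto
  have yJ: "ideal ((*) y ` J) (mpoly_ring n)" by (rule ideal_scale_ideal[OF J y])
  have "(*) y ` J \<subseteq> J" using ideal_mult[OF J y] by auto
  then show ?case unfolding mult_ideal_snoc
    using ideal_plus_ideal[OF IH(1) yJ] ideal_plus_left[OF yJ, of "mult_ideal ys"] IH(2)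
      ideal_plus_least[OF J IH(3)] by auto
qed

lemma scalar_span_eq:
  assumes "set ys \<subseteq> polys n"
  shows "scalar_span (mpoly_ring n) M (set ys) = \<phi> ` mult_ideal ys"
proof -
  let ?G = "\<lambda>X. {x \<odot> v | x v. x \<in> X \<and> v \<in> carrier M}"
  note props = mult_ideal_props[OF assms]
  have "?G (set ys) \<subseteq> \<phi> ` mult_ideal ys"
    using assms
  proof (induction ys rule: rev_induct)
    case (snoc y ys)
    then have y: "y \<in> polys n" and ys: "set ys \<subseteq> polys n" by auto
    note p = mult_ideal_props[OF ys]
    have yJ: "ideal ((*) y ` J) (mpoly_ring n)" by (rule ideal_scale_ideal[OF J y])
    have "?G (set (ys @ [y])) \<subseteq> ?G (set ys) \<union> {y \<odot> v | v. v \<in> carrier M}" by auto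
    also have "\<dots> \<subseteq> \<phi> ` mult_ideal (ys @ [y])"
    proof (rule Un_least)
      show "?G (set ys) \<subseteq> \<phi> ` mult_ideal (ys @ [y])"
        using snoc.IH[OF ys] ideal_plus_left[OF yJ, of "mult_ideal ys"] unfolding mult_ideal_snoc by blast
      show "{y \<odot> v | v. v \<in> carrier M} \<subseteq> \<phi> ` mult_ideal (ys @ [y])"
        using ideal_plus_right[of "mult_ideal ys" n "(*) y ` J"] p y unfolding mult_ideal_snoc surj[symmetric]
        by (auto simp: hom_smult[symmetric])
    qed
    finally show ?case .
  qed simp
  moreover have "submodule (\<phi> ` mult_ideal ys) (mpoly_ring n) M"
    using props by (intro image_submodule) auto
  moreover have "\<phi> ` mult_ideal ys \<subseteq> N" if N: "submodule N (mpoly_ring n) M" "?G (set ys) \<subseteq> N" for N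
  proof -
    have v: "ideal {f \<in> J. \<phi> f \<in> N} (mpoly_ring n)" by (rule vimage_submodule[OF N(1)])
    have "mult_ideal ys \<subseteq> {f \<in> J. \<phi> f \<in> N}"
      using assms N(2)
    proof (induction ys rule: rev_induct)
      case Nil
      have "\<phi> f \<in> N" if "f \<in> J'" for f
        using kernel[of f] J'J that submodule.axioms(1)[OF N(1), THEN subgroup.one_closed] by auto
      then show ?case using J'J by (auto simp: mult_ideal_def)
    next
      case (snoc y ys)
      have "(*) y ` J \<subseteq> {f \<in> J. \<phi> f \<in> N}"
      proof
        fix g assume "g \<in> (*) y ` J"
        then obtain f where f: "f \<in> J" "g = y * f" by auto
        then have "y \<odot> \<phi> f \<in> N" using snoc.prems(2) hom_closed by force
        then show "g \<in> {f \<in> J. \<phi> f \<in> N}"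
          using f snoc.prems(1) ideal_mult[OF J] by (auto simp: hom_smult)
      qed
      moreover have "?G (set ys) \<subseteq> N" using snoc.prems(2) by auto
      then have "mult_ideal ys \<subseteq> {f \<in> J. \<phi> f \<in> N}" using snoc by auto
      ultimately show ?case unfolding mult_ideal_snoc by (intro ideal_plus_least[OF v])
    qed
    then show ?thesis by auto
  qed
  ultimately show ?thesis unfolding scalar_span_def module_span_def by blast
qed

lemma regular_sequence_iff:
  assumes "set ys \<subseteq> polys n"
  shows "regular_sequence (mpoly_ring n) M ys \<longleftrightarrow>
    (\<forall>i<length ys. \<forall>f\<in>J. ys ! i * f \<in> mult_ideal (take i ys) \<longrightarrow> f \<in> mult_ideal (take i ys)) \<and>
    mult_ideal ys \<noteq> J"
proof -
  have "nonzerodivisor_on (quot_module M (scalar_span (mpoly_ring n) M (set (take i ys)))) (ys ! i) \<longleftrightarrow>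
     (\<forall>f\<in>J. ys ! i * f \<in> mult_ideal (take i ys) \<longrightarrow> f \<in> mult_ideal (take i ys))"
    if i: "i < length ys" for i
  proof -
    have t: "set (take i ys) \<subseteq> polys n" using assms set_take_subset by fast
    note p = mult_ideal_props[OF t]
    interpret q: presentation n J "mult_ideal (take i ys)" "quot_module M (\<phi> ` mult_ideal (take i ys))"
        "\<lambda>f. \<phi> ` mult_ideal (take i ys) +>\<^bsub>M\<^esub> \<phi> f"
      using p by (intro presentation_quot) auto
    have "ys ! i \<in> polys n" using assms i by auto
    then show ?thesis unfolding scalar_span_eq[OF t] by (rule q.nonzerodivisor_on_iff)
  qed
  moreover have "\<phi> ` mult_ideal ys = carrier M \<longleftrightarrow> mult_ideal ys = J"
    using mult_ideal_props[OF assms] mem_image_iff[of "mult_ideal ys"] unfolding surj[symmetric] by blast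
  ultimately show ?thesis
    using assms unfolding regular_sequence_def scalar_span_eq[OF assms] by auto
qed

lemma weakly_regular_mult_ideal:
  assumes "weakly_regular ys J' J" "i < length ys" "f \<in> J" "ys ! i * f \<in> mult_ideal (take i ys)"
  shows "f \<in> mult_ideal (take i ys)"
proof -
  have "f \<in> foldl (\<lambda>K y. K \<boxplus> (*) y ` J) K (take i ys)"
    if "weakly_regular ys K J" "i < length ys" "ys ! i * f \<in> foldl (\<lambda>K y. K \<boxplus> (*) y ` J) K (take i ys)"
    for K
    using that
  proof (induction ys arbitrary: K i)
    case (Cons y ys)
    then show ?case using assms(3) by (cases i) auto
  qed simp
  then show ?thesis using assms unfolding mult_ideal_def by blast
qed

lemma annihilator_eq: "annihilator (mpoly_ring n) M = {r \<in> polys n. \<forall>f\<in>J. r * f \<in> J'}"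
  unfolding annihilator_def surj[symmetric]
  by (auto simp: hom_smult[symmetric] kernel ideal_mult[OF J])

lemma annihilator_ideal: "ideal (annihilator (mpoly_ring n) M) (mpoly_ring n)"
  unfolding annihilator_eq ideal_mpoly_ring_iff
  by (auto simp: ideal_zero[OF J'] ideal_add[OF J'] ideal_mult[OF J'] distrib_right mult.assoc)

end

section \<open>Depth and dimension of quotients of squarefree ideals\<close>

text \<open>
  A common index set for the exponents of several monomials makes the additivity of the degree
  evident.
\<close>

lemma mdegree_eq_sum: "finite F \<Longrightarrow> keys t \<subseteq> F \<Longrightarrow> mdegree t = (\<Sum>i\<in>F. lookup t i)"
  unfolding mdegree_def by (rule sum.mono_neutral_left) (auto simp: in_keys_iff)

lemma mdegree_plus: "mdegree (s + t) = mdegree s + mdegree t"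
proof -
  have "mdegree x = (\<Sum>i\<in>keys s \<union> keys t. lookup x i)" if "x \<in> {s, t, s + t}" for x
    using that by (intro mdegree_eq_sum) (auto simp: keys_plus_nat)
  then show ?thesis by (simp add: lookup_add sum.distrib)
qed

lemma mdegree_eq_0_iff: "mdegree t = 0 \<longleftrightarrow> t = 0"
proof
  assume "mdegree t = 0"
  then have "\<forall>i\<in>keys t. lookup t i = 0" by (simp add: mdegree_def)
  then show "t = 0" by (intro poly_mapping_eqI) (metis in_keys_iff lookup_zero)
qed (simp add: mdegree_def)

text \<open>
  Every monomial other than \<open>1\<close> is divisible by a variable.
\<close>

lemma graded_maximal_ideal_iff:
  "f \<in> graded_maximal_ideal n \<longleftrightarrow> f \<in> polys n \<and> 0 \<notin> keys f"
proof -
  let ?R = "mpoly_ring n :: (monomial \<Rightarrow>\<^sub>0 'a::field) ring"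
  let ?X = "(\<lambda>i. single (single i 1) 1) ` {1..n} :: (monomial \<Rightarrow>\<^sub>0 'a) set"
  interpret cring ?R by (rule cring_mpoly_ring)
  have X: "?X \<subseteq> polys n" by (auto simp: polys_iff)
  have m: "ideal (graded_maximal_ideal n) ?R"
    unfolding graded_maximal_ideal_def by (rule genideal_ideal[OF X])
  have K: "ideal {f :: monomial \<Rightarrow>\<^sub>0 'a. f \<in> polys n \<and> 0 \<notin> keys f} ?R"
  proof -
    have "{f :: monomial \<Rightarrow>\<^sub>0 'a. f \<in> polys n \<and> 0 \<notin> keys f} = support_ideal (Pow {1..n} - {{}})"
      unfolding support_ideal_def polys_iff
      by (auto simp del: One_nat_def)
    then show ?thesis by (simp only:) (rule support_ideal_ideal, auto simp: up_closed_def)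
  qed
  show ?thesis
  proof
    assume "f \<in> graded_maximal_ideal n"
    moreover have ne: "0 \<noteq> single i (1::nat)" for i :: nat
      by (metis lookup_single_eq lookup_zero zero_neq_one)
    have "graded_maximal_ideal n \<subseteq> {f :: monomial \<Rightarrow>\<^sub>0 'a. f \<in> polys n \<and> 0 \<notin> keys f}"
      unfolding graded_maximal_ideal_def
    proof (rule genideal_minimal[OF K], intro subsetI CollectI conjI)
      fix f assume f: "f \<in> ?X"
      then show "f \<in> polys n" using X by blast
      show "0 \<notin> keys f" using f ne by auto
    qed
    ultimately show "f \<in> polys n \<and> 0 \<notin> keys f" by auto
  next
    assume f: "f \<in> polys n \<and> 0 \<notin> keys f"
    have "single t (lookup f t) \<in> graded_maximal_ideal n" if t: "t \<in> keys f" for t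
    proof -
      have "t \<noteq> 0" using f t by auto
      then obtain i where i: "i \<in> keys t" by (metis keys_eq_empty ex_in_conv)
      then have "{i} \<subseteq> keys t" by simp
      then obtain s where s: "t = s + sqfree {i}" "keys s \<subseteq> keys t" by (rule sqfree_dvd)
      have "i \<in> {1..n}" using i t f unfolding polys_iff by blast
      then have "single (single i 1) 1 \<in> ?X" by blast
      then have x: "single (single i 1) 1 \<in> (graded_maximal_ideal n :: (monomial \<Rightarrow>\<^sub>0 'a) set)"
        unfolding graded_maximal_ideal_def using genideal_self[OF X] by blast
      have "single s (lookup f t) \<in> polys n" using s t f by (fastforce simp: polys_iff)
      from ideal_mult[OF m this x] show ?thesis using s by (simp add: sqfree_def mult_single)
    qed
    then show "f \<in> graded_maximal_ideal n" by (rule ideal_memI_terms[OF m])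
  qed
qed

lemma keys_esym: "t \<in> keys (esym n d) \<Longrightarrow> \<exists>C\<subseteq>{1..n}. card C = d \<and> t = sqfree C"
  unfolding esym_def by (drule subsetD[OF keys_sum_subset]) auto

lemma esyms_graded_maximal_ideal: "set (esyms n d) \<subseteq> graded_maximal_ideal n"
proof (induction d)
  case (Suc d)
  have "(0::monomial) \<notin> keys (esym n (Suc d) :: monomial \<Rightarrow>\<^sub>0 'a)"
  proof
    assume "(0::monomial) \<in> keys (esym n (Suc d) :: monomial \<Rightarrow>\<^sub>0 'a)"
    then obtain C where C: "C \<subseteq> {1..n}" "card C = Suc d" "0 = sqfree C" using keys_esym by blast
    then have "keys (sqfree C) = C" using finite_subset[OF C(1)] by (intro keys_sqfree) auto
    then show False using C by (metis card.empty keys_zero nat.distinct(1))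
  qed
  then show ?case using Suc esym_polys by (auto simp: graded_maximal_ideal_iff)
qed simp

lemma face_ideal_antimono: "B \<subseteq> A \<Longrightarrow> face_ideal n A \<subseteq> face_ideal n B"
  unfolding mem_face_ideal_iff subset_iff[of "face_ideal n A"] by (meson order_trans)

lemma face_ideal_primeideal: "primeideal (face_ideal n A) (mpoly_ring n)"
proof (rule primeidealI[OF face_ideal_ideal cring_mpoly_ring])
  show "polys n \<noteq> face_ideal n A" using one_notin_face_ideal polys_closed(2) by blast
qed (use face_ideal_prime in auto)

locale squarefree_presentation =
  presentation n "support_ideal U" "support_ideal U'" M \<phi>
  for n :: nat and U U' :: "nat set set"
    and M :: "(monomial \<Rightarrow>\<^sub>0 'k::field, 'b) module" (structure) and \<phi> +
  assumes up_U: "up_closed n U" and up_U': "up_closed n U'" and U'U: "U' \<subset> U"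
begin

lemma finitely_generated: "finitely_generated (mpoly_ring n) M"
proof -
  let ?A = "(\<lambda>B. \<phi> (single (sqfree B) 1)) ` U"
  have U: "U \<subseteq> Pow {1..n}" using up_U by (simp add: up_closed_def)
  then have fU: "finite U" using finite_subset by auto
  have fB: "finite B" if "B \<in> U" for B using that U finite_subset[of B "{1..n}"] by auto
  have x: "single (sqfree B) 1 \<in> support_ideal U" if "B \<in> U" for B
    using that fB by (simp add: support_ideal_def keys_sqfree)
  then have A: "?A \<subseteq> carrier M" using hom_closed by auto
  have "carrier M \<subseteq> N" if N: "submodule N (mpoly_ring n) M" "?A \<subseteq> N" for N
  proof -
    let ?K = "{f \<in> support_ideal U. \<phi> f \<in> N}"
    have K: "ideal ?K (mpoly_ring n)" by (rule vimage_submodule[OF N(1)])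
    have "support_ideal U \<subseteq> ?K"
    proof
      fix f :: "monomial \<Rightarrow>\<^sub>0 'k" assume f: "f \<in> support_ideal U"
      have "single t (lookup f t) \<in> ?K" if t: "t \<in> keys f" for t
      proof -
        have tU: "keys t \<in> U" using f t by (simp add: support_ideal_def)
        obtain s where s: "t = s + sqfree (keys t)" "keys s \<subseteq> keys t"
          using sqfree_dvd[OF order_refl] .
        have "single (sqfree (keys t)) 1 \<in> ?K" using x[OF tU] N(2) tU by auto
        moreover have "single s (lookup f t) \<in> polys n"
          using s(2) tU U by (auto simp: polys_iff)
        ultimately have "single s (lookup f t) * single (sqfree (keys t)) 1 \<in> ?K"
          by (intro ideal_mult[OF K])
        then show ?thesis using s(1) by (simp add: mult_single)
      qed
      then show "f \<in> ?K" by (rule ideal_memI_terms[OF K])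
    qed
    then show ?thesis unfolding surj[symmetric] by blast
  qed
  then have "module_span (mpoly_ring n) M ?A = carrier M"
    unfolding module_span_def using A carrier_is_submodule by blast
  then show ?thesis unfolding finitely_generated_def using fU A by blast
qed

text \<open>
  The graded version of Nakayama's lemma: a monomial of least degree among those in \<open>J\<close> but not
  in \<open>J'\<close> cannot occur in an element of \<open>J' + (ys)J\<close>, since the product of an element of \<open>J\<close> with a
  polynomial without constant term has only monomials that lie in \<open>J'\<close> or are of larger degree.
\<close>

lemma mult_ideal_proper:
  assumes ys: "set ys \<subseteq> graded_maximal_ideal n"
  shows "mult_ideal ys \<noteq> support_ideal U"
proof -
  obtain B where B: "B \<in> U - U'" using U'U by auto
  have fB: "finite B" using B up_U finite_subset[of B "{1..n}"] by (auto simp: up_closed_def)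
  define D where "D = (LEAST m. \<exists>t. keys t \<in> U - U' \<and> mdegree t = m)"
  have "\<exists>t. keys t \<in> U - U' \<and> mdegree t = mdegree (sqfree B)"
    using B fB by (intro exI[of _ "sqfree B"]) (simp add: keys_sqfree)
  then have "\<exists>t. keys t \<in> U - U' \<and> mdegree t = D" unfolding D_def by (rule LeastI)
  then obtain t where t: "keys t \<in> U - U'" "mdegree t = D" by blast
  have D: "D \<le> mdegree s" if "keys s \<in> U - U'" for s
    unfolding D_def using that by (intro Least_le) auto
  let ?Z = "{f. \<forall>s\<in>keys f. keys s \<in> U' \<or> D < mdegree s}"
  have "mult_ideal ys \<subseteq> ?Z" using ys
  proof (induction ys rule: rev_induct)
    case Nil
    have "mult_ideal [] = support_ideal U'" by (simp add: mult_ideal_def)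
    then show ?case unfolding support_ideal_def by auto
  next
    case (snoc y ys)
    have y: "y \<in> polys n" "0 \<notin> keys y" using snoc.prems by (auto simp: graded_maximal_ideal_iff)
    have yf: "y * f \<in> ?Z" if f: "f \<in> support_ideal U" for f
    proof (intro CollectI ballI)
      fix s assume "s \<in> keys (y * f)"
      then obtain a b where ab: "a \<in> keys y" "b \<in> keys f" "s = a + b" by (rule keys_multE)
      have bU: "keys b \<in> U" using f ab by (simp add: support_ideal_def)
      show "keys s \<in> U' \<or> D < mdegree s"
      proof (cases "keys b \<in> U'")
        case True
        have "keys s \<subseteq> {1..n}" "keys b \<subseteq> keys s"
          using ab y(1) bU up_U by (auto simp: keys_plus_nat polys_iff up_closed_def simp del: One_nat_def)
        then show ?thesis using True up_U' unfolding up_closed_def by blast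
      next
        case False
        have "mdegree a \<noteq> 0" using ab(1) y(2) mdegree_eq_0_iff by metis
        then show ?thesis using D[of b] bU False ab(3) by (simp add: mdegree_plus)
      qed
    qed
    show ?case
    proof
      fix h assume "h \<in> mult_ideal (ys @ [y])"
      then obtain a f where h: "a \<in> mult_ideal ys" "f \<in> support_ideal U" "h = a + y * f"
        unfolding mult_ideal_snoc by (auto elim!: ideal_plusE)
      then have "a \<in> ?Z" using snoc by auto
      then show "h \<in> ?Z" using yf[OF h(2)] keys_add[of a "y * f"] h(3) by blast
    qed
  qed
  moreover have "single t (1::'k) \<notin> ?Z" "single t (1::'k) \<in> support_ideal U"
    using t by (auto simp: support_ideal_def)
  ultimately show ?thesis by blast
qed

context
  fixes d
  assumes small: "\<And>B. B \<in> U - U' \<Longrightarrow> card B \<le> d"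
begin

lemma large_supports:
  assumes "f \<in> support_ideal U" "\<And>t. t \<in> keys f \<Longrightarrow> d < card (keys t)"
  shows "f \<in> support_ideal U'"
  using assms small unfolding support_ideal_def by fastforce

lemma regular_sequence_length_le:
  assumes "regular_sequence (mpoly_ring n) M xs"
  shows "length xs \<le> d"
proof -
  have xs: "set xs \<subseteq> polys n" using assms by (simp add: regular_sequence_def)
  note p = mult_ideal_props
  have t: "set (take i xs) \<subseteq> polys n" for i using xs set_take_subset by fast
  have S: "mult_ideal (take (Suc i) xs) = mult_ideal (take i xs) \<boxplus> (*) (xs ! i) ` support_ideal U"
    if "i < length xs" for i
    using that by (simp add: take_Suc_conv_app_nth mult_ideal_snoc)
  have yJ: "ideal ((*) (xs ! i) ` support_ideal U) (mpoly_ring n)" if "i < length xs" for i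
    using that xs J by (intro ideal_scale_ideal) auto
  obtain u where u: "u \<in> support_ideal U" "u \<notin> mult_ideal xs"
    using assms p[OF xs] unfolding regular_sequence_iff[OF xs] by blast
  show ?thesis
  proof (rule regular_chain_length_le[where N = "\<lambda>i. mult_ideal (take i xs)", OF J u(1) xs])
    show "f \<in> mult_ideal (take 0 xs)"
      if "f \<in> support_ideal U" "\<And>t. t \<in> keys f \<Longrightarrow> d < card (keys t)" for f
      using large_supports[OF that] by (simp add: mult_ideal_def)
    show "xs ! i * w \<in> mult_ideal (take (Suc i) xs)" if "i < length xs" "w \<in> support_ideal U" for i w
      unfolding S[OF that(1)] using ideal_plus_right[of "mult_ideal (take i xs)" n] p[OF t] that by blast
    show "mult_ideal (take i xs) \<subseteq> mult_ideal (take (Suc i) xs)" if "i < length xs" for i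
      unfolding S[OF that] by (rule ideal_plus_left[OF yJ[OF that]])
  qed (use p[OF t] u assms in \<open>auto simp: regular_sequence_iff[OF xs]\<close>)
qed

text \<open>
  Elements \<open>y i\<close> of \<open>P (Suc i)\<close> outside \<open>P i\<close> form a chain as in \<open>regular_chain_length_le\<close>. A monomial
  in more than \<open>d\<close> variables multiplies \<open>J\<close> into \<open>J'\<close>, so it annihilates the module and lies in \<open>P 0\<close>.
\<close>

lemma prime_chain_length_le:
  assumes P: "\<And>i. i \<le> l \<Longrightarrow> primeideal (P i) (mpoly_ring n)"
    and ann: "annihilator (mpoly_ring n) M \<subseteq> P 0"
    and chain: "\<And>i. i < l \<Longrightarrow> P i \<subset> P (Suc i)"
  shows "l \<le> d"
proof -
  have Pi: "ideal (P i) (mpoly_ring n)" if "i \<le> l" for i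
    using P[OF that] by (rule primeideal.axioms(1))
  have "\<exists>y. y \<in> P (Suc i) \<and> y \<notin> P i" if "i < l" for i using chain[OF that] by blast
  then obtain y where y: "\<And>i. i < l \<Longrightarrow> y i \<in> P (Suc i)" "\<And>i. i < l \<Longrightarrow> y i \<notin> P i" by metis
  have yp: "y i \<in> polys n" if "i < l" for i using y(1)[OF that] ideal_polys[OF Pi[of "Suc i"]] that by auto
  define ys where "ys = map y [0..<l]"
  have ys: "length ys = l" "\<And>i. i < l \<Longrightarrow> ys ! i = y i" "set ys \<subseteq> polys n"
    using yp by (auto simp: ys_def)
  have S: "ideal (polys n) (mpoly_ring n :: (monomial \<Rightarrow>\<^sub>0 'k) ring)" by (auto simp: ideal_mpoly_ring_iff)
  have one: "1 \<notin> P l"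
  proof
    assume "1 \<in> P l"
    then have "polys n \<subseteq> P l" using ideal_mult[OF Pi[of l], of _ 1] by auto
    then show False
      using primeideal.I_notcarr[OF P[of l]] ideal_polys[OF Pi[of l]] by auto
  qed
  have "length ys \<le> d"
  proof (rule regular_chain_length_le[where N = P, OF S polys_closed(2) ys(3)])
    fix f :: "monomial \<Rightarrow>\<^sub>0 'k" assume f: "f \<in> polys n" "\<And>t. t \<in> keys f \<Longrightarrow> d < card (keys t)"
    have "f * g \<in> support_ideal U'" if g: "g \<in> support_ideal U" for g
    proof (rule large_supports[OF ideal_mult[OF J f(1) g]])
      fix t assume "t \<in> keys (f * g)"
      then obtain a b where "a \<in> keys f" "t = a + b" by (rule keys_multE)
      then have "d < card (keys a)" "card (keys a) \<le> card (keys t)"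
        using f(2) by (auto simp: keys_plus_nat intro: card_mono)
      then show "d < card (keys t)" by simp
    qed
    then show "f \<in> P 0" using f ann by (auto simp: annihilator_eq)
  next
    fix i and w :: "monomial \<Rightarrow>\<^sub>0 'k"
    assume i: "i < length ys" and w: "w \<in> polys n" and yw: "ys ! i * w \<in> P i"
    then show "w \<in> P i"
      using primeideal.I_prime[OF P[of i], of "ys ! i" w] y(2)[of i] ys yp[of i] by auto
  next
    fix i and w :: "monomial \<Rightarrow>\<^sub>0 'k"
    assume i: "i < length ys" and w: "w \<in> polys n"
    have "w * y i \<in> P (Suc i)"
      using y(1)[of i] i w ys by (intro ideal_mult[OF Pi]) auto
    then show "ys ! i * w \<in> P (Suc i)" using i ys by (simp add: mult.commute)
  qed (use Pi one chain ys in auto)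
  then show ?thesis using ys by simp
qed

text \<open>
  The counting bound gives depth and dimension at most \<open>d\<close>. The depth is attained by the
  elementary symmetric polynomials. The dimension is attained because the annihilator of the
  module annihilates \<open>w\<close> and is thus contained in \<open>face_ideal n A\<close>, above which there is a chain
  of \<open>d\<close> further primes, one for each element removed from \<open>A\<close>.
\<close>

lemma cohen_macaulay_criterion:
  assumes wr: "weakly_regular (esyms n d) (support_ideal U') (support_ideal U :: (monomial \<Rightarrow>\<^sub>0 'k) set)"
    and A: "A \<subseteq> {1..n}" "card A = d"
    and w: "w \<in> (support_ideal U :: (monomial \<Rightarrow>\<^sub>0 'k) set)"
    and colon: "\<And>f. f \<in> polys n \<Longrightarrow> f * w \<in> support_ideal U' \<Longrightarrow> f \<in> face_ideal n A"
  shows "cohen_macaulay (mpoly_ring n) (graded_maximal_ideal n) M"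
    and "module_dim (mpoly_ring n) M = enat d"
proof -
  have reg: "regular_sequence (mpoly_ring n) M (esyms n d)"
    unfolding regular_sequence_iff[OF esyms_polys]
    using weakly_regular_mult_ideal[OF wr] mult_ideal_proper[OF esyms_graded_maximal_ideal] by blast
  have depth: "depth (mpoly_ring n) (graded_maximal_ideal n) M = enat d"
    unfolding depth_def
  proof (rule antisym)
    show "Sup {enat (length xs) | xs. set xs \<subseteq> graded_maximal_ideal n \<and>
        regular_sequence (mpoly_ring n) M xs} \<le> enat d"
      using regular_sequence_length_le by (intro Sup_least) auto
    show "enat d \<le> Sup {enat (length xs) | xs. set xs \<subseteq> graded_maximal_ideal n \<and>
        regular_sequence (mpoly_ring n) M xs}"
      using reg by (intro Sup_upper CollectI exI[of _ "esyms n d"])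
        (simp add: esyms_graded_maximal_ideal length_esyms)
  qed
  let ?ann = "annihilator (mpoly_ring n) M"
  interpret ann: ideal ?ann "mpoly_ring n" by (rule annihilator_ideal)
  have annA: "?ann \<subseteq> face_ideal n A"
  proof
    fix r assume "r \<in> ?ann"
    then have "r \<in> polys n" "r * w \<in> support_ideal U'" using w unfolding annihilator_eq by blast+
    then show "r \<in> face_ideal n A" by (rule colon)
  qed
  have fA: "finite A" using finite_subset[OF A(1)] by simp
  obtain as where as: "set as = A" "distinct as" using finite_distinct_list[OF fA] by blast
  then have len: "length as = d" using A(2) distinct_card by force
  define P where "P = (\<lambda>i. face_ideal n (set (drop i as)) :: (monomial \<Rightarrow>\<^sub>0 'k) set)"
  have "P i \<subset> P (Suc i)" if i: "i < d" for i
  proof -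
    have "set (drop (Suc i) as) \<subseteq> set (drop i as)" by (rule set_drop_subset_set_drop) simp
    then have "P i \<subseteq> P (Suc i)" unfolding P_def by (rule face_ideal_antimono)
    moreover have a: "as ! i \<in> set (drop i as)" "as ! i \<notin> set (drop (Suc i) as)" "as ! i \<in> A"
      using as i len
      by (auto simp: Cons_nth_drop_Suc[symmetric] in_set_conv_nth nth_eq_iff_index_eq)
    then have "as ! i \<in> {1..n}" using A(1) by blast
    then have "single (single (as ! i) 1) 1 \<in> P (Suc i) - P i"
      unfolding P_def using a by (auto simp: mem_face_ideal_iff polys_iff)
    ultimately show ?thesis by blast
  qed
  moreover have "primeideal (P i) (mpoly_ring n) \<and> ?ann \<subseteq> P i" for i
  proof
    show "primeideal (P i) (mpoly_ring n)" unfolding P_def by (rule face_ideal_primeideal)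
    have "set (drop i as) \<subseteq> A" using as set_drop_subset by fast
    then show "?ann \<subseteq> P i" using annA unfolding P_def by (blast dest: face_ideal_antimono)
  qed
  ultimately have "enat d \<le> Sup {enat l | l. \<exists>P. (\<forall>i\<le>l. primeideal (P i) (mpoly_ring n) \<and> ?ann \<subseteq> P i)
      \<and> (\<forall>i<l. P i \<subset> P (Suc i))}"
    by (intro Sup_upper) blast
  moreover have "Sup {enat l | l. \<exists>P. (\<forall>i\<le>l. primeideal (P i) (mpoly_ring n) \<and> ?ann \<subseteq> P i)
      \<and> (\<forall>i<l. P i \<subset> P (Suc i))} \<le> enat d"
  proof (rule Sup_least, clarify)
    fix l and P :: "nat \<Rightarrow> (monomial \<Rightarrow>\<^sub>0 'k) set"
    assume "\<forall>i\<le>l. primeideal (P i) (mpoly_ring n) \<and> ?ann \<subseteq> P i" "\<forall>i<l. P i \<subset> P (Suc i)"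
    then have "l \<le> d" by (intro prime_chain_length_le[of l P]) auto
    then show "enat l \<le> enat d" by simp
  qed
  ultimately show dim: "module_dim (mpoly_ring n) M = enat d"
    unfolding module_dim_def ann.krull_dim_Quot[OF cring_mpoly_ring] by (rule antisym[rotated])
  show "cohen_macaulay (mpoly_ring n) (graded_maximal_ideal n) M"
    unfolding cohen_macaulay_def using is_module finitely_generated depth dim by simp
qed

end

end

section \<open>Relative shellings\<close>

text \<open>
  Starting from \<open>U\<close>, the family grows by disjoint intervals of sets whose tops have \<open>d\<close> elements,
  and it remains up-closed throughout. For complements this is a pure relative shelling.
\<close>

inductive relatively_shellable :: "nat \<Rightarrow> nat \<Rightarrow> nat set set \<Rightarrow> nat set set \<Rightarrow> bool" for n d U where
  refl: "up_closed n U \<Longrightarrow> relatively_shellable n d U U"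
| add: "\<lbrakk>relatively_shellable n d U V; R \<subseteq> A; A \<subseteq> {1..n}; card A = d; V \<inter> {R..A} = {};
     up_closed n (V \<union> {R..A})\<rbrakk> \<Longrightarrow> relatively_shellable n d U (V \<union> {R..A})"

text \<open>
  One interval \<open>{R..A}\<close> adds the monomials whose support lies between \<open>R\<close> and \<open>A\<close>, that is the
  multiples of the squarefree monomial \<open>x\<close> of \<open>R\<close> by monomials in the variables of \<open>A\<close>. So \<open>x\<close>
  generates the new part, with annihilator \<open>face_ideal n A\<close>.
\<close>

lemma shelling_step:
  fixes V :: "nat set set" and R A :: "nat set"
  defines "x \<equiv> single (sqfree R) 1 :: monomial \<Rightarrow>\<^sub>0 'k::field"
  assumes V: "up_closed n V" and W: "up_closed n (V \<union> {R..A})"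
    and RA: "R \<subseteq> A" "A \<subseteq> {1..n}" and disj: "V \<inter> {R..A} = {}"
  shows "support_ideal (V \<union> {R..A}) = support_ideal V \<boxplus> (*) x ` polys n"
    and "f \<in> polys n \<Longrightarrow> f * x \<in> support_ideal V \<longleftrightarrow> f \<in> face_ideal n A"
proof -
  have R: "R \<subseteq> {1..n}" "finite R" using RA finite_subset[of R "{1..n}"] by auto
  note I = support_ideal_ideal
  have S: "ideal (polys n) (mpoly_ring n :: (monomial \<Rightarrow>\<^sub>0 'k) ring)" by (auto simp: ideal_mpoly_ring_iff)
  have x: "x \<in> polys n" "x \<in> support_ideal (V \<union> {R..A})"
    using R RA by (auto simp: x_def sqfree_polys support_ideal_def keys_sqfree)
  have xS: "ideal ((*) x ` polys n) (mpoly_ring n)" by (rule ideal_scale_ideal[OF S x(1)])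
  have L: "ideal (support_ideal V \<boxplus> (*) x ` polys n) (mpoly_ring n)"
    by (rule ideal_plus_ideal[OF I[OF V] xS])
  show "support_ideal (V \<union> {R..A}) = support_ideal V \<boxplus> (*) x ` polys n"
  proof
    show "support_ideal V \<boxplus> (*) x ` polys n \<subseteq> support_ideal (V \<union> {R..A})"
    proof (rule ideal_plus_least[OF I[OF W]])
      show "support_ideal V \<subseteq> support_ideal (V \<union> {R..A})" by (rule support_ideal_mono) simp
      show "(*) x ` polys n \<subseteq> support_ideal (V \<union> {R..A})"
        using ideal_mult[OF I[OF W] _ x(2)] by (auto simp: mult.commute)
    qed
    show "support_ideal (V \<union> {R..A}) \<subseteq> support_ideal V \<boxplus> (*) x ` polys n"
    proof
      fix f :: "monomial \<Rightarrow>\<^sub>0 'k" assume f: "f \<in> support_ideal (V \<union> {R..A})"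
      have "single t (lookup f t) \<in> support_ideal V \<boxplus> (*) x ` polys n" if t: "t \<in> keys f" for t
      proof (cases "keys t \<in> V")
        case True
        then have "single t (lookup f t) \<in> support_ideal V" by (simp add: support_ideal_def)
        then show ?thesis using ideal_plus_left[OF xS] by blast
      next
        case False
        then have tA: "R \<subseteq> keys t" "keys t \<subseteq> A" using f t by (auto simp: support_ideal_def)
        obtain s where s: "t = s + sqfree R" "keys s \<subseteq> keys t" using sqfree_dvd[OF tA(1)] .
        have "keys s \<subseteq> {1..n}" using s(2) tA(2) RA(2) by (rule order_trans[OF order_trans])
        then have "single s (lookup f t) \<in> polys n" by (simp add: polys_iff)
        moreover have "single t (lookup f t) = x * single s (lookup f t)"
          using s(1) by (simp add: x_def mult_single add.commute)
        ultimately show ?thesis using ideal_plus_right[OF I[OF V], of "(*) x ` polys n"] by blast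
      qed
      then show "f \<in> support_ideal V \<boxplus> (*) x ` polys n" by (rule ideal_memI_terms[OF L])
    qed
  qed
  assume f: "f \<in> polys n"
  show "f * x \<in> support_ideal V \<longleftrightarrow> f \<in> face_ideal n A"
  proof
    assume fx: "f * x \<in> support_ideal V"
    have "\<not> keys t \<subseteq> A" if t: "t \<in> keys f" for t
    proof
      assume "keys t \<subseteq> A"
      then have "keys (t + sqfree R) \<in> {R..A}" using RA R by (auto simp: keys_plus_nat keys_sqfree)
      moreover have "t + sqfree R \<in> keys (f * x)"
        using t by (simp add: in_keys_iff x_def lookup_times_single)
      ultimately show False using fx disj by (auto simp: support_ideal_def)
    qed
    then show "f \<in> face_ideal n A" using f by (simp add: mem_face_ideal_iff)
  next
    assume fA: "f \<in> face_ideal n A"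
    show "f * x \<in> support_ideal V"
      unfolding support_ideal_def
    proof (intro CollectI ballI)
      fix t assume "t \<in> keys (f * x)"
      then obtain s where s: "s \<in> keys f" "t = s + sqfree R"
        by (rule keys_multE) (auto simp: x_def)
      then have k: "keys t = keys s \<union> R" using R by (simp add: keys_plus_nat keys_sqfree)
      have "keys s \<subseteq> {1..n}" "\<not> keys s \<subseteq> A" using s(1) fA unfolding mem_face_ideal_iff polys_iff by auto
      then have "keys t \<subseteq> {1..n}" "R \<subseteq> keys t" "keys t \<notin> {R..A}" using k R by auto
      moreover have "R \<in> V \<union> {R..A}" using RA by simp
      ultimately show "keys t \<in> V" using W unfolding up_closed_def by blast
    qed
  qed
qed

lemma relatively_shellable_up_closed:
  "relatively_shellable n d U V \<Longrightarrow> up_closed n U \<and> up_closed n V \<and> U \<subseteq> V"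
  by (induction rule: relatively_shellable.induct) auto

lemma relatively_shellable_card:
  "relatively_shellable n d U V \<Longrightarrow> B \<in> V - U \<Longrightarrow> card B \<le> d"
proof (induction rule: relatively_shellable.induct)
  case (add V R A)
  have "finite A" using add finite_subset[of A "{1..n}"] by auto
  then show ?case using add by (auto intro: card_mono)
qed auto

lemma relatively_shellable_weakly_regular:
  "relatively_shellable n d U V \<Longrightarrow>
    weakly_regular (esyms n d) (support_ideal U) (support_ideal V :: (monomial \<Rightarrow>\<^sub>0 'k::field) set)"
proof (induction rule: relatively_shellable.induct)
  case refl
  then show ?case by (intro weakly_regular_refl[OF support_ideal_ideal esyms_polys])
next
  case (add V R A)
  note up = relatively_shellable_up_closed[OF add.hyps(1)]
  let ?x = "single (sqfree R) 1 :: monomial \<Rightarrow>\<^sub>0 'k"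
  note step = shelling_step[OF _ add.hyps(6) add.hyps(2,3,5), where ?'k = 'k]
  have "weakly_regular (esyms n d) (support_ideal V) (support_ideal V \<boxplus> (*) ?x ` polys n)"
    using up step(2) add.hyps(3,4)
      sqfree_polys[OF order_trans[OF add.hyps(2,3)], of "1::'k"]
    by (intro weakly_regular_cyclic[where A = A] support_ideal_ideal) auto
  then have "weakly_regular (esyms n d) (support_ideal V) (support_ideal (V \<union> {R..A}) :: (monomial \<Rightarrow>\<^sub>0 'k) set)"
    using step(1) up by simp
  moreover have "U \<subseteq> V" "V \<subseteq> V \<union> {R..A}" using up by auto
  ultimately show ?case
    using up add.IH
    by (intro weakly_regular_trans[OF support_ideal_ideal support_ideal_ideal
          support_ideal_ideal[OF add.hyps(6)] support_ideal_mono support_ideal_mono esyms_polys,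
          of U V]) (simp_all del: Un_subset_iff)
qed

text \<open>
  The witness \<open>w\<close> is the squarefree monomial of the bottom \<open>R\<close> of the last interval \<open>{R..A}\<close>: its
  annihilator modulo the family before this interval is \<open>face_ideal n A\<close>, and \<open>U\<close> is contained in
  that family.
\<close>

lemma relatively_shellable_colon:
  assumes "relatively_shellable n d U V" "U \<noteq> V"
  shows "\<exists>A w. A \<subseteq> {1..n} \<and> card A = d \<and> w \<in> (support_ideal V :: (monomial \<Rightarrow>\<^sub>0 'k::field) set) \<and>
    (\<forall>f\<in>polys n. f * w \<in> support_ideal U \<longrightarrow> f \<in> face_ideal n A)"
  using assms(1)
proof cases
  case (add V' R A)
  note up = relatively_shellable_up_closed[OF add(2)]
  let ?x = "single (sqfree R) 1 :: monomial \<Rightarrow>\<^sub>0 'k"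
  have "finite R" using add finite_subset[of R "{1..n}"] by auto
  then have "?x \<in> support_ideal V" using add by (simp add: support_ideal_def keys_sqfree)
  moreover have "f \<in> face_ideal n A" if "f \<in> polys n" "f * ?x \<in> support_ideal U" for f
    using shelling_step(2)[of n V' R A f] up add that support_ideal_mono[of U V'] by blast
  ultimately show ?thesis using add by blast
qed (use assms in auto)

lemma shellable_factor_cohen_macaulay:
  fixes M :: "(monomial \<Rightarrow>\<^sub>0 'k::field, 'b) Module.module"
  assumes "presentation n (support_ideal V) (support_ideal U) M \<phi>"
    and "relatively_shellable n d U V" "U \<noteq> V"
  shows "cohen_macaulay (mpoly_ring n) (graded_maximal_ideal n) M"
    and "module_dim (mpoly_ring n) M = enat d"
proof -
  note up = relatively_shellable_up_closed[OF assms(2)]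
  interpret presentation n "support_ideal V" "support_ideal U" M \<phi> by fact
  interpret squarefree_presentation n V U M \<phi>
    by unfold_locales (use up assms in auto)
  obtain A w where "A \<subseteq> {1..n}" "card A = d" "w \<in> (support_ideal V :: (monomial \<Rightarrow>\<^sub>0 'k) set)"
    "\<And>f. f \<in> polys n \<Longrightarrow> f * w \<in> support_ideal U \<Longrightarrow> f \<in> face_ideal n A"
    using relatively_shellable_colon[OF assms(2,3)] by blast
  note c = cohen_macaulay_criterion[OF relatively_shellable_card[OF assms(2)]
      relatively_shellable_weakly_regular[OF assms(2)] this]
  show "cohen_macaulay (mpoly_ring n) (graded_maximal_ideal n) M"
    and "module_dim (mpoly_ring n) M = enat d"
    by (rule c; simp)+
qed

lemma up_closedD: "up_closed n U \<Longrightarrow> B \<in> U \<Longrightarrow> B \<subseteq> B' \<Longrightarrow> B' \<subseteq> {1..n} \<Longrightarrow> B' \<in> U"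
  by (auto simp: up_closed_def)

lemma up_closed_subset: "up_closed n U \<Longrightarrow> B \<in> U \<Longrightarrow> B \<subseteq> {1..n}"
  unfolding up_closed_def by blast

section \<open>Skeletons of simplices\<close>

text \<open>
  A criterion for adding only a part \<open>Y\<close> of a layer \<open>X\<close>: the part has to be up-closed relative to
  the layer.
\<close>

lemma up_closed_refine:
  assumes V: "up_closed n V" and VX: "up_closed n (V \<union> X)" and Y: "Y \<subseteq> X"
    and "\<And>B B'. B \<in> Y \<Longrightarrow> B \<subseteq> B' \<Longrightarrow> B' \<in> X \<Longrightarrow> B' \<in> Y"
  shows "up_closed n (V \<union> Y)"
  unfolding up_closed_def
proof (intro conjI ballI allI impI)
  show "V \<union> Y \<subseteq> Pow {1..n}" using VX Y unfolding up_closed_def by blast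
  fix B B' assume B: "B \<in> V \<union> Y" and B': "B \<subseteq> B' \<and> B' \<subseteq> {1..n}"
  show "B' \<in> V \<union> Y"
  proof (cases "B \<in> V")
    case True
    then show ?thesis using up_closedD[OF V True] B' by blast
  next
    case False
    then have "B' \<in> V \<union> X" using up_closedD[OF VX, of B B'] B B' Y by blast
    then show ?thesis using assms(4)[of B B'] False B B' by blast
  qed
qed

text \<open>
  The layer consists of the sets with at most \<open>d\<close> elements that are obtained from \<open>R\<close> by adding
  elements above \<open>c\<close>: a skeleton of a simplex. If exactly \<open>d\<close> elements are available, or \<open>R\<close> already
  has \<open>d\<close> elements, the layer is a single interval. Otherwise the sets containing \<open>c + 1\<close> are
  added first and those without it afterwards; both are layers of the same kind.
\<close>

lemma relatively_shellable_skeleton: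
  assumes "relatively_shellable n d U V" "R \<subseteq> {1..c}" "c \<le> n" "card R \<le> d" "d \<le> card R + (n - c)"
    and "V \<inter> {B. R \<subseteq> B \<and> B \<subseteq> R \<union> {c<..n} \<and> card B \<le> d} = {}"
    and "up_closed n (V \<union> {B. R \<subseteq> B \<and> B \<subseteq> R \<union> {c<..n} \<and> card B \<le> d})"
  shows "relatively_shellable n d U (V \<union> {B. R \<subseteq> B \<and> B \<subseteq> R \<union> {c<..n} \<and> card B \<le> d})"
  using assms
proof (induction "n - c" arbitrary: V R c)
  define X where "X = (\<lambda>R c. {B. R \<subseteq> B \<and> B \<subseteq> R \<union> {c<..n} \<and> card B \<le> d})"
  have X: "X R c = {B. R \<subseteq> B \<and> B \<subseteq> R \<union> {c<..n} \<and> card B \<le> d}" for R c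
    by (simp add: X_def)
  have interval: "relatively_shellable n d U (V \<union> X R c)"
    if "relatively_shellable n d U V" "R \<subseteq> A" "A \<subseteq> {1..n}" "card A = d" "X R c = {R..A}"
      "V \<inter> X R c = {}" "up_closed n (V \<union> X R c)" for V R A c
    using relatively_shellable.add[of n d U V R A] that by simp
  have full: "X R c = {R..R \<union> {c<..n}} \<and> card (R \<union> {c<..n}) = d"
    if "R \<subseteq> {1..c}" "d = card R + (n - c)" for R c
  proof -
    have fR: "finite R" using that(1) finite_subset by blast
    have "card (R \<union> {c<..n}) = card R + card {c<..n}"
      using fR that(1) by (intro card_Un_disjoint) auto
    then have c: "card (R \<union> {c<..n}) = d" using that by simp
    have "card B \<le> d" if "B \<subseteq> R \<union> {c<..n}" for B
      using card_mono[OF _ that] fR c by simp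
    then show ?thesis
      using c unfolding X_def atLeastAtMost_def atLeast_def atMost_def by blast
  qed
  { case 0
    have "n = c" using 0 by simp
    then show ?case
      using interval[of V R "R \<union> {c<..n}" c] full[of R c] 0 unfolding X_def by fastforce }
  { case (Suc m)
    have fR: "finite R" using Suc.prems(2) finite_subset by blast
    consider "d = card R + (n - c)" | "card R = d" | "card R < d" "d < card R + (n - c)"
      using Suc.prems by linarith
    then show ?case
    proof cases
      case 1
      have "R \<union> {c<..n} \<subseteq> {1..n}" using Suc.prems(2,3) by auto
      then show ?thesis
        using interval[of V R "R \<union> {c<..n}" c] full[of R c] 1 Suc.prems unfolding X_def by blast
    next
      case 2
      have "B = R" if "R \<subseteq> B" "B \<subseteq> R \<union> {c<..n}" "card B \<le> d" for B
        using that 2 fR finite_subset[OF that(2)] card_seteq[of B R] by simp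
      then have "X R c = {R..R}" using 2 by (auto simp: X_def)
      moreover have "R \<subseteq> {1..n}" using Suc.prems(2,3) by auto
      ultimately show ?thesis
        using interval[of V R R c] 2 Suc.prems unfolding X_def by blast
    next
      case 3
      let ?R = "insert (Suc c) R"
      have cn: "Suc c \<le> n" and m: "m = n - Suc c" using Suc.hyps(2) by auto
      have cR: "Suc c \<notin> R" using Suc.prems(2) by auto
      have split: "{c<..n} = insert (Suc c) {Suc c<..n}" using cn by auto
      have X1: "X ?R (Suc c) = {B \<in> X R c. Suc c \<in> B}" and X2: "X R (Suc c) = {B \<in> X R c. Suc c \<notin> B}"
        unfolding X_def split using cR by auto
      have V: "up_closed n V" using relatively_shellable_up_closed[OF Suc.prems(1)] by simp
      have VX: "up_closed n (V \<union> X R c)" and disj: "V \<inter> X R c = {}"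
        using Suc.prems(6,7) unfolding X_def by auto
      have V1: "up_closed n (V \<union> X ?R (Suc c))"
        unfolding X1 by (rule up_closed_refine[OF V VX]) auto
      have "relatively_shellable n d U (V \<union> X ?R (Suc c))"
        unfolding X[of ?R "Suc c"]
      proof (rule Suc.hyps(1)[OF m Suc.prems(1)])
        show "?R \<subseteq> {1..Suc c}" "Suc c \<le> n" "card ?R \<le> d" "d \<le> card ?R + (n - Suc c)"
          using Suc.prems(2) cn 3 cR fR Suc.hyps(2) by auto
        show "V \<inter> {B. ?R \<subseteq> B \<and> B \<subseteq> ?R \<union> {Suc c<..n} \<and> card B \<le> d} = {}"
          unfolding X[symmetric] X1 using disj by blast
        show "up_closed n (V \<union> {B. ?R \<subseteq> B \<and> B \<subseteq> ?R \<union> {Suc c<..n} \<and> card B \<le> d})"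
          unfolding X[symmetric] by (rule V1)
      qed
      moreover have "V \<union> X ?R (Suc c) \<union> X R (Suc c) = V \<union> X R c" unfolding X1 X2 by blast
      moreover have "relatively_shellable n d U (V \<union> X ?R (Suc c) \<union> X R (Suc c))"
        if rs: "relatively_shellable n d U (V \<union> X ?R (Suc c))"
        unfolding X[of R "Suc c"]
      proof (rule Suc.hyps(1)[OF m rs])
        show "R \<subseteq> {1..Suc c}" "Suc c \<le> n" "card R \<le> d" "d \<le> card R + (n - Suc c)"
          using Suc.prems(2) cn 3 Suc.hyps(2) by auto
        show "(V \<union> X ?R (Suc c)) \<inter> {B. R \<subseteq> B \<and> B \<subseteq> R \<union> {Suc c<..n} \<and> card B \<le> d} = {}"
          unfolding X[of R "Suc c", symmetric] unfolding X1 X2 using disj by blast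
        show "up_closed n (V \<union> X ?R (Suc c) \<union> {B. R \<subseteq> B \<and> B \<subseteq> R \<union> {Suc c<..n} \<and> card B \<le> d})"
          unfolding X[of R "Suc c", symmetric] using VX \<open>V \<union> X ?R (Suc c) \<union> X R (Suc c) = V \<union> X R c\<close> by simp
      qed
      ultimately show ?thesis unfolding X[of R c, symmetric] by simp
    qed }
qed

section \<open>Sequential shellings\<close>

text \<open>
  Consecutive relative shellings with increasing sizes of the tops; \<open>d\<close> is the last size. Each
  layer will give one factor of the filtration.
\<close>

inductive sequentially_shellable :: "nat \<Rightarrow> nat set set \<Rightarrow> nat \<Rightarrow> nat set set \<Rightarrow> bool" for n U where
  first: "relatively_shellable n d U V \<Longrightarrow> U \<noteq> V \<Longrightarrow> sequentially_shellable n U d V"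
| later: "\<lbrakk>sequentially_shellable n U d V; d < e; relatively_shellable n e V W; V \<noteq> W\<rbrakk>
    \<Longrightarrow> sequentially_shellable n U e W"

lemma sequentially_shellable_up_closed: "sequentially_shellable n U d V \<Longrightarrow> up_closed n V \<and> U \<subset> V"
  by (induction rule: sequentially_shellable.induct)
     (blast dest: relatively_shellable_up_closed)+

text \<open>
  An interval whose top is as large as the previous ones extends the last layer, and one with
  a larger top opens a new layer.
\<close>

lemma sequentially_shellable_add:
  assumes V: "sequentially_shellable n U d V" "d \<le> card A"
    and RA: "R \<subseteq> A" "A \<subseteq> {1..n}" "V \<inter> {R..A} = {}" "up_closed n (V \<union> {R..A})"
  shows "sequentially_shellable n U (card A) (V \<union> {R..A})"
proof (cases "d < card A")
  case True
  have "relatively_shellable n (card A) V (V \<union> {R..A})"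
    by (rule relatively_shellable.add[OF relatively_shellable.refl])
       (use RA sequentially_shellable_up_closed[OF V(1)] in auto)
  moreover have "R \<in> {R..A}" "R \<notin> V" using RA(1,3) by auto
  then have "V \<noteq> V \<union> {R..A}" by blast
  ultimately show ?thesis using sequentially_shellable.later[OF V(1) True] by blast
next
  case False
  then have d: "d = card A" using V(2) by simp
  have ext: "relatively_shellable n d V' (V \<union> {R..A}) \<and> V' \<noteq> V \<union> {R..A}"
    if "relatively_shellable n d V' V" "V' \<noteq> V" for V'
  proof
    show "relatively_shellable n d V' (V \<union> {R..A})"
      by (rule relatively_shellable.add[OF that(1)]) (use RA d in auto)
    show "V' \<noteq> V \<union> {R..A}" using relatively_shellable_up_closed[OF that(1)] that(2) by auto
  qed
  show ?thesis
    using V(1)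
  proof cases
    case first
    then show ?thesis using ext[of U] d sequentially_shellable.first by blast
  next
    case (later d' V')
    then show ?thesis using ext[of V'] d sequentially_shellable.later by blast
  qed
qed

lemma sequentially_shellable_filtration:
  "sequentially_shellable n U d V \<Longrightarrow>
   \<exists>(r::nat) F e. F 0 = U \<and> F r = V \<and> e r = d \<and>
     (\<forall>i\<in>{1..r}. relatively_shellable n (e i) (F (i - 1)) (F i) \<and> F (i - 1) \<noteq> F i) \<and>
     (\<forall>i\<in>{1..<r}. e i < e (i + 1))"
proof (induction rule: sequentially_shellable.induct)
  case (first d V)
  show ?case
    by (rule exI[of _ "Suc 0"], rule exI[of _ "\<lambda>i. if i = 0 then U else V"], rule exI[of _ "\<lambda>_. d"])
       (use first in simp)
next
  case (later d V d' W)
  from later.IH obtain r :: nat and F e where F: "F 0 = U" "F r = V" "e r = d"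
      "\<forall>i\<in>{1..r}. relatively_shellable n (e i) (F (i - 1)) (F i) \<and> F (i - 1) \<noteq> F i"
      "\<forall>i\<in>{1..<r}. e i < e (i + 1)"
    by (elim exE conjE) (rule that)
  show ?case
  proof (rule exI[of _ "Suc r"], rule exI[of _ "F(Suc r := W)"], rule exI[of _ "e(Suc r := d')"],
      intro conjI ballI)
    let ?F = "F(Suc r := W)" and ?e = "e(Suc r := d')"
    show "?F 0 = U" "?F (Suc r) = W" "?e (Suc r) = d'" using F by auto
    fix i assume i: "i \<in> {1..Suc r}"
    show "relatively_shellable n (?e i) (?F (i - 1)) (?F i)" "?F (i - 1) \<noteq> ?F i"
      using F(2) bspec[OF F(4), of i] i later by (auto simp: le_Suc_eq)
  next
    fix i assume i: "i \<in> {1..<Suc r}"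
    then show "(e(Suc r := d')) i < (e(Suc r := d')) (i + 1)"
      using F(3) bspec[OF F(5), of i] later(2) by (cases "i = r") auto
  qed
qed

section \<open>The complex of a squarefree lexsegment\<close>

text \<open>
  The set \<open>J\<close> is the support of the squarefree monomial that determines the lexsegment.
\<close>

locale lex_position =
  fixes n q :: nat and J :: "nat set"
  assumes q: "2 \<le> q" and J: "J \<subseteq> {2..n}" and card_J: "card J = q"
begin

lemma finite_J: "finite J"
  using finite_subset[OF J] by simp

definition facet :: "nat \<Rightarrow> nat set" where
  "facet j = {x \<in> J. x < j} \<union> {j<..n}"

text \<open>
  The sets below none of the facets that belong to elements of \<open>J\<close> less than \<open>p\<close>. This family
  grows as \<open>p\<close> decreases, from the sets below no facet to the full power set.
\<close>

definition avoid :: "nat \<Rightarrow> nat set set" where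
  "avoid p = {B. B \<subseteq> {1..n} \<and> (\<forall>j\<in>J. j < p \<longrightarrow> \<not> B \<subseteq> facet j)}"

definition nonfaces :: "nat set set" where
  "nonfaces = {B \<in> avoid (Suc n). q \<le> card B}"

lemma avoid_Suc_n: "avoid (Suc n) = {B. B \<subseteq> {1..n} \<and> (\<forall>j\<in>J. \<not> B \<subseteq> facet j)}"
  unfolding avoid_def using J by auto

lemma up_closed_avoid: "up_closed n (avoid p)"
  unfolding up_closed_def avoid_def by blast

lemma up_closed_nonfaces: "up_closed n nonfaces"
  unfolding up_closed_def
proof (intro conjI ballI allI impI)
  show "nonfaces \<subseteq> Pow {1..n}" unfolding nonfaces_def avoid_def by blast
  fix B B' assume B: "B \<in> nonfaces" and B': "B \<subseteq> B' \<and> B' \<subseteq> {1..n}"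
  then have "card B \<le> card B'" using finite_subset[of B' "{1..n}"] by (intro card_mono) auto
  then show "B' \<in> nonfaces"
    using B B' up_closedD[OF up_closed_avoid, of B "Suc n" B'] by (auto simp: nonfaces_def)
qed

text \<open>
  The layer consists of the small sets below no facet that agree with \<open>J\<close> on \<open>{1..p}\<close>. If
  \<open>p + 1 \<in> J\<close>, such a set contains \<open>p + 1\<close>, since otherwise it would be below \<open>facet (p + 1)\<close>. If
  \<open>p + 1 \<notin> J\<close>, the sets containing \<open>p + 1\<close> are unrestricted above it and form a skeleton of a
  simplex; they come first, and the others agree with \<open>J\<close> on \<open>{1..p + 1}\<close>. At the end only \<open>J\<close>
  itself could remain, but it has \<open>q\<close> elements.
\<close>

lemma relatively_shellable_small_nonsubsets:
  defines "d \<equiv> q - 1"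
  defines "Y \<equiv> \<lambda>p. {B \<in> avoid (Suc n). card B \<le> d \<and> B \<inter> {1..p} = J \<inter> {1..p}}"
  assumes "p \<le> n" "relatively_shellable n d U V" "V \<inter> Y p = {}" "up_closed n (V \<union> Y p)"
  shows "relatively_shellable n d U (V \<union> Y p)"
  using assms(3-)
proof (induction "n - p" arbitrary: V p)
  case 0
  have "B = J" if "B \<in> Y p" for B
  proof -
    have "B \<inter> {1..n} = J \<inter> {1..n}" "B \<subseteq> {1..n}" using that 0 by (auto simp: Y_def avoid_def)
    moreover have "J \<subseteq> {1..n}" using J by auto
    ultimately show ?thesis by blast
  qed
  then have "Y p = {}" using card_J q by (fastforce simp: Y_def d_def)
  then show ?case using 0 by simp
next
  case (Suc m)
  then have m: "m = n - Suc p" and pn: "Suc p \<le> n" by auto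
  have "{1..Suc p} = insert (Suc p) {1..p}" by auto
  then have p1: "B \<inter> {1..Suc p} = J \<inter> {1..Suc p} \<longleftrightarrow>
      (Suc p \<in> B \<longleftrightarrow> Suc p \<in> J) \<and> B \<inter> {1..p} = J \<inter> {1..p}" for B
    by (auto simp: set_eq_iff)
  show ?case
  proof (cases "Suc p \<in> J")
    case True
    have "Suc p \<in> B" if B: "B \<in> Y p" for B
    proof (rule ccontr)
      assume p: "Suc p \<notin> B"
      have "B \<subseteq> facet (Suc p)"
      proof
        fix b assume b: "b \<in> B"
        then have "b \<in> {1..n}" using B unfolding Y_def avoid_def by blast
        show "b \<in> facet (Suc p)"
        proof (cases "b \<le> p")
          case True
          then have "b \<in> B \<inter> {1..p}" using b \<open>b \<in> {1..n}\<close> by auto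
          then have "b \<in> J" using B unfolding Y_def by blast
          then show ?thesis using True by (simp add: facet_def)
        next
          case False
          then have "Suc p < b" using p b by (metis Suc_lessI not_le_imp_less)
          then show ?thesis using \<open>b \<in> {1..n}\<close> by (simp add: facet_def)
        qed
      qed
      then show False using B True unfolding Y_def avoid_Suc_n by blast
    qed
    then have "Y p = Y (Suc p)" using True unfolding Y_def p1 by blast
    then show ?thesis using Suc.hyps(1)[OF m pn] Suc.prems by simp
  next
    case False
    define R where "R = insert (Suc p) (J \<inter> {1..p})"
    define X where "X = {B. R \<subseteq> B \<and> B \<subseteq> R \<union> {Suc p<..n} \<and> card B \<le> d}"
    have R: "R \<subseteq> {1..Suc p}" "finite R" using finite_J by (auto simp: R_def)
    have X: "X = {B \<in> Y p. Suc p \<in> B}"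
    proof (intro equalityI subsetI)
      fix B assume B: "B \<in> X"
      have "{1..Suc p} \<subseteq> {1..n}" "{Suc p<..n} \<subseteq> {1..n}" using pn by auto
      then have Bn: "B \<subseteq> {1..n}" using B R(1) unfolding X_def by blast
      have "\<not> B \<subseteq> facet j" if j: "j \<in> J" for j
      proof (cases "j \<le> p")
        case True
        then have "j \<in> R" using j J by (auto simp: R_def)
        then show ?thesis using B by (auto simp: X_def facet_def)
      next
        case j': False
        then have "Suc p \<notin> facet j" using False j by (auto simp: facet_def)
        then show ?thesis using B by (auto simp: X_def R_def)
      qed
      moreover have "B \<inter> {1..p} = J \<inter> {1..p}"
      proof -
        have "R \<inter> {1..p} = J \<inter> {1..p}" "{Suc p<..n} \<inter> {1..p} = {}" by (auto simp: R_def)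
        then show ?thesis using B unfolding X_def by blast
      qed
      ultimately show "B \<in> {B \<in> Y p. Suc p \<in> B}"
        using B Bn by (auto simp: Y_def avoid_Suc_n X_def R_def)
    next
      fix B assume "B \<in> {B \<in> Y p. Suc p \<in> B}"
      then have B: "B \<subseteq> {1..n}" "card B \<le> d" "B \<inter> {1..p} = J \<inter> {1..p}" "Suc p \<in> B"
        by (auto simp: Y_def avoid_def)
      have "b \<in> R \<union> {Suc p<..n}" if b: "b \<in> B" for b
      proof (cases "b \<le> p")
        case True
        then have "b \<in> B \<inter> {1..p}" using b B(1) by auto
        then have "b \<in> J \<inter> {1..p}" unfolding B(3) .
        then show ?thesis by (simp add: R_def)
      next
        case False
        then show ?thesis using b B(1) by (auto simp: R_def)
      qed
      then have "B \<subseteq> R \<union> {Suc p<..n}" by blast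
      moreover have "R \<subseteq> B" using B(3,4) unfolding R_def by blast
      ultimately show "B \<in> X" using B(2) unfolding X_def by blast
    qed
    have Y: "Y p = X \<union> Y (Suc p)"
    proof -
      have "Y (Suc p) = {B \<in> Y p. Suc p \<notin> B}" using False unfolding Y_def p1 by blast
      then show ?thesis unfolding X by blast
    qed
    have disj: "X \<inter> Y (Suc p) = {}" using False unfolding X Y_def p1 by blast
    have V: "up_closed n V" using relatively_shellable_up_closed[OF Suc.prems(2)] by simp
    have VX: "up_closed n (V \<union> X)"
      by (rule up_closed_refine[OF V Suc.prems(4)]) (auto simp: X)
    have rs: "relatively_shellable n d U (V \<union> X)"
    proof (cases "card R \<le> d")
      case True
      have "card J = card (J \<inter> {1..p}) + card (J \<inter> {Suc p<..n})"
      proof -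
        have "J = (J \<inter> {1..p}) \<union> (J \<inter> {Suc p<..n})"
        proof (intro equalityI subsetI)
          fix x assume x: "x \<in> J"
          then have "x \<in> {2..n}" "x \<noteq> Suc p" using J False by auto
          then show "x \<in> (J \<inter> {1..p}) \<union> (J \<inter> {Suc p<..n})" using x by (cases "x \<le> p") auto
        qed auto
        moreover have "card ((J \<inter> {1..p}) \<union> (J \<inter> {Suc p<..n})) = card (J \<inter> {1..p}) + card (J \<inter> {Suc p<..n})"
          using finite_J by (intro card_Un_disjoint) auto
        ultimately show ?thesis by simp
      qed
      also have "card (J \<inter> {Suc p<..n}) \<le> card {Suc p<..n}" by (intro card_mono) auto
      also have "card {Suc p<..n} = n - Suc p" by simp
      finally have "q \<le> card (J \<inter> {1..p}) + (n - Suc p)" using card_J by simp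
      moreover have "card R = Suc (card (J \<inter> {1..p}))" using finite_J by (simp add: R_def)
      ultimately have "d \<le> card R + (n - Suc p)" by (simp add: d_def)
      then show ?thesis
        unfolding X_def
        by (intro relatively_shellable_skeleton[OF Suc.prems(2) R(1) pn True])
           (use Suc.prems(3) Y VX in \<open>auto simp: X_def\<close>)
    next
      case False
      have "X = {}"
      proof (rule ccontr)
        assume "X \<noteq> {}"
        then obtain B where B: "R \<subseteq> B" "B \<subseteq> R \<union> {Suc p<..n}" "card B \<le> d" by (auto simp: X_def)
        have "card R \<le> card B" using B R(2) finite_subset[OF B(2)] by (intro card_mono) auto
        then show False using B False by simp
      qed
      then show ?thesis using Suc.prems(2) by simp
    qed
    have "relatively_shellable n d U (V \<union> X \<union> Y (Suc p))"
      by (rule Suc.hyps(1)[OF m pn rs]) (use Suc.prems(3,4) disj in \<open>auto simp: Y Un_assoc\<close>)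
    then show ?thesis by (simp add: Y Un_assoc)
  qed
qed

lemma first_layer_shellable: "sequentially_shellable n nonfaces (q - 1) (avoid (Suc n))"
proof (rule sequentially_shellable.first)
  let ?Y = "{B \<in> avoid (Suc n). card B \<le> q - 1 \<and> B \<inter> {1..0} = J \<inter> {1..0}}"
  have Y: "avoid (Suc n) = nonfaces \<union> ?Y" by (auto simp: nonfaces_def)
  have "relatively_shellable n (q - 1) nonfaces (nonfaces \<union> ?Y)"
    by (rule relatively_shellable_small_nonsubsets)
       (use q Y[symmetric] up_closed_avoid[of "Suc n"] relatively_shellable.refl[OF up_closed_nonfaces]
         in \<open>auto simp: nonfaces_def\<close>)
  then show "relatively_shellable n (q - 1) nonfaces (avoid (Suc n))" using Y by simp
  have "J \<noteq> {}" using card_J q by auto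
  then have "1 \<in> {1..n}" using J by force
  moreover have "1 \<notin> facet j" if "j \<in> J" for j using J that by (auto simp: facet_def)
  ultimately have "{1} \<in> avoid (Suc n)" by (auto simp: avoid_def)
  moreover have "{1} \<notin> nonfaces" using q by (simp add: nonfaces_def)
  ultimately show "nonfaces \<noteq> avoid (Suc n)" by blast
qed

lemma card_facet: "card (facet j) = card {x \<in> J. x < j} + (n - j)"
proof -
  have "card (facet j) = card {x \<in> J. x < j} + card {j<..n}"
    unfolding facet_def using finite_J by (intro card_Un_disjoint) auto
  then show ?thesis by simp
qed

text \<open>
  The facets do not shrink when their index decreases, so the shelling can end with them in
  this order.
\<close>

lemma card_facet_antimono:
  assumes "j < p" "p \<le> n"
  shows "card (facet p) \<le> card (facet j)"
proof -
  have "card {x \<in> J. x < p} \<le> card ({x \<in> J. x < j} \<union> {j..<p})"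
    using finite_J by (intro card_mono) auto
  also have "\<dots> \<le> card {x \<in> J. x < j} + (p - j)"
    using card_Un_le[of "{x \<in> J. x < j}" "{j..<p}"] by simp
  finally show ?thesis using assms by (simp add: card_facet)
qed

lemma card_facet_ge:
  assumes "j \<in> J"
  shows "q - 1 \<le> card (facet j)"
proof -
  have "card J \<le> card ({x \<in> J. x < j} \<union> {j..n})"
    using finite_J J by (intro card_mono) auto
  also have "\<dots> \<le> card {x \<in> J. x < j} + (Suc n - j)"
    using card_Un_le[of "{x \<in> J. x < j}" "{j..n}"] by simp
  finally show ?thesis using card_J by (simp add: card_facet)
qed

text \<open>
  A set below \<open>facet p\<close>, but below no \<open>facet j\<close> with smaller index, contains every element \<open>j\<close> of \<open>J\<close>
  less than \<open>p\<close>, because \<open>j\<close> is the only element of \<open>facet p\<close> that \<open>facet j\<close> misses.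
\<close>

lemma avoid_step:
  assumes p: "p \<in> J"
  shows "avoid p = avoid (Suc p) \<union> {{x \<in> J. x < p}..facet p}"
    and "avoid (Suc p) \<inter> {{x \<in> J. x < p}..facet p} = {}"
proof -
  have Gn: "facet p \<subseteq> {1..n}" using J by (auto simp: facet_def)
  have "B \<in> avoid (Suc p) \<or> B \<in> {{x \<in> J. x < p}..facet p}" if B: "B \<in> avoid p" for B
  proof (cases "B \<subseteq> facet p")
    case True
    have "j \<in> B" if j: "j \<in> J" "j < p" for j
    proof -
      obtain x where x: "x \<in> B" "x \<notin> facet j" using B j by (auto simp: avoid_def)
      then have "x \<in> facet p" using True by auto
      moreover have "x \<le> n" using x(1) B unfolding avoid_def by auto
      ultimately have "x = j" using x(2) j by (auto simp: facet_def not_less)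
      then show ?thesis using x by simp
    qed
    then show ?thesis using True by auto
  next
    case False
    then show ?thesis using B by (auto simp: avoid_def less_Suc_eq)
  qed
  moreover have "B \<in> avoid p" if "B \<in> {{x \<in> J. x < p}..facet p}" for B
  proof -
    have "\<not> B \<subseteq> facet j" if "j \<in> J" "j < p" for j
      using that \<open>B \<in> {{x \<in> J. x < p}..facet p}\<close> by (force simp: facet_def)
    then show ?thesis using that Gn unfolding avoid_def by auto
  qed
  moreover have "avoid (Suc p) \<subseteq> avoid p" by (auto simp: avoid_def)
  ultimately show "avoid p = avoid (Suc p) \<union> {{x \<in> J. x < p}..facet p}" by blast
  show "avoid (Suc p) \<inter> {{x \<in> J. x < p}..facet p} = {}" using p by (auto simp: avoid_def)
qed

lemma layers_shellable:
  "p \<le> Suc n \<Longrightarrow> \<exists>d. sequentially_shellable n nonfaces d (avoid p) \<and> (\<forall>j\<in>J. j < p \<longrightarrow> d \<le> card (facet j))"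
proof (induction p rule: inc_induct)
  case base
  then show ?case using first_layer_shellable card_facet_ge by blast
next
  case (step p)
  then obtain d where d: "sequentially_shellable n nonfaces d (avoid (Suc p))"
    "\<forall>j\<in>J. j < Suc p \<longrightarrow> d \<le> card (facet j)" by auto
  show ?case
  proof (cases "p \<in> J")
    case True
    have "sequentially_shellable n nonfaces (card (facet p)) (avoid (Suc p) \<union> {{x \<in> J. x < p}..facet p})"
    proof (rule sequentially_shellable_add[OF d(1)])
      show "d \<le> card (facet p)" using d(2) True by simp
      show "{x \<in> J. x < p} \<subseteq> facet p" by (auto simp: facet_def)
      show "facet p \<subseteq> {1..n}" using J by (auto simp: facet_def)
      show "avoid (Suc p) \<inter> {{x \<in> J. x < p}..facet p} = {}" by (rule avoid_step(2)[OF True])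
      show "up_closed n (avoid (Suc p) \<union> {{x \<in> J. x < p}..facet p})"
        using up_closed_avoid[of p] avoid_step(1)[OF True] by simp
    qed
    then have "sequentially_shellable n nonfaces (card (facet p)) (avoid p)"
      using avoid_step(1)[OF True] by simp
    moreover have "card (facet p) \<le> card (facet j)" if "j < p" for j
      using step.hyps True J that by (intro card_facet_antimono) auto
    ultimately show ?thesis by blast
  next
    case False
    have "avoid (Suc p) = avoid p" using False by (auto simp: avoid_def less_Suc_eq)
    then show ?thesis using d by auto
  qed
qed

lemma sequentially_shellable_nonfaces: "\<exists>d. sequentially_shellable n nonfaces d (Pow {1..n})"
proof -
  have "avoid 0 = Pow {1..n}" by (auto simp: avoid_def)
  then show ?thesis using layers_shellable[of 0] by auto
qed

end

section \<open>The grading of the residue class ring\<close>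

abbreviation hom_comp :: "int \<Rightarrow> (monomial \<Rightarrow>\<^sub>0 'k::field) \<Rightarrow> (monomial \<Rightarrow>\<^sub>0 'k)" where
  "hom_comp d \<equiv> poly_part (\<lambda>t. int (mdegree t) = d)"

lemma hom_comp_support_ideal: "f \<in> support_ideal V \<Longrightarrow> hom_comp d f \<in> support_ideal V"
  by (auto simp: support_ideal_def keys_poly_part)

lemma hom_comp_diff: "hom_comp d (f - g) = hom_comp d f - hom_comp d g"
  by (rule poly_mapping_eqI) (simp add: lookup_poly_part lookup_minus)

lemma hom_comp_sum: "hom_comp d (sum f X) = (\<Sum>x\<in>X. hom_comp d (f x))"
  by (rule poly_mapping_eqI) (simp add: lookup_poly_part lookup_sum)

lemma sum_hom_comp:
  assumes "finite X" "int ` mdegree ` keys f \<subseteq> X"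
  shows "(\<Sum>d\<in>X. hom_comp d f) = f"
proof (rule poly_mapping_eqI)
  fix t
  have "lookup (\<Sum>d\<in>X. hom_comp d f) t = (\<Sum>d\<in>X. if d = int (mdegree t) then lookup f t else 0)"
    unfolding lookup_sum lookup_poly_part by (intro sum.cong) auto
  also have "\<dots> = (if int (mdegree t) \<in> X then lookup f t else 0)"
    using assms(1) by (simp add: sum.delta)
  also have "\<dots> = lookup f t"
  proof (cases "t \<in> keys f")
    case True
    then show ?thesis using assms(2) by auto
  qed (simp add: in_keys_iff)
  finally show "lookup (\<Sum>d\<in>X. hom_comp d f) t = lookup f t" .
qed

definition hom_part :: "nat \<Rightarrow> int \<Rightarrow> (monomial \<Rightarrow>\<^sub>0 'k::field) set" where
  "hom_part n d = {f \<in> polys n. \<forall>t\<in>keys f. int (mdegree t) = d}"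

text \<open>
  Indexing by integers puts \<open>{0}\<close> in negative degrees, in accordance with \<open>quot_grading\<close>.
\<close>

lemma hom_part_eq: "hom_part n d = (if d < 0 then {0} else homogeneous n (nat d))"
proof (cases "d < 0")
  case True
  have "f = 0" if "f \<in> hom_part n d" for f :: "monomial \<Rightarrow>\<^sub>0 'a"
  proof -
    have "keys f = {}" using that True by (auto simp: hom_part_def)
    then show ?thesis by simp
  qed
  then show ?thesis using True by (auto simp: hom_part_def)
next
  case False
  then show ?thesis by (auto simp: hom_part_def homogeneous_def)
qed

lemma hom_part_closed:
  "0 \<in> hom_part n d"
  "f \<in> hom_part n d \<Longrightarrow> g \<in> hom_part n d \<Longrightarrow> f + g \<in> hom_part n d"
  "f \<in> hom_part n d \<Longrightarrow> - f \<in> hom_part n d"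
  "f \<in> hom_part n d \<Longrightarrow> f \<in> polys n"
  "f \<in> polys n \<Longrightarrow> hom_comp d f \<in> hom_part n d"
proof -
  show "f + g \<in> hom_part n d" if "f \<in> hom_part n d" "g \<in> hom_part n d"
    using that keys_add[of f g] unfolding hom_part_def by blast
  show "hom_comp d f \<in> hom_part n d" if "f \<in> polys n"
    using that by (auto simp: hom_part_def keys_poly_part polys_iff)
qed (auto simp: hom_part_def keys_uminus)

lemma hom_part_mult:
  assumes "f \<in> hom_part n e" "g \<in> hom_part n d"
  shows "f * g \<in> hom_part n (e + d)"
proof -
  have "int (mdegree t) = e + d" if "t \<in> keys (f * g)" for t
    using that assms by (auto simp: hom_part_def mdegree_plus elim!: keys_multE)
  then show ?thesis using assms by (auto simp: hom_part_def)
qed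

lemma hom_comp_hom_part: "f \<in> hom_part n e \<Longrightarrow> hom_comp d f = (if d = e then f else 0)"
  by (rule poly_mapping_eqI) (auto simp: lookup_poly_part hom_part_def in_keys_iff)

lemma presentation_self:
  "presentation n (polys n) {0} (self_module (mpoly_ring n)) (\<lambda>f :: monomial \<Rightarrow>\<^sub>0 'k::field. f)"
proof (rule presentation.intro)
  interpret R: cring "mpoly_ring n :: (monomial \<Rightarrow>\<^sub>0 'k) ring" by (rule cring_mpoly_ring)
  show "Module.module (mpoly_ring n) (self_module (mpoly_ring n :: (monomial \<Rightarrow>\<^sub>0 'k) ring))"
  proof (rule moduleI)
    show "abelian_group (self_module (mpoly_ring n :: (monomial \<Rightarrow>\<^sub>0 'k) ring))"
    proof (rule abelian_groupI)
      fix f assume "f \<in> carrier (self_module (mpoly_ring n :: (monomial \<Rightarrow>\<^sub>0 'k) ring))"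
      then show "\<exists>g\<in>carrier (self_module (mpoly_ring n)).
          g \<oplus>\<^bsub>self_module (mpoly_ring n)\<^esub> f = \<zero>\<^bsub>self_module (mpoly_ring n)\<^esub>"
        by (intro bexI[of _ "- f"]) (auto simp: self_module_def)
    qed (auto simp: self_module_def algebra_simps)
  qed (auto simp: self_module_def algebra_simps cring_mpoly_ring)
qed (auto simp: self_module_def ideal_mpoly_ring_iff)

locale squarefree_quotient =
  fixes n :: nat and U :: "nat set set" and I :: "(monomial \<Rightarrow>\<^sub>0 'k::field) set"
    and Q :: "(monomial \<Rightarrow>\<^sub>0 'k, (monomial \<Rightarrow>\<^sub>0 'k) set) Module.module" and \<pi> :: "(monomial \<Rightarrow>\<^sub>0 'k) \<Rightarrow> (monomial \<Rightarrow>\<^sub>0 'k) set"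
  assumes up: "up_closed n U" and I: "I = support_ideal U"
    and Q: "Q = quot_module (self_module (mpoly_ring n)) I"
    and \<pi>: "\<pi> = (\<lambda>f. I +>\<^bsub>mpoly_ring n\<^esub> f)"
begin

lemma I_ideal: "ideal I (mpoly_ring n)"
  unfolding I by (rule support_ideal_ideal[OF up])

lemma presentation_Q: "presentation n (polys n) I Q \<pi>"
proof -
  interpret s: presentation n "polys n" "{0}" "self_module (mpoly_ring n)" "\<lambda>f :: monomial \<Rightarrow>\<^sub>0 'k. f"
    by (rule presentation_self)
  have "presentation n (polys n) I (quot_module (self_module (mpoly_ring n)) ((\<lambda>f. f) ` I))
      (\<lambda>f. (\<lambda>f. f) ` I +>\<^bsub>self_module (mpoly_ring n)\<^esub> f)"
    using ideal_zero[OF I_ideal] ideal_polys[OF I_ideal] by (intro s.presentation_quot I_ideal) auto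
  moreover have "I +>\<^bsub>self_module (mpoly_ring n)\<^esub> f = I +>\<^bsub>mpoly_ring n\<^esub> f" for f
    by (simp add: a_r_coset_def' self_module_def)
  ultimately show ?thesis unfolding Q \<pi> by simp
qed

sublocale presentation n "polys n" I Q \<pi> by (rule presentation_Q)

lemma quot_grading_eq: "quot_grading n I d = \<pi> ` hom_part n d"
proof -
  have "\<pi> 0 = I" using hom_zero unfolding Q by simp
  then show ?thesis unfolding quot_grading_def hom_part_eq by (auto simp: \<pi>)
qed

lemma hom_finsum:
  assumes "finite X" "\<And>x. x \<in> X \<Longrightarrow> g x \<in> polys n"
  shows "\<pi> (\<Sum>x\<in>X. g x) = finsum Q (\<lambda>x. \<pi> (g x)) X"
  using assms
proof (induction X)
  case (insert x X)
  have "\<pi> (g x + (\<Sum>x\<in>X. g x)) = \<pi> (g x) \<oplus>\<^bsub>Q\<^esub> \<pi> (\<Sum>x\<in>X. g x)"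
    using insert.prems by (intro hom_add polys_sum) auto
  then show ?case
    using insert hom_closed by (subst finsum_insert) auto
qed (simp add: hom_zero)

text \<open>
  The ideal is generated by monomials, so it contains the homogeneous components of each of
  its elements. Lifting the given components to homogeneous polynomials and comparing with the
  components of \<open>f\<close> determines them modulo the ideal.
\<close>

lemma decomposition_unique:
  assumes f: "f \<in> polys n" and c: "homogeneous_decomposition Q (quot_grading n I) (\<pi> f) c"
  shows "c d = \<pi> (hom_comp d f)"
proof -
  let ?X = "{d. c d \<noteq> \<zero>\<^bsub>Q\<^esub>}"
  have "\<forall>d. \<exists>g. g \<in> hom_part n d \<and> c d = \<pi> g"
    using c unfolding homogeneous_decomposition_def quot_grading_eq by blast
  then obtain g where g: "\<And>d. g d \<in> hom_part n d" "\<And>d. c d = \<pi> (g d)" by metis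
  have fin: "finite ?X" using c by (simp add: homogeneous_decomposition_def)
  have gp: "g d \<in> polys n" for d using hom_part_closed(4)[OF g(1)] .
  have cg: "c = (\<lambda>d. \<pi> (g d))" using g(2) by auto
  have "\<pi> f = finsum Q c ?X" using c by (simp add: homogeneous_decomposition_def)
  also have "\<dots> = \<pi> (\<Sum>d\<in>?X. g d)"
    using hom_finsum[OF fin gp] by (simp add: cg)
  finally have "f - (\<Sum>d\<in>?X. g d) \<in> I"
    using hom_eq_iff[OF f polys_sum[of ?X g n]] gp by blast
  then have "hom_comp d (f - (\<Sum>d\<in>?X. g d)) \<in> I" unfolding I by (rule hom_comp_support_ideal)
  also have "hom_comp d (f - (\<Sum>d\<in>?X. g d)) = hom_comp d f - (\<Sum>e\<in>?X. if d = e then g e else 0)"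
    unfolding hom_comp_diff hom_comp_sum using hom_comp_hom_part[OF g(1)] by simp
  also have "(\<Sum>e\<in>?X. if d = e then g e else 0) = (if d \<in> ?X then g d else 0)"
    using fin by (simp add: sum.delta)
  finally have *: "hom_comp d f - (if d \<in> ?X then g d else 0) \<in> I" .
  have hp: "hom_comp d f \<in> polys n" using hom_part_closed(4,5) f by blast
  show ?thesis
  proof (cases "d \<in> ?X")
    case True
    then show ?thesis using * hom_eq_iff[OF hp gp[of d]] g(2) by simp
  next
    case False
    then have "hom_comp d f \<in> I" using * by auto
    then show ?thesis using kernel[OF hp] False by simp
  qed
qed

lemma decomposition_exists:
  assumes f: "f \<in> polys n"
  shows "homogeneous_decomposition Q (quot_grading n I) (\<pi> f) (\<lambda>d. \<pi> (hom_comp d f))"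
proof -
  let ?X = "{d. \<pi> (hom_comp d f) \<noteq> \<zero>\<^bsub>Q\<^esub>}" and ?Y = "int ` mdegree ` keys f"
  have hp: "hom_comp d f \<in> polys n" for d using hom_part_closed(4,5) f by blast
  have sub: "?X \<subseteq> ?Y"
  proof
    fix d assume d: "d \<in> ?X"
    show "d \<in> ?Y"
    proof (rule ccontr)
      assume "d \<notin> ?Y"
      then have "keys (hom_comp d f) = {}" by (auto simp: keys_poly_part)
      then have "hom_comp d f = 0" by simp
      then show False using d hom_zero by simp
    qed
  qed
  then have fin: "finite ?X" by (rule finite_subset) simp
  have "f - (\<Sum>d\<in>?X. hom_comp d f) = (\<Sum>d\<in>?Y - ?X. hom_comp d f)"
    using sum_hom_comp[of ?Y f] sum.subset_diff[OF sub, of "\<lambda>d. hom_comp d f"]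
    by (simp add: algebra_simps)
  also have "\<dots> \<in> I" using kernel[OF hp] by (intro ideal_sum[OF I_ideal]) auto
  finally have "\<pi> f = \<pi> (\<Sum>d\<in>?X. hom_comp d f)"
    using hom_eq_iff[OF f polys_sum[of ?X "\<lambda>d. hom_comp d f"]] hp by simp
  also have "\<dots> = finsum Q (\<lambda>d. \<pi> (hom_comp d f)) ?X" by (rule hom_finsum[OF fin hp])
  finally show ?thesis
    using fin hom_part_closed(5)[OF f] unfolding homogeneous_decomposition_def quot_grading_eq by blast
qed

lemma graded_module_Q: "graded_module n Q (quot_grading n I)"
  unfolding graded_module_def
proof (intro conjI allI ballI)
  show "Module.module (mpoly_ring n) Q" by (rule is_module)
  show "subgroup (quot_grading n I d) (add_monoid Q)" for d
    unfolding quot_grading_eq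
  proof (rule add.subgroupI)
    show "\<pi> ` hom_part n d \<subseteq> carrier Q" using hom_part_closed(4) hom_closed by blast
    show "\<pi> ` hom_part n d \<noteq> {}" using hom_part_closed(1) by blast
    fix x assume "x \<in> \<pi> ` hom_part n d"
    then obtain f where f: "f \<in> hom_part n d" "x = \<pi> f" by auto
    have "\<ominus>\<^bsub>Q\<^esub> x = \<pi> (- f)"
      unfolding f(2) by (rule hom_uminus[OF hom_part_closed(4)[OF f(1)], symmetric])
    then show "\<ominus>\<^bsub>Q\<^esub> x \<in> \<pi> ` hom_part n d" using hom_part_closed(3)[OF f(1)] by simp
    fix y assume "y \<in> \<pi> ` hom_part n d"
    then obtain g where g: "g \<in> hom_part n d" "y = \<pi> g" by auto
    have "x \<oplus>\<^bsub>Q\<^esub> y = \<pi> (f + g)"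
      unfolding f(2) g(2)
      by (rule hom_add[OF hom_part_closed(4)[OF f(1)] hom_part_closed(4)[OF g(1)], symmetric])
    then show "x \<oplus>\<^bsub>Q\<^esub> y \<in> \<pi> ` hom_part n d" using hom_part_closed(2)[OF f(1) g(1)] by simp
  qed
  fix e :: nat and d and f :: "monomial \<Rightarrow>\<^sub>0 'k" and u assume f: "f \<in> homogeneous n e" and u: "u \<in> quot_grading n I d"
  have f': "f \<in> hom_part n (int e)" using f by (simp add: hom_part_eq)
  obtain g where g: "g \<in> hom_part n d" "u = \<pi> g" using u unfolding quot_grading_eq by auto
  have "f \<odot>\<^bsub>Q\<^esub> u = \<pi> (f * g)"
    unfolding g(2) by (rule hom_smult[OF hom_part_closed(4)[OF f'] hom_part_closed(4)[OF g(1)], symmetric])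
  then show "f \<odot>\<^bsub>Q\<^esub> u \<in> quot_grading n I (int e + d)"
    unfolding quot_grading_eq using hom_part_mult[OF f' g(1)] by blast
next
  fix u assume "u \<in> carrier Q"
  then obtain f where f: "f \<in> polys n" "u = \<pi> f" using surj by auto
  show "\<exists>!c. homogeneous_decomposition Q (quot_grading n I) u c"
    unfolding f(2) using decomposition_exists[OF f(1)] decomposition_unique[OF f(1)] by blast
qed

lemma graded_submodule_Q:
  assumes V: "up_closed n V"
  shows "graded_submodule n Q (quot_grading n I) (\<pi> ` support_ideal V)"
  unfolding graded_submodule_def
proof (intro conjI ballI allI impI)
  note VI = support_ideal_ideal[OF V, where ?'a = 'k]
  show "submodule (\<pi> ` support_ideal V) (mpoly_ring n) Q"
    using ideal_polys[OF VI] by (intro image_submodule VI) auto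
  fix u c d assume u: "u \<in> \<pi> ` support_ideal V"
    and c: "homogeneous_decomposition Q (quot_grading n I) u c"
  then obtain f where f: "f \<in> support_ideal V" "u = \<pi> f" by auto
  then have "c d = \<pi> (hom_comp d f)" using decomposition_unique ideal_polys[OF VI] c by auto
  then show "c d \<in> \<pi> ` support_ideal V" using hom_comp_support_ideal[OF f(1)] by blast
qed

text \<open>
  The layers of the shelling give the filtration by the images of the corresponding ideals.
\<close>

lemma sequentially_cohen_macaulay_Q:
  assumes "sequentially_shellable n U d (Pow {1..n})"
  shows "sequentially_cohen_macaulay n Q (quot_grading n I)"
proof -
  obtain r :: nat and F e where F: "F 0 = U" "F r = Pow {1..n}"
      "\<forall>i\<in>{1..r}. relatively_shellable n (e i) (F (i - 1)) (F i) \<and> F (i - 1) \<noteq> F i"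
      "\<forall>i\<in>{1..<r}. e i < e (i + 1)"
    using sequentially_shellable_filtration[OF assms] by (elim exE conjE) (rule that)
  have step: "up_closed n (F (i - 1))" "up_closed n (F i)" "F (i - 1) \<subset> F i"
    if "i \<in> {1..r}" for i
    using bspec[OF F(3) that] relatively_shellable_up_closed[of n "e i" "F (i - 1)" "F i"] by auto
  have UF: "up_closed n (F i) \<and> U \<subseteq> F i" if "i \<le> r" for i
    using that
  proof (induction i)
    case 0
    then show ?case using F(1) up by simp
  next
    case (Suc i)
    then show ?case using step(2,3)[of "Suc i"] by auto
  qed
  define N where "N = (\<lambda>i. \<pi> ` support_ideal (F i))"
  have SI: "ideal (support_ideal (F i)) (mpoly_ring n)" "support_ideal (F i) \<subseteq> polys n"
     "I \<subseteq> support_ideal (F i)" if "i \<le> r" for i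
    using support_ideal_ideal[of n "F i"] UF[OF that] ideal_polys support_ideal_mono[of U "F i"]
    unfolding I by auto
  have factor: "cohen_macaulay (mpoly_ring n) (graded_maximal_ideal n) (factor_module Q N i) \<and>
      module_dim (mpoly_ring n) (factor_module Q N i) = enat (e i)" if i: "i \<in> {1..r}" for i
  proof -
    have ir: "i \<le> r" "i - 1 \<le> r" using i by auto
    interpret r: presentation n "support_ideal (F i)" I "restrict_module Q (N i)" \<pi>
      unfolding N_def by (rule presentation_restrict[OF SI(1,3,2)[OF ir(1)]])
    have "presentation n (support_ideal (F i)) (support_ideal (F (i - 1))) (factor_module Q N i)
        (\<lambda>f. N (i - 1) +>\<^bsub>restrict_module Q (N i)\<^esub> \<pi> f)"
      unfolding factor_module_def unfolding N_def[THEN fun_cong, of "i - 1"]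
      using SI(1,3)[OF ir(2)] support_ideal_mono[of "F (i - 1)" "F i"] step(3)[OF i]
      by (intro r.presentation_quot) auto
    then show ?thesis
      using shellable_factor_cohen_macaulay bspec[OF F(3) i] by blast
  qed
  have fg: "finitely_generated (mpoly_ring n) Q"
  proof -
    interpret s: presentation n "support_ideal (Pow {1..n})" "support_ideal U" Q \<pi>
      using presentation_Q unfolding I support_ideal_Pow .
    interpret s: squarefree_presentation n "Pow {1..n}" U Q \<pi>
      by unfold_locales (use up sequentially_shellable_up_closed[OF assms] in auto)
    show ?thesis by (rule s.finitely_generated)
  qed
  show ?thesis
    unfolding sequentially_cohen_macaulay_def
  proof (intro conjI graded_module_Q fg exI[of _ r] exI[of _ N] allI impI ballI)
    show "N 0 = {\<zero>\<^bsub>Q\<^esub>}"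
    proof -
      have "\<pi> f = \<zero>\<^bsub>Q\<^esub>" if "f \<in> I" for f using kernel[of f] that ideal_polys[OF I_ideal that] by simp
      then show ?thesis using ideal_zero[OF I_ideal] unfolding N_def F(1) I[symmetric] by auto
    qed
    show "N r = carrier Q" unfolding N_def F(2) support_ideal_Pow by (rule surj)
    show "graded_submodule n Q (quot_grading n I) (N i)" if "i \<le> r" for i
      unfolding N_def using UF[OF that] by (intro graded_submodule_Q) simp
    show "N (i - 1) \<subset> N i" if i: "i \<in> {1..r}" for i
    proof -
      obtain B where B: "B \<in> F i" "B \<notin> F (i - 1)" using step(3)[OF i] by auto
      have ir: "i \<le> r" "i - 1 \<le> r" using i by auto
      have "finite B" using B(1) up_closed_subset[OF step(2)[OF i]] finite_subset by blast
      then have x: "single (sqfree B) (1::'k) \<in> support_ideal (F i)" "single (sqfree B) (1::'k) \<notin> support_ideal (F (i - 1))"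
        using B by (auto simp: support_ideal_def keys_sqfree)
      then have "\<pi> (single (sqfree B) 1) \<notin> N (i - 1)"
        unfolding N_def using mem_image_iff[OF SI(1,3,2)[OF ir(2)]] SI(2)[OF ir(1)] by blast
      moreover have "N (i - 1) \<subseteq> N i"
        unfolding N_def using support_ideal_mono[of "F (i - 1)" "F i"] step(3)[OF i] by blast
      ultimately show ?thesis using x(1) unfolding N_def by blast
    qed
    show "cohen_macaulay (mpoly_ring n) (graded_maximal_ideal n) (factor_module Q N i)"
      if "i \<in> {1..r}" for i using factor[OF that] by simp
    show "module_dim (mpoly_ring n) (factor_module Q N i) < module_dim (mpoly_ring n) (factor_module Q N (i + 1))"
      if i: "i \<in> {1..<r}" for i
      using factor[of i] factor[of "i + 1"] bspec[OF F(4) i] i by auto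
  qed
qed

end

lemma sequentially_cohen_macaulay_ideal_of_shellable:
  assumes "up_closed n U" "sequentially_shellable n U d (Pow {1..n})"
  shows "sequentially_cohen_macaulay_ideal n (support_ideal U :: (monomial \<Rightarrow>\<^sub>0 'k::field) set)"
proof -
  let ?I = "support_ideal U :: (monomial \<Rightarrow>\<^sub>0 'k) set"
  interpret squarefree_quotient n U ?I "quot_module (self_module (mpoly_ring n)) ?I"
      "\<lambda>f. ?I +>\<^bsub>mpoly_ring n\<^esub> f"
    by unfold_locales (use assms in auto)
  show ?thesis
    unfolding sequentially_cohen_macaulay_ideal_def
    using I_ideal sequentially_cohen_macaulay_Q[OF assms(2)] by blast
qed

section \<open>The lexsegment ideal\<close>

lemma sqfree_less_iff:
  assumes "finite B" "finite C"
  shows "sqfree B < sqfree C \<longleftrightarrow> (\<exists>k. k \<in> C \<and> k \<notin> B \<and> (\<forall>i<k. i \<in> B \<longleftrightarrow> i \<in> C))"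
  unfolding monomial_less_iff lookup_sqfree[OF assms(1)] lookup_sqfree[OF assms(2)]
  by (auto split: if_splits)

lemma mdegree_sqfree: "finite B \<Longrightarrow> mdegree (sqfree B) = card B"
  by (simp add: mdegree_def keys_sqfree lookup_sqfree)

lemma squarefree_monomials_eq: "squarefree_monomials n q = sqfree ` {B. B \<subseteq> {1..n} \<and> card B = q}"
proof (intro equalityI subsetI)
  fix w assume w: "w \<in> squarefree_monomials n q"
  then have l: "\<forall>i. lookup w i \<le> 1" and k: "keys w \<subseteq> {1..n}"
    by (auto simp: squarefree_monomials_def monomials_def)
  have "lookup w i = (if i \<in> keys w then 1 else 0)" for i
    using l[rule_format, of i] by (auto simp: in_keys_iff)
  then have e: "w = sqfree (keys w)" by (intro poly_mapping_eqI) (simp add: lookup_sqfree)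
  then have "card (keys w) = q" using w mdegree_sqfree[of "keys w"] by (simp add: squarefree_monomials_def)
  then show "w \<in> sqfree ` {B. B \<subseteq> {1..n} \<and> card B = q}" using e k by blast
next
  fix w assume "w \<in> sqfree ` {B. B \<subseteq> {1..n} \<and> card B = q}"
  then obtain B where B: "B \<subseteq> {1..n}" "card B = q" "w = sqfree B" by auto
  moreover have "finite B" using finite_subset[OF B(1)] by simp
  ultimately show "w \<in> squarefree_monomials n q"
    by (simp add: squarefree_monomials_def monomials_def keys_sqfree mdegree_sqfree lookup_sqfree)
qed

lemma initial_segment_exists:
  fixes B :: "nat set"
  assumes "finite B" "q \<le> card B"
  shows "\<exists>C\<subseteq>B. card C = q \<and> (\<forall>c\<in>C. \<forall>b\<in>B - C. c < b)"
  using assms(2)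
proof (induction q)
  case 0
  then show ?case by (intro exI[of _ "{}"]) auto
next
  case (Suc q)
  then obtain C where C: "C \<subseteq> B" "card C = q" "\<forall>c\<in>C. \<forall>b\<in>B - C. c < b" by auto
  have "B - C \<noteq> {}"
  proof
    assume "B - C = {}"
    then have "B = C" using C(1) by auto
    then show False using C(2) Suc.prems by simp
  qed
  define m where "m = Min (B - C)"
  have m: "m \<in> B - C" "\<forall>b\<in>B - C. m \<le> b"
    using Min_in[of "B - C"] Min_le[of "B - C"] assms(1) \<open>B - C \<noteq> {}\<close> by (simp_all add: m_def)
  have "finite C" using C(1) assms(1) finite_subset by blast
  moreover have "m < b" if "b \<in> B - insert m C" for b
    using m(2) that by (metis DiffD1 DiffD2 DiffI insertCI le_neq_implies_less)
  ultimately show ?case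
    using C m(1) by (intro exI[of _ "insert m C"]) auto
qed

context lex_position
begin

text \<open>
  If \<open>B\<close> is below \<open>facet j\<close>, then the first difference between \<open>B\<close> and \<open>J\<close> is at most \<open>j\<close> and is an
  element of \<open>J\<close>, which makes the monomial of \<open>B\<close> smaller.
\<close>

lemma lexsegment_nonface:
  assumes B: "B \<subseteq> {1..n}" "card B = q" and ge: "sqfree J \<le> sqfree B"
  shows "B \<in> nonfaces"
proof -
  have fB: "finite B" using finite_subset[OF B(1)] by simp
  have "\<not> B \<subseteq> facet j" if j: "j \<in> J" for j
  proof
    assume BG: "B \<subseteq> facet j"
    have "j \<notin> B" using BG by (auto simp: facet_def)
    then have "\<exists>k. k \<in> J \<and> k \<notin> B" using j by auto
    define k where "k = (LEAST k. k \<in> J \<and> k \<notin> B)"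
    have k: "k \<in> J" "k \<notin> B" using LeastI_ex[OF \<open>\<exists>k. k \<in> J \<and> k \<notin> B\<close>] by (auto simp: k_def)
    have kj: "k \<le> j" unfolding k_def using j \<open>j \<notin> B\<close> by (intro Least_le) auto
    have "i \<in> B \<longleftrightarrow> i \<in> J" if "i < k" for i
    proof
      assume "i \<in> B"
      then show "i \<in> J" using BG that kj by (auto simp: facet_def)
    next
      assume "i \<in> J"
      then show "i \<in> B" using not_less_Least[of i "\<lambda>k. k \<in> J \<and> k \<notin> B"] that by (auto simp: k_def)
    qed
    then have "sqfree B < sqfree J" using k sqfree_less_iff[OF fB finite_J] by blast
    then show False using ge by simp
  qed
  then show ?thesis using B by (auto simp: nonfaces_def avoid_Suc_n)
qed

text \<open>
  The \<open>q\<close> smallest elements \<open>C\<close> of \<open>B\<close> give the largest candidate. If its monomial were smaller than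
  that of \<open>J\<close>, the first difference \<open>k\<close> would be an element of \<open>J\<close>, and \<open>B\<close> would be below \<open>facet k\<close>.
\<close>

lemma nonface_lexsegment:
  assumes B: "B \<in> nonfaces"
  shows "\<exists>C\<subseteq>B. card C = q \<and> sqfree J \<le> sqfree C"
proof -
  have Bn: "B \<subseteq> {1..n}" and nG: "\<And>j. j \<in> J \<Longrightarrow> \<not> B \<subseteq> facet j" and cB: "q \<le> card B"
    using B by (auto simp: nonfaces_def avoid_Suc_n)
  have fB: "finite B" using finite_subset[OF Bn] by simp
  obtain C where C: "C \<subseteq> B" "card C = q" "\<forall>c\<in>C. \<forall>b\<in>B - C. c < b"
    using initial_segment_exists[OF fB cB] by blast
  have fC: "finite C" using C(1) fB finite_subset by blast
  have "\<not> sqfree C < sqfree J"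
  proof
    assume "sqfree C < sqfree J"
    then obtain k where k: "k \<in> J" "k \<notin> C" "\<forall>i<k. i \<in> C \<longleftrightarrow> i \<in> J"
      using sqfree_less_iff[OF fC finite_J] by blast
    \<comment> \<open>Otherwise \<open>C\<close> would be contained in \<open>J - {k}\<close>, which has too few elements.\<close>
    have big: "\<not> (\<forall>c\<in>C. c < k)"
    proof
      assume "\<forall>c\<in>C. c < k"
      then have "C \<subseteq> J - {k}" using k by auto
      then have "card C \<le> card (J - {k})" using finite_J by (intro card_mono) auto
      also have "\<dots> < card J" using k(1) finite_J by (intro card_Diff1_less)
      finally show False using C(2) card_J by simp
    qed
    then obtain c where c: "c \<in> C" "k \<le> c" by auto
    have "b \<in> facet k" if b: "b \<in> B" for b
    proof (cases "b < k")
      case True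
      have "b \<in> C"
      proof (rule ccontr)
        assume "b \<notin> C"
        then have "c < b" using C(3) c(1) b by blast
        then show False using True c(2) by simp
      qed
      then show ?thesis using k(3) True by (auto simp: facet_def)
    next
      case False
      have "b \<noteq> k"
      proof
        assume "b = k"
        then have "c < k" using C(3) c(1) b k(2) by blast
        then show False using c(2) by simp
      qed
      then show ?thesis using False b Bn by (auto simp: facet_def)
    qed
    then show False using nG[OF k(1)] by blast
  qed
  then show ?thesis using C by (intro exI[of _ C]) auto
qed

lemma initial_lexsegment_eq:
  "initial_lexsegment n (sqfree J) = sqfree ` {B. B \<subseteq> {1..n} \<and> card B = q \<and> sqfree J \<le> sqfree B}"
  unfolding initial_lexsegment_def mdegree_sqfree[OF finite_J] card_J squarefree_monomials_eq by auto

lemma initial_lexsegment_ideal_eq: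
  "initial_lexsegment_ideal n (sqfree J) = (support_ideal nonfaces :: (monomial \<Rightarrow>\<^sub>0 'k::field) set)"
proof -
  let ?R = "mpoly_ring n :: (monomial \<Rightarrow>\<^sub>0 'k) ring"
  let ?X = "(\<lambda>w. single w 1) ` initial_lexsegment n (sqfree J) :: (monomial \<Rightarrow>\<^sub>0 'k) set"
  interpret cring ?R by (rule cring_mpoly_ring)
  note S = support_ideal_ideal[OF up_closed_nonfaces, where ?'a = 'k]
  have XS: "?X \<subseteq> support_ideal nonfaces"
  proof
    fix x assume "x \<in> ?X"
    then obtain B where B: "B \<subseteq> {1..n}" "card B = q" "sqfree J \<le> sqfree B" "x = single (sqfree B) 1"
      unfolding initial_lexsegment_eq by auto
    then show "x \<in> support_ideal nonfaces"
      using lexsegment_nonface[OF B(1,2,3)] finite_subset[OF B(1)]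
      by (simp add: support_ideal_def keys_sqfree)
  qed
  then have X: "?X \<subseteq> polys n" using ideal_polys[OF S] by blast
  have Idl: "ideal (Idl\<^bsub>?R\<^esub> ?X) ?R" by (rule genideal_ideal[OF X])
  have "f \<in> Idl\<^bsub>?R\<^esub> ?X" if f: "f \<in> support_ideal nonfaces" for f
  proof -
    have "single t (lookup f t) \<in> Idl\<^bsub>?R\<^esub> ?X" if t: "t \<in> keys f" for t
    proof -
      have tn: "keys t \<in> nonfaces" using f t by (simp add: support_ideal_def)
      then obtain C where C: "C \<subseteq> keys t" "card C = q" "sqfree J \<le> sqfree C"
        using nonface_lexsegment by blast
      have tn': "keys t \<subseteq> {1..n}" by (rule up_closed_subset[OF up_closed_nonfaces tn])
      then have "single (sqfree C) 1 \<in> ?X"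
        unfolding initial_lexsegment_eq using C by blast
      then have x: "single (sqfree C) 1 \<in> Idl\<^bsub>?R\<^esub> ?X" using genideal_self[OF X] by blast
      obtain s where s: "t = s + sqfree C" "keys s \<subseteq> keys t" using sqfree_dvd[OF C(1)] .
      have "single s (lookup f t) \<in> polys n" using s(2) tn' by (auto simp: polys_iff)
      from ideal_mult[OF Idl this x] show ?thesis using s(1) by (simp add: mult_single)
    qed
    then show ?thesis by (rule ideal_memI_terms[OF Idl])
  qed
  moreover have "Idl\<^bsub>?R\<^esub> ?X \<subseteq> support_ideal nonfaces" by (rule genideal_minimal[OF S XS])
  ultimately show ?thesis unfolding initial_lexsegment_ideal_def by blast
qed

end

theorem proposition2p2p4:
  fixes n q :: nat and j :: "nat \<Rightarrow> nat" and v :: monomial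
    and I :: "(monomial \<Rightarrow>\<^sub>0 'k::field) set"
  assumes "q \<ge> 2"
    and "strict_mono_on {1..q} j" and "2 \<le> j 1" and "j q \<le> n"
    and "v = (\<Sum>i\<in>{1..q}. Poly_Mapping.single (j i) 1)"
    and "I = initial_lexsegment_ideal n v"
  shows "sequentially_cohen_macaulay_ideal n I"
proof -
  let ?J = "j ` {1..q}"
  have inj: "inj_on j {1..q}" using assms(2) by (rule strict_mono_on_imp_inj_on)
  have le: "j a \<le> j b" if "a \<in> {1..q}" "b \<in> {1..q}" "a \<le> b" for a b
  proof (cases "a = b")
    case False
    then have "j a < j b" using assms(2) that by (intro strict_mono_onD[of "{1..q}" j]) auto
    then show ?thesis by simp
  qed simp
  interpret lex_position n q ?J
  proof
    show "2 \<le> q" by fact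
    show "?J \<subseteq> {2..n}"
    proof
      fix x assume "x \<in> ?J"
      then obtain i where i: "i \<in> {1..q}" "x = j i" by auto
      then have "j 1 \<le> x" "x \<le> j q" using le[of 1 i] le[of i q] by auto
      then show "x \<in> {2..n}" using assms(3,4) by simp
    qed
    show "card ?J = q" using inj by (simp add: card_image)
  qed
  have "v = sqfree ?J" unfolding sqfree_def assms(5) using inj by (simp add: sum.reindex)
  then have "I = support_ideal nonfaces" using assms(6) initial_lexsegment_ideal_eq by simp
  then show ?thesis
    using sequentially_shellable_nonfaces
      sequentially_cohen_macaulay_ideal_of_shellable[OF up_closed_nonfaces] by blast
qed

end
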